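(* Let $\Gamma$ be a metric graph, and let $D$ be an effective divisor on $\Gamma$. (a) There exist a loopless model $(G,\ell)$ of $\Gamma$ with $\operatorname{supp}(D) \subseteq V(G)$ and a rational length vector $\ell' \in \mathbb{Q}_{>0}^{E(G)}$ such that the $G$-rescaling $D'$ of $D$ in $\Gamma' := \Gamma(G,\ell')$ satisfies $\operatorname{rank}_{\Gamma'}(D') \geq \operatorname{rank}_{\Gamma}(D)$. (b) If $\Gamma$ is a metric $\mathbb{Q}$-graph, then the length vector $\ell'$ in (a) can be chosen in such a way that $\Gamma'$ is isometric to $\Gamma$.
   Context: For a finite multigraph $G$ and $\ell\colon E(G)\to\mathbb{R}_{>0}$, the metric graph $\Gamma(G,\ell)$ is obtained by taking an interval $[0,\ell(e)]$ for each edge $e$ and gluing endpoints as prescribed by $G$, with the shortest path metric. A metric graph is a metric space of this form; if $\Gamma=\Gamma(G,\ell)$ then $(G,\ell)$ is a model of $\Gamma$ (and $V(G)$ is regarded as a subset of $\Gamma$); it is loopless if $G$ has no loops. A metric $\mathbb{Q}$-graph is a metric graph admitting a model with rational edge lengths. Given a model $(G,\ell)$ of $\Gamma$ and another length vector $\ell'\in\mathbb{R}_{>0}^{E(G)}$, the metric graph $\Gamma(G,\ell')$ is a $G$-rescaling of $\Gamma$; if $D$ is a divisor on $\Gamma$ with $\operatorname{supp}(D)\subseteq V(G)$, its $G$-rescaling is the divisor $D'$ on $\Gamma(G,\ell')$ with the same coefficient at each vertex of $G$. A divisor on a metric graph $\Gamma$ is a finitely supported formal $\mathbb{Z}$-combination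 of points of $\Gamma$; its support is the set of points with nonzero coefficient; it is effective if all coefficients are $\geq 0$. A rational function on $\Gamma$ is a continuous piecewise linear $f\colon\Gamma\to\mathbb{R}$ with integer slopes; its principal divisor assigns to each point the sum of the outgoing slopes of $f$ at that point. Two divisors are equivalent if their difference is principal. The rank $\operatorname{rank}_\Gamma(D)$ is the largest integer $k$ such that $D-E$ is equivalent to an effective divisor for every effective divisor $E$ on $\Gamma$ of degree $k$. *)

theory Defs
  imports
    "HOL-Analysis.Analysis"
    "HOL-Library.Poly_Mapping"
    "Graph_Theory.Graph_Theory"
begin

section \<open>Metric graphs\<close>

text \<open>
  A finite multigraph (loops and parallel edges allowed) is represented by a finite digraph. The
  orientation of an edge only serves to identify the edge with an interval: \<open>0\<close> is glued to the
  tail and the length of the edge to the head. Connectivity is that of the underlying undirected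
  graph; it is what makes the shortest path metric finite, and it entails that there is a vertex.
\<close>

definition weighted_multigraph :: "('v, 'e) pre_digraph \<Rightarrow> ('e \<Rightarrow> real) \<Rightarrow> bool" where
  "weighted_multigraph G l \<longleftrightarrow>
     fin_digraph G \<and> Digraph_Component.connected G \<and> (\<forall>e\<in>arcs G. 0 < l e)"

text \<open>
  The points of the glued space are the vertices and the interior points of the edges;
  \<open>edge_point G l e\<close> is the map from the interval \<open>{0..l e}\<close> to the glued space.
\<close>

datatype ('v, 'e) point = Vertex 'v | Interior 'e real

definition edge_point :: "('v, 'e) pre_digraph \<Rightarrow> ('e \<Rightarrow> real) \<Rightarrow> 'e \<Rightarrow> real \<Rightarrow> ('v, 'e) point" where
  "edge_point G l e t =
     (if t = 0 then Vertex (tail G e) else if t = l e then Vertex (head G e) else Interior e t)"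

definition points :: "('v, 'e) pre_digraph \<Rightarrow> ('e \<Rightarrow> real) \<Rightarrow> ('v, 'e) point set" where
  "points G l = Vertex ` verts G \<union> (\<Union>e\<in>arcs G. Interior e ` {0<..<l e})"

text \<open>
  \<open>path_length G l x y r\<close>: some path from \<open>x\<close> to \<open>y\<close>, composed of finitely many segments each of
  which is contained in a single edge, has length \<open>r\<close>.
\<close>

inductive path_length ::
    "('v, 'e) pre_digraph \<Rightarrow> ('e \<Rightarrow> real) \<Rightarrow> ('v, 'e) point \<Rightarrow> ('v, 'e) point \<Rightarrow> real \<Rightarrow> bool"
  for G l where
  trivial: "x \<in> points G l \<Longrightarrow> path_length G l x x 0"
| segment: "\<lbrakk>path_length G l x (edge_point G l e s) r; e \<in> arcs G; s \<in> {0..l e}; t \<in> {0..l e}\<rbrakk>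
    \<Longrightarrow> path_length G l x (edge_point G l e t) (r + \<bar>t - s\<bar>)"

text \<open>The value outside of the carrier is irrelevant, but \<^locale>\<open>Metric_space\<close> requires
  nonnegativity and symmetry everywhere.\<close>

definition path_dist ::
    "('v, 'e) pre_digraph \<Rightarrow> ('e \<Rightarrow> real) \<Rightarrow> ('v, 'e) point \<Rightarrow> ('v, 'e) point \<Rightarrow> real" where
  "path_dist G l x y =
     (if x \<in> points G l \<and> y \<in> points G l then Inf {r. path_length G l x y r} else 0)"

definition metric_graph_of :: "('v, 'e) pre_digraph \<Rightarrow> ('e \<Rightarrow> real) \<Rightarrow> ('v, 'e) point metric" where
  "metric_graph_of G l = metric (points G l, path_dist G l)"

definition isometry :: "'a metric \<Rightarrow> 'b metric \<Rightarrow> ('a \<Rightarrow> 'b) \<Rightarrow> bool" where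
  "isometry X Y \<phi> \<longleftrightarrow> bij_betw \<phi> (mspace X) (mspace Y) \<and>
     (\<forall>x\<in>mspace X. \<forall>y\<in>mspace X. mdist Y (\<phi> x) (\<phi> y) = mdist X x y)"

definition isometric :: "'a metric \<Rightarrow> 'b metric \<Rightarrow> bool" where
  "isometric X Y \<longleftrightarrow> (\<exists>\<phi>. isometry X Y \<phi>)"

text \<open>
  A model of \<open>\<Gamma>\<close> has points of \<open>\<Gamma>\<close> as its vertices, and \<open>\<phi>\<close> identifies the glued space with
  \<open>\<Gamma>\<close> compatibly with this. Edges of models are named by natural numbers, which is no restriction
  since they are finite in number.
\<close>

definition model_via ::
    "'a metric \<Rightarrow> ('a, nat) pre_digraph \<Rightarrow> (nat \<Rightarrow> real) \<Rightarrow> (('a, nat) point \<Rightarrow> 'a) \<Rightarrow> bool" where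
  "model_via \<Gamma> G l \<phi> \<longleftrightarrow>
     weighted_multigraph G l \<and> isometry (metric_graph_of G l) \<Gamma> \<phi> \<and> (\<forall>v\<in>verts G. \<phi> (Vertex v) = v)"

definition model :: "'a metric \<Rightarrow> ('a, nat) pre_digraph \<Rightarrow> (nat \<Rightarrow> real) \<Rightarrow> bool" where
  "model \<Gamma> G l \<longleftrightarrow> (\<exists>\<phi>. model_via \<Gamma> G l \<phi>)"

definition metric_graph :: "'a metric \<Rightarrow> bool" where
  "metric_graph \<Gamma> \<longleftrightarrow> (\<exists>G l. model \<Gamma> G l)"

definition metric_Q_graph :: "'a metric \<Rightarrow> bool" where
  "metric_Q_graph \<Gamma> \<longleftrightarrow> (\<exists>G l. model \<Gamma> G l \<and> (\<forall>e\<in>arcs G. l e \<in> \<rat>))"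


section \<open>Divisors\<close>

text \<open>Finitely supported formal integer combinations are finitely supported functions
  \<open>'a \<Rightarrow>\<^sub>0 int\<close>; the support is \<^const>\<open>Poly_Mapping.keys\<close>.\<close>

definition divisors :: "'a metric \<Rightarrow> ('a \<Rightarrow>\<^sub>0 int) set" where
  "divisors \<Gamma> = {D. Poly_Mapping.keys D \<subseteq> mspace \<Gamma>}"

definition divisor_degree :: "('a \<Rightarrow>\<^sub>0 int) \<Rightarrow> int" where
  "divisor_degree D = (\<Sum>x\<in>Poly_Mapping.keys D. Poly_Mapping.lookup D x)"

definition effective :: "('a \<Rightarrow>\<^sub>0 int) \<Rightarrow> bool" where
  "effective D \<longleftrightarrow> (\<forall>x. 0 \<le> Poly_Mapping.lookup D x)"

text \<open>
  A function on \<open>\<Gamma>\<close> is a rational function, i.e. continuous and piecewise linear with integer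
  slopes, iff some model of \<open>\<Gamma>\<close> (obtained by subdividing at the break points) is such that it is
  affine with integer slope on every closed edge; here \<open>s e\<close> is the slope in the direction from tail to head.
\<close>

definition has_slopes ::
    "('a, nat) pre_digraph \<Rightarrow> (nat \<Rightarrow> real) \<Rightarrow> (('a, nat) point \<Rightarrow> 'a) \<Rightarrow> ('a \<Rightarrow> real)
      \<Rightarrow> (nat \<Rightarrow> int) \<Rightarrow> bool" where
  "has_slopes G l \<phi> f s \<longleftrightarrow> (\<forall>e\<in>arcs G. \<forall>t\<in>{0..l e}.
     f (\<phi> (edge_point G l e t)) = f (\<phi> (edge_point G l e 0)) + of_int (s e) * t)"

text \<open>
  A loop contributes to its vertex at both of its ends. At points that are not vertices of the
  model, the two outgoing slopes cancel, in accordance with the sums below being empty.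
\<close>

definition outgoing_slope_sum :: "('a, nat) pre_digraph \<Rightarrow> (nat \<Rightarrow> int) \<Rightarrow> 'a \<Rightarrow> int" where
  "outgoing_slope_sum G s x =
     (\<Sum>e\<in>{e\<in>arcs G. tail G e = x}. s e) + (\<Sum>e\<in>{e\<in>arcs G. head G e = x}. - s e)"

text \<open>
  \<open>principal_divisor_of \<Gamma> f D\<close>: \<open>f\<close> is a rational function on \<open>\<Gamma>\<close> with principal divisor \<open>D\<close>. The
  outgoing slopes do not depend on the model along whose edges \<open>f\<close> is affine.
\<close>

definition principal_divisor_of :: "'a metric \<Rightarrow> ('a \<Rightarrow> real) \<Rightarrow> ('a \<Rightarrow>\<^sub>0 int) \<Rightarrow> bool" where
  "principal_divisor_of \<Gamma> f D \<longleftrightarrow> (\<exists>G l \<phi> s. model_via \<Gamma> G l \<phi> \<and> has_slopes G l \<phi> f s \<and>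
     (\<forall>x. Poly_Mapping.lookup D x = outgoing_slope_sum G s x))"

definition principal :: "'a metric \<Rightarrow> ('a \<Rightarrow>\<^sub>0 int) \<Rightarrow> bool" where
  "principal \<Gamma> D \<longleftrightarrow> (\<exists>f. principal_divisor_of \<Gamma> f D)"

definition equivalent :: "'a metric \<Rightarrow> ('a \<Rightarrow>\<^sub>0 int) \<Rightarrow> ('a \<Rightarrow>\<^sub>0 int) \<Rightarrow> bool" where
  "equivalent \<Gamma> D D' \<longleftrightarrow> principal \<Gamma> (D - D')"

text \<open>The rank is \<open>-1\<close> if \<open>D\<close> is not equivalent to an effective divisor, because there are no
  effective divisors of negative degree.\<close>

definition divisor_rank :: "'a metric \<Rightarrow> ('a \<Rightarrow>\<^sub>0 int) \<Rightarrow> int" where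
  "divisor_rank \<Gamma> D = (GREATEST k. \<forall>E\<in>divisors \<Gamma>. effective E \<and> divisor_degree E = k \<longrightarrow>
     (\<exists>F\<in>divisors \<Gamma>. effective F \<and> equivalent \<Gamma> (D - E) F))"

text \<open>The divisor on \<open>metric_graph_of G l'\<close> (for any \<open>l'\<close>) with the same coefficients at the
  vertices as \<open>D\<close>, where the support of \<open>D\<close> consists of vertices of \<open>G\<close>.\<close>

definition rescaled_divisor :: "('v \<Rightarrow>\<^sub>0 int) \<Rightarrow> ('v, 'e) point \<Rightarrow>\<^sub>0 int" where
  "rescaled_divisor D = frag_extend (\<lambda>v. frag_of (Vertex v)) D"

lemma lookup_rescaled_divisor:
  fixes D :: "'v \<Rightarrow>\<^sub>0 int"
  shows "Poly_Mapping.lookup (rescaled_divisor D :: ('v, 'e) point \<Rightarrow>\<^sub>0 int) (Vertex v)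
      = Poly_Mapping.lookup D v"
    and "Poly_Mapping.lookup (rescaled_divisor D :: ('v, 'e) point \<Rightarrow>\<^sub>0 int) (Interior e t) = 0"
proof -
  have "Poly_Mapping.lookup (rescaled_divisor D :: ('v, 'e) point \<Rightarrow>\<^sub>0 int) x
      = (\<Sum>i\<in>Poly_Mapping.keys D. if Vertex i = x then Poly_Mapping.lookup D i else 0)" for x
    unfolding rescaled_divisor_def frag_extend_def
    by (auto simp: lookup_sum intro!: sum.cong)
  then show "Poly_Mapping.lookup (rescaled_divisor D :: ('v, 'e) point \<Rightarrow>\<^sub>0 int) (Vertex v)
      = Poly_Mapping.lookup D v"
    "Poly_Mapping.lookup (rescaled_divisor D :: ('v, 'e) point \<Rightarrow>\<^sub>0 int) (Interior e t) = 0"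
    by (auto simp: in_keys_iff)
qed


section \<open>The glued space is a metric space\<close>

lemma edge_point_in_points:
  assumes "weighted_multigraph G l" "e \<in> arcs G" "t \<in> {0..l e}"
  shows "edge_point G l e t \<in> points G l"
proof -
  interpret fin_digraph G using assms(1) by (simp add: weighted_multigraph_def)
  show ?thesis using assms(2,3) by (force simp: edge_point_def points_def)
qed

lemma path_length_nonneg: "path_length G l x y r \<Longrightarrow> 0 \<le> r"
  by (induction rule: path_length.induct) auto

lemma path_length_points:
  assumes "weighted_multigraph G l" "path_length G l x y r"
  shows "x \<in> points G l \<and> y \<in> points G l"
  using assms(2) by (induction rule: path_length.induct) (auto intro: edge_point_in_points[OF assms(1)])

lemma path_length_trans:
  assumes "path_length G l y z r'" "path_length G l x y r"
  shows "path_length G l x z (r + r')"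
  using assms
proof (induction rule: path_length.induct)
  case (trivial y)
  then show ?case by simp
next
  case (segment y e s r' t)
  then show ?case
    using path_length.segment[of G l x e s "r + r'" t] by (simp add: add.assoc)
qed

lemma path_length_sym:
  assumes "weighted_multigraph G l" "path_length G l x y r"
  shows "path_length G l y x r"
  using assms(2)
proof (induction rule: path_length.induct)
  case (trivial x)
  then show ?case by (rule path_length.trivial)
next
  case (segment x e s r t)
  have "path_length G l (edge_point G l e t) (edge_point G l e t) 0"
    using segment assms(1) by (intro path_length.trivial edge_point_in_points)
  then have "path_length G l (edge_point G l e t) (edge_point G l e s) (0 + \<bar>s - t\<bar>)"
    using segment by (intro path_length.segment) auto
  with segment.IH show ?case
    using path_length_trans by (fastforce simp: add.commute abs_minus_commute)
qed

lemma path_length_edge: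
  assumes "weighted_multigraph G l" "e \<in> arcs G" "s \<in> {0..l e}" "t \<in> {0..l e}"
  shows "\<exists>r. path_length G l (edge_point G l e s) (edge_point G l e t) r"
  using path_length.segment[OF path_length.trivial[OF edge_point_in_points[OF assms(1-3)]] assms(2-4)]
  by blast

lemma path_length_tail_head:
  assumes "weighted_multigraph G l" "e \<in> arcs G"
  shows "\<exists>r. path_length G l (Vertex (tail G e)) (Vertex (head G e)) r"
proof -
  have "0 < l e" using assms by (auto simp: weighted_multigraph_def)
  then show ?thesis
    using path_length_edge[OF assms, of 0 "l e"] by (auto simp: edge_point_def)
qed

lemma path_length_verts:
  assumes wm: "weighted_multigraph G l" and "u \<in> verts G" "v \<in> verts G"
  shows "\<exists>r. path_length G l (Vertex u) (Vertex v) r"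
proof -
  interpret fin_digraph G using wm by (simp add: weighted_multigraph_def)
  have "u \<rightarrow>\<^sup>*\<^bsub>with_proj (mk_symmetric G)\<^esub> v"
    using assms by (auto simp: weighted_multigraph_def Digraph_Component.connected_def strongly_connected_def)
  then have "(u, v) \<in> rtrancl_on (verts G) (parcs (mk_symmetric G))"
    by (simp add: reachable_def)
  then show ?thesis
  proof (induction rule: rtrancl_on.induct)
    case (rtrancl_on_refl a)
    then have "path_length G l (Vertex a) (Vertex a) 0"
      by (intro path_length.trivial) (auto simp: points_def)
    then show ?case ..
  next
    case (rtrancl_on_into_rtrancl_on a b c)
    have "\<exists>r. path_length G l (Vertex b) (Vertex c) r"
      using rtrancl_on_into_rtrancl_on(2) path_length_tail_head[OF wm] path_length_sym[OF wm]
      by (fastforce simp: mk_symmetric_def)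
    with rtrancl_on_into_rtrancl_on.IH show ?case using path_length_trans by blast
  qed
qed

lemma path_length_to_vertex:
  assumes wm: "weighted_multigraph G l" and "x \<in> points G l"
  shows "\<exists>v\<in>verts G. \<exists>r. path_length G l x (Vertex v) r"
proof -
  interpret fin_digraph G using wm by (simp add: weighted_multigraph_def)
  from assms(2) consider v where "v \<in> verts G" "x = Vertex v"
    | e t where "e \<in> arcs G" "0 < t" "t < l e" "x = Interior e t"
    by (auto simp: points_def)
  then show ?thesis
  proof cases
    case 1
    then show ?thesis using path_length.trivial[OF assms(2)] by blast
  next
    case 2
    then have "\<exists>r. path_length G l x (Vertex (tail G e)) r"
      using path_length_edge[OF wm, of e t 0] by (auto simp: edge_point_def)
    with 2 show ?thesis by auto
  qed
qed

lemma path_length_ex: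
  assumes wm: "weighted_multigraph G l" and "x \<in> points G l" "y \<in> points G l"
  shows "\<exists>r. path_length G l x y r"
proof -
  obtain u r where u: "u \<in> verts G" "path_length G l x (Vertex u) r"
    using path_length_to_vertex assms by blast
  obtain v r' where v: "v \<in> verts G" "path_length G l y (Vertex v) r'"
    using path_length_to_vertex assms by blast
  obtain r'' where "path_length G l (Vertex u) (Vertex v) r''"
    using path_length_verts[OF wm u(1) v(1)] by blast
  then show ?thesis
    using path_length_trans[OF path_length_sym[OF wm v(2)] path_length_trans[OF _ u(2)]] by blast
qed

lemma path_length_lipschitz:
  assumes "path_length G l x y r"
    and "\<And>e s t. \<lbrakk>e \<in> arcs G; s \<in> {0..l e}; t \<in> {0..l e}\<rbrakk>
      \<Longrightarrow> \<bar>g (edge_point G l e t) - g (edge_point G l e s)\<bar> \<le> \<bar>t - s\<bar>"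
  shows "\<bar>g y - g x :: real\<bar> \<le> r"
  using assms(1)
proof (induction rule: path_length.induct)
  case (segment x e s r t)
  then show ?case using assms(2)[of e s t] by linarith
qed simp

lemma path_length_ge_Interior:
  fixes G :: "('a, 'b) pre_digraph"
  assumes wm: "weighted_multigraph G l" and y: "Interior e t \<in> points G l" "x \<noteq> Interior e t"
  shows "\<exists>d>0. \<forall>r. path_length G l x (Interior e t) r \<longrightarrow> d \<le> r"
proof -
  have t: "e \<in> arcs G" "0 < t" "t < l e" using y by (auto simp: points_def)
  define m where "m = min t (l e - t)"
  define g :: "('a, 'b) point \<Rightarrow> real" where "g = (\<lambda>z. case z of Vertex v \<Rightarrow> 0
    | Interior e' s \<Rightarrow> if e' = e then max 0 (m - \<bar>s - t\<bar>) else 0)"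
  have g: "g (edge_point G l e' s) = (if e' = e then max 0 (m - \<bar>s - t\<bar>) else 0)"
    if "e' \<in> arcs G" "s \<in> {0..l e'}" for e' s
    using that t by (auto simp: g_def edge_point_def m_def)
  have "\<bar>g (Interior e t) - g x\<bar> \<le> r" if "path_length G l x (Interior e t) r" for r
    using that by (rule path_length_lipschitz) (auto simp: g)
  moreover have "g x < g (Interior e t)"
    using y(2) t by (auto simp: g_def m_def split: point.split)
  ultimately show ?thesis by (intro exI[of _ "g (Interior e t) - g x"]) force
qed

lemma path_length_ge_Vertex:
  assumes wm: "weighted_multigraph G l" and "u \<noteq> v"
  shows "\<exists>d>0. \<forall>r. path_length G l (Vertex u) (Vertex v) r \<longrightarrow> d \<le> r"
proof -
  interpret fin_digraph G using wm by (simp add: weighted_multigraph_def)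
  define m where "m = Min (insert 1 (l ` arcs G))"
  have m: "0 < m" using wm by (auto simp: m_def weighted_multigraph_def)
  have ml: "m \<le> l e" if "e \<in> arcs G" for e using that by (auto simp: m_def)
  define h where "h = (\<lambda>e s. max (if tail G e = v then max 0 (m - s) else 0)
    (if head G e = v then max 0 (m - (l e - s)) else 0))"
  define g where "g = (\<lambda>z. case z of Vertex w \<Rightarrow> if w = v then m else 0 | Interior e s \<Rightarrow> h e s)"
  have g: "g (edge_point G l e s) = h e s" if "e \<in> arcs G" "s \<in> {0..l e}" for e s
    using that m ml[of e] by (auto simp: g_def edge_point_def h_def)
  have h: "\<bar>h e t - h e s\<bar> \<le> \<bar>t - s\<bar>" for e s t
    unfolding h_def max_def by (smt (verit))
  have "\<bar>g (Vertex v) - g (Vertex u)\<bar> \<le> r" if "path_length G l (Vertex u) (Vertex v) r" for r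
    using that by (rule path_length_lipschitz) (use g h in auto)
  then show ?thesis using m \<open>u \<noteq> v\<close> by (intro exI[of _ m]) (auto simp: g_def)
qed

lemma path_length_ge:
  assumes wm: "weighted_multigraph G l" and "x \<in> points G l" "y \<in> points G l" "x \<noteq> y"
  shows "\<exists>d>0. \<forall>r. path_length G l x y r \<longrightarrow> d \<le> r"
proof (cases y)
  case (Interior e t)
  then show ?thesis using path_length_ge_Interior[OF wm] assms by blast
next
  case y: (Vertex v)
  show ?thesis
  proof (cases x)
    case (Vertex u)
    then show ?thesis using path_length_ge_Vertex[OF wm] y assms by blast
  next
    case (Interior e t)
    then show ?thesis
      using path_length_ge_Interior[OF wm, of e t y] path_length_sym[OF wm] assms by blast
  qed
qed

theorem Metric_space_path_dist:
  assumes wm: "weighted_multigraph G l"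
  shows "Metric_space (points G l) (path_dist G l)"
proof
  have bdd: "bdd_below {r. path_length G l x y r}" for x y
    by (intro bdd_belowI[of _ 0]) (auto intro: path_length_nonneg)
  fix x y z
  show "0 \<le> path_dist G l x y"
    using path_length_ex[OF wm, of x y]
    by (auto simp: path_dist_def intro!: cInf_greatest intro: path_length_nonneg)
  show "path_dist G l x y = path_dist G l y x"
    using path_length_sym[OF wm] by (auto simp: path_dist_def intro!: arg_cong[of _ _ Inf])
  show "path_dist G l x y = 0 \<longleftrightarrow> x = y" if xy: "x \<in> points G l" "y \<in> points G l"
  proof
    assume 0: "path_dist G l x y = 0"
    show "x = y"
    proof (rule ccontr)
      assume "x \<noteq> y"
      then obtain d where d: "0 < d" "\<And>r. path_length G l x y r \<Longrightarrow> d \<le> r"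
        using path_length_ge[OF wm xy] by blast
      then have "d \<le> path_dist G l x y"
        using path_length_ex[OF wm xy] xy by (auto simp: path_dist_def intro!: cInf_greatest)
      with 0 d(1) show False by simp
    qed
  next
    assume "x = y"
    then have "path_dist G l x y \<le> 0"
      using xy path_length.trivial[of x G l] bdd by (auto simp: path_dist_def intro!: cInf_lower)
    with \<open>0 \<le> path_dist G l x y\<close> show "path_dist G l x y = 0" by simp
  qed
  show "path_dist G l x z \<le> path_dist G l x y + path_dist G l y z"
    if xyz: "x \<in> points G l" "y \<in> points G l" "z \<in> points G l"
  proof -
    have le: "path_dist G l x z \<le> r + r'"
      if "path_length G l x y r" "path_length G l y z r'" for r r'
      using xyz path_length_trans[OF that(2,1)] bdd by (auto simp: path_dist_def intro!: cInf_lower)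
    have "path_dist G l x z - r \<le> path_dist G l y z" if "path_length G l x y r" for r
      unfolding path_dist_def[of G l y z]
      using le[OF that] path_length_ex[OF wm xyz(2,3)] xyz
      by (auto intro!: cInf_greatest) (smt (verit))
    then have "path_dist G l x z - path_dist G l y z \<le> r" if "path_length G l x y r" for r
      using that by (force simp: algebra_simps)
    then have "path_dist G l x z - path_dist G l y z \<le> path_dist G l x y"
      unfolding path_dist_def[of G l x y]
      using path_length_ex[OF wm xyz(1,2)] xyz by (auto intro!: cInf_greatest)
    then show ?thesis by simp
  qed
qed

lemma mspace_metric_graph_of: "weighted_multigraph G l \<Longrightarrow> mspace (metric_graph_of G l) = points G l"
  and mdist_metric_graph_of: "weighted_multigraph G l \<Longrightarrow> mdist (metric_graph_of G l) = path_dist G l"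
  by (simp_all add: metric_graph_of_def Metric_space.mspace_metric Metric_space.mdist_metric
      Metric_space_path_dist)

end

theory Submission
  imports Defs
begin

text \<open>
  Fix a loopless model \<open>G0\<close> of \<open>\<Gamma>\<close>, with rational edge lengths in part (b). Its vertices are
  rank-determining: to bound the rank from below by \<open>k\<close> it suffices to consider the finitely many
  effective divisors \<open>E\<close> of degree \<open>k\<close> supported on them. For each of these choose a rational
  function that witnesses that \<open>D - E\<close> is equivalent to an effective divisor, and let \<open>G\<close> be a
  common subdivision of \<open>G0\<close> along whose edges all these functions are affine. The edge lengths of
  \<open>G\<close> and the values of the functions at the vertices solve the linear equations with integer
  coefficients \<open>f (head e) - f (tail e) = s e * l e\<close>. Applying to such a solution a \<open>\<rat>\<close>-linear map
  \<open>T\<close> with \<open>T 1 = 1\<close> that maps each \<open>l e\<close> to a rational number close to it preserves these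
  equations, so that the functions survive on the rescaled graph, where the vertices of \<open>G0\<close> are
  still rank-determining. As \<open>T\<close> fixes the rational numbers, the total lengths of the edges of \<open>G0\<close>
  do not change in case (b).
\<close>

section \<open>Small spheres in a metric graph\<close>

text \<open>Principality refers to some model along which the function is affine, so different
  functions come with unrelated models. What makes them comparable is metric: on a small sphere
  around \<open>x\<close> the differences \<open>f y - f x\<close> add up to the radius times the
  coefficient at \<open>x\<close>. This gives independence of the model. Together with the two-point
  spheres around interior points it also shows that a function affine along one model is affine
  along every model with more vertices, so a common subdivision only amounts to enlarging a vertex
  set.

  Looplessness is what lets the vertices determine the rank: the argument moves two chips towards
  each other along an edge, one from each side, and on a loop both could be the same chip at its
  only vertex.

  Positivity of the new lengths is the reason for approximating. The rank is carried over by the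
  exactness of the linear relations; no limit argument occurs. As \<open>T\<close> is in general
  discontinuous, it acts on lengths and vertex values, never on a function along an edge.\<close>

lemma connected_iff_closed:
  assumes "wf_digraph G"
  shows "Digraph_Component.connected G \<longleftrightarrow> verts G \<noteq> {} \<and>
    (\<forall>S\<subseteq>verts G. S \<noteq> {} \<longrightarrow> (\<forall>e\<in>arcs G. tail G e \<in> S \<longleftrightarrow> head G e \<in> S) \<longrightarrow> S = verts G)"
    (is "?L \<longleftrightarrow> ?R")
proof
  interpret wf_digraph G by fact
  let ?r = "rtrancl_on (verts G) ((arcs_ends G)\<^sup>s)"
  show ?R if L: ?L
  proof (intro conjI allI impI)
    show "verts G \<noteq> {}" using L by (simp add: connected_conv)
    fix S assume S: "S \<subseteq> verts G" "S \<noteq> {}" "\<forall>e\<in>arcs G. tail G e \<in> S \<longleftrightarrow> head G e \<in> S"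
    then obtain u where u: "u \<in> S" by auto
    have "v \<in> S" if "(u, v) \<in> ?r" for v
      using that
    proof (induction rule: rtrancl_on_induct)
      case (step y z)
      then show ?case using S(3) by (auto simp: symcl_def arcs_ends_conv)
    qed (use u in auto)
    then show "S = verts G" using L S u by (auto simp: connected_conv)
  qed
  show ?L if R: ?R
    unfolding connected_conv
  proof (intro conjI ballI)
    show "verts G \<noteq> {}" using R by simp
    fix u v assume uv: "u \<in> verts G" "v \<in> verts G"
    \<comment> \<open>Reachability in the symmetric closure gives a set that no arc can leave in
      either direction.\<close>
    define S where "S = {w. (u, w) \<in> ?r}"
    have "tail G e \<in> S \<longleftrightarrow> head G e \<in> S" if "e \<in> arcs G" for e
    proof -
      have "(tail G e, head G e) \<in> (arcs_ends G)\<^sup>s" "(head G e, tail G e) \<in> (arcs_ends G)\<^sup>s"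
        using that by (force simp: symcl_def arcs_ends_conv)+
      then show ?thesis using that
        by (auto simp: S_def intro: rtrancl_on_into_rtrancl_on)
    qed
    moreover have "S \<subseteq> verts G" by (auto simp: S_def dest: in_rtrancl_on_in_F)
    moreover have "u \<in> S" using uv by (auto simp: S_def)
    ultimately have "S = verts G" using R by auto
    then show "(u, v) \<in> ?r" using uv by (auto simp: S_def)
  qed
qed

lemma weighted_multigraph_fin_digraph: "weighted_multigraph G l \<Longrightarrow> fin_digraph G"
  and weighted_multigraph_pos: "weighted_multigraph G l \<Longrightarrow> e \<in> arcs G \<Longrightarrow> 0 < l e"
  and weighted_multigraph_finite_verts: "weighted_multigraph G l \<Longrightarrow> finite (verts G)"
  and weighted_multigraph_finite_arcs: "weighted_multigraph G l \<Longrightarrow> finite (arcs G)"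
  and weighted_multigraph_tail: "weighted_multigraph G l \<Longrightarrow> e \<in> arcs G \<Longrightarrow> tail G e \<in> verts G"
  and weighted_multigraph_head: "weighted_multigraph G l \<Longrightarrow> e \<in> arcs G \<Longrightarrow> head G e \<in> verts G"
  by (auto simp: weighted_multigraph_def fin_digraph_def fin_digraph_axioms_def wf_digraph_def)

lemma weighted_multigraph_verts_nonempty: "weighted_multigraph G l \<Longrightarrow> verts G \<noteq> {}"
  by (simp add: weighted_multigraph_def connected_conv)

lemma points_cases:
  assumes "x \<in> points G l"
  obtains v where "v \<in> verts G" "x = Vertex v"
  | e t where "e \<in> arcs G" "0 < t" "t < l e" "x = Interior e t" "x = edge_point G l e t"
  using assms by (auto simp: points_def edge_point_def)

lemma edge_point_0 [simp]: "edge_point G l e 0 = Vertex (tail G e)"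
  by (simp add: edge_point_def)

lemma edge_point_end: "0 < l e \<Longrightarrow> edge_point G l e (l e) = Vertex (head G e)"
  by (simp add: edge_point_def)

lemma edge_point_interior [simp]: "0 < t \<Longrightarrow> t < l e \<Longrightarrow> edge_point G l e t = Interior e t"
  by (simp add: edge_point_def)

lemma path_dist_le:
  assumes "weighted_multigraph G l" "path_length G l x y r"
  shows "path_dist G l x y \<le> r"
  using path_length_points[OF assms] assms(2)
  by (auto simp: path_dist_def intro!: cInf_lower bdd_belowI[of _ 0] intro: path_length_nonneg)

lemma path_length_edge_points:
  assumes "weighted_multigraph G l" "e \<in> arcs G" "s \<in> {0..l e}" "t \<in> {0..l e}"
  shows "path_length G l (edge_point G l e s) (edge_point G l e t) \<bar>t - s\<bar>"
  using path_length.segment[OF path_length.trivial[OF edge_point_in_points[OF assms(1-3)]] assms(2-4)]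
  by simp

lemma path_dist_edge_points_le:
  assumes "weighted_multigraph G l" "e \<in> arcs G" "s \<in> {0..l e}" "t \<in> {0..l e}"
  shows "path_dist G l (edge_point G l e s) (edge_point G l e t) \<le> \<bar>t - s\<bar>"
  by (rule path_dist_le[OF assms(1) path_length_edge_points[OF assms]])

lemma path_dist_lipschitz:
  assumes wm: "weighted_multigraph G l" and "x \<in> points G l" "y \<in> points G l"
    and "\<And>e s t. \<lbrakk>e \<in> arcs G; s \<in> {0..l e}; t \<in> {0..l e}\<rbrakk>
      \<Longrightarrow> \<bar>g (edge_point G l e t) - g (edge_point G l e s)\<bar> \<le> \<bar>t - s\<bar>"
  shows "\<bar>g y - g x :: real\<bar> \<le> path_dist G l x y"
  using path_length_ex[OF wm assms(2,3)] path_length_lipschitz[OF _ assms(4)] assms(2,3)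
  by (auto simp: path_dist_def intro!: cInf_greatest)

lemma path_dist_self:
  assumes "weighted_multigraph G l" "x \<in> points G l"
  shows "path_dist G l x x = 0"
  using Metric_space_path_dist[OF assms(1)] assms(2) by (simp add: Metric_space.zero)

lemma Vertex_in_points [simp]: "Vertex v \<in> points G l \<longleftrightarrow> v \<in> verts G"
  and Interior_in_points [simp]: "Interior e t \<in> points G l \<longleftrightarrow> e \<in> arcs G \<and> 0 < t \<and> t < l e"
  by (auto simp: points_def image_iff)

text \<open>Segments of the edge bound the distances from above. The bound from below comes from the
  1-Lipschitz function \<open>g\<close>, the distance along the edge truncated at \<open>m\<close>,
  so that it is constant outside the edge. Since \<open>r < m\<close>, a point at distance
  \<open>r\<close> cannot have left the edge, and there the two bounds meet.\<close>

lemma sphere_Interior: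
  fixes G :: "('a, 'b) pre_digraph"
  assumes wm: "weighted_multigraph G l" and e: "e \<in> arcs G" "0 < t" "t < l e"
    and r: "0 < r" "r < t" "r < l e - t"
  shows "{y \<in> points G l. path_dist G l (Interior e t) y = r} = {Interior e (t + r), Interior e (t - r)}"
proof -
  define m where "m = min t (l e - t)"
  define g :: "('a, 'b) point \<Rightarrow> real" where
    "g = (\<lambda>z. case z of Vertex v \<Rightarrow> m | Interior e' s \<Rightarrow> if e' = e then min m \<bar>s - t\<bar> else m)"
  have g: "g (edge_point G l e' s) = (if e' = e then min m \<bar>s - t\<bar> else m)"
    if "e' \<in> arcs G" "s \<in> {0..l e'}" for e' s
    using that e by (auto simp: g_def edge_point_def m_def)
  have ge: "\<bar>g y - g (Interior e t)\<bar> \<le> path_dist G l (Interior e t) y" if "y \<in> points G l" for y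
    by (rule path_dist_lipschitz[OF wm _ that]) (use e in \<open>auto simp: g\<close>)
  have le: "path_dist G l (Interior e t) (Interior e s) \<le> \<bar>s - t\<bar>" if "0 < s" "s < l e" for s
    using path_dist_edge_points_le[OF wm e(1), of t s] that e by simp
  have gt: "g (Interior e t) = 0" using e by (simp add: g_def m_def)
  have m: "r < m" using r by (simp add: m_def)
  show ?thesis
  proof (intro set_eqI iffI)
    fix y assume y: "y \<in> {y \<in> points G l. path_dist G l (Interior e t) y = r}"
    then have "g y \<le> r" using ge[of y] gt by auto
    then obtain s where s: "y = Interior e s" "\<bar>s - t\<bar> \<le> r"
      using m by (auto simp: g_def split: point.splits if_splits)
    then have "r \<le> \<bar>s - t\<bar>" using y le[of s] by (auto)
    with s show "y \<in> {Interior e (t + r), Interior e (t - r)}" by auto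
  next
    fix y :: "('a, 'b) point" assume "y \<in> {Interior e (t + r), Interior e (t - r)}"
    then obtain s where s: "y = Interior e s" "\<bar>s - t\<bar> = r" "0 < s" "s < l e" using r by auto
    then have "y \<in> points G l" using e by simp
    moreover have "g y = r" using s m by (simp add: g_def)
    ultimately show "y \<in> {y \<in> points G l. path_dist G l (Interior e t) y = r}"
      using le[of s] ge[of y] gt s by auto
  qed
qed

text \<open>The same two bounds, with the truncated distance to \<open>v\<close> along the arcs
  incident to it. The condition \<open>2 * r < l e\<close> separates the two ends of an arc, which
  matters for loops at \<open>v\<close>.\<close>

lemma sphere_Vertex:
  fixes G :: "('a, 'b) pre_digraph"
  assumes wm: "weighted_multigraph G l" and v: "v \<in> verts G"
    and r: "0 < r" "\<And>e. e \<in> arcs G \<Longrightarrow> 2 * r < l e"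
  shows "{y \<in> points G l. path_dist G l (Vertex v) y = r}
    = (\<lambda>e. Interior e r) ` {e\<in>arcs G. tail G e = v} \<union> (\<lambda>e. Interior e (l e - r)) ` {e\<in>arcs G. head G e = v}"
    (is "?L = ?R")
proof -
  \<comment> \<open>A truncation level that no arc length falls below; the extra element keeps the
    minimum meaningful, and above \<open>2 * r\<close>, for a graph without arcs.\<close>
  define m where "m = Min (insert (2 * r + 1) (l ` arcs G))"
  have fin: "finite (arcs G)" using wm by (rule weighted_multigraph_finite_arcs)
  have m: "2 * r < m" using r fin by (auto simp: m_def)
  have ml: "m \<le> l e" if "e \<in> arcs G" for e using that fin by (auto simp: m_def)
  define h where "h = (\<lambda>e s. min m (min (if tail G e = v then s else m) (if head G e = v then l e - s else m)))"
  define g where "g = (\<lambda>z. case z of Vertex w \<Rightarrow> if w = v then 0 else m | Interior e s \<Rightarrow> h e s)"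
  have g: "g (edge_point G l e s) = h e s" if "e \<in> arcs G" "s \<in> {0..l e}" for e s
    using that m r(1) ml[of e] by (auto simp: g_def edge_point_def h_def)
  have h: "\<bar>h e t - h e s\<bar> \<le> \<bar>t - s\<bar>" for e s t
    unfolding h_def min_def by (smt (verit))
  have ge: "\<bar>g y - g (Vertex v)\<bar> \<le> path_dist G l (Vertex v) y" if "y \<in> points G l" for y
    by (rule path_dist_lipschitz[OF wm _ that]) (use v h g in auto)
  have gv: "g (Vertex v) = 0" by (simp add: g_def)
  have le1: "path_dist G l (Vertex v) (Interior e s) \<le> s"
    if "e \<in> arcs G" "tail G e = v" "0 < s" "s < l e" for e s
    using path_dist_edge_points_le[OF wm that(1), of 0 s] that by simp
  have le2: "path_dist G l (Vertex v) (Interior e s) \<le> l e - s"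
    if "e \<in> arcs G" "head G e = v" "0 < s" "s < l e" for e s
    using path_dist_edge_points_le[OF wm that(1), of "l e" s] that by (simp add: edge_point_end)
  show ?thesis
  proof (intro set_eqI iffI)
    fix y assume y: "y \<in> ?L"
    then have yr: "g y \<le> r" using ge[of y] gv by auto
    have yp: "y \<in> points G l" using y by simp
    have "y \<noteq> Vertex v" using y path_dist_self[OF wm] r(1) v by auto
    then obtain e s where s: "y = Interior e s" "h e s \<le> r"
      using m r(1) yr by (auto simp: g_def split: point.splits if_splits)
    then have es: "e \<in> arcs G" "0 < s" "s < l e" using yp by auto
    have "tail G e = v \<and> s \<le> r \<or> head G e = v \<and> l e - s \<le> r"
      using s(2) m r(1) by (auto simp: h_def min_def split: if_splits)
    then have "tail G e = v \<and> s = r \<or> head G e = v \<and> l e - s = r"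
      using le1[of e s] le2[of e s] es s(1) y by auto
    then show "y \<in> ?R" using s(1) es by auto
  next
    fix y assume "y \<in> ?R"
    then obtain e s where s: "y = Interior e s" "e \<in> arcs G"
      "tail G e = v \<and> s = r \<or> head G e = v \<and> l e - s = r" by force
    then have s': "0 < s" "s < l e" using r(2)[of e] r(1) by auto
    have yp: "y \<in> points G l" using s s' by simp
    have "g y = r" using s r m ml[of e] by (auto simp: g_def h_def)
    moreover have "path_dist G l (Vertex v) y \<le> r"
      using le1[of e s] le2[of e s] s s' by auto
    ultimately show "y \<in> ?L" using ge[OF yp] gv yp by auto
  qed
qed

text \<open>For small \<open>r\<close> this set has one point for each direction out of
  \<open>x\<close>, so sums over it replace sums over incident arcs without mention of a
  model.\<close>

definition msphere :: "'a metric \<Rightarrow> 'a \<Rightarrow> real \<Rightarrow> 'a set" where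
  "msphere \<Gamma> x r = {y \<in> mspace \<Gamma>. mdist \<Gamma> x y = r}"

section \<open>Points and spheres of a metric graph seen through a model\<close>

lemma model_via_weighted: "model_via \<Gamma> G l \<phi> \<Longrightarrow> weighted_multigraph G l"
  and model_via_Vertex: "model_via \<Gamma> G l \<phi> \<Longrightarrow> v \<in> verts G \<Longrightarrow> \<phi> (Vertex v) = v"
  by (auto simp: model_via_def)

lemma model_via_bij: "model_via \<Gamma> G l \<phi> \<Longrightarrow> bij_betw \<phi> (points G l) (mspace \<Gamma>)"
  by (auto simp: model_via_def isometry_def mspace_metric_graph_of)

lemma model_via_mdist:
  "\<lbrakk>model_via \<Gamma> G l \<phi>; x \<in> points G l; y \<in> points G l\<rbrakk> \<Longrightarrow> mdist \<Gamma> (\<phi> x) (\<phi> y) = path_dist G l x y"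
  by (auto simp: model_via_def isometry_def mspace_metric_graph_of mdist_metric_graph_of)

lemma model_via_in_mspace: "\<lbrakk>model_via \<Gamma> G l \<phi>; x \<in> points G l\<rbrakk> \<Longrightarrow> \<phi> x \<in> mspace \<Gamma>"
  using model_via_bij by (metis bij_betwE)

lemma model_via_inj:
  "\<lbrakk>model_via \<Gamma> G l \<phi>; x \<in> points G l; y \<in> points G l; \<phi> x = \<phi> y\<rbrakk> \<Longrightarrow> x = y"
  using model_via_bij by (metis bij_betw_def inj_onD)

lemma model_via_verts: "model_via \<Gamma> G l \<phi> \<Longrightarrow> verts G \<subseteq> mspace \<Gamma>"
  using model_via_in_mspace[of \<Gamma> G l \<phi>] model_via_Vertex[of \<Gamma> G l \<phi>] Vertex_in_points
  by (metis subsetI)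

lemma model_via_edge_point:
  "\<lbrakk>model_via \<Gamma> G l \<phi>; e \<in> arcs G; t \<in> {0..l e}\<rbrakk> \<Longrightarrow> \<phi> (edge_point G l e t) \<in> mspace \<Gamma>"
  using edge_point_in_points model_via_in_mspace model_via_weighted by metis

lemma model_via_tail: "\<lbrakk>model_via \<Gamma> G l \<phi>; e \<in> arcs G\<rbrakk> \<Longrightarrow> \<phi> (edge_point G l e 0) = tail G e"
  and model_via_head: "\<lbrakk>model_via \<Gamma> G l \<phi>; e \<in> arcs G\<rbrakk> \<Longrightarrow> \<phi> (edge_point G l e (l e)) = head G e"
  using model_via_weighted[of \<Gamma> G l \<phi>] model_via_Vertex[of \<Gamma> G l \<phi>]
  by (auto simp: edge_point_end weighted_multigraph_pos weighted_multigraph_tail weighted_multigraph_head)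

lemma model_via_Interior_notin_verts:
  assumes "model_via \<Gamma> G l \<phi>" "e \<in> arcs G" "0 < t" "t < l e"
  shows "\<phi> (Interior e t) \<notin> verts G"
proof
  assume "\<phi> (Interior e t) \<in> verts G"
  then have "Interior e t = Vertex (\<phi> (Interior e t))"
    using assms by (intro model_via_inj[OF assms(1)]) (auto simp: model_via_Vertex)
  then show False by simp
qed

lemma model_via_cases:
  assumes "model_via \<Gamma> G l \<phi>" "x \<in> mspace \<Gamma>"
  obtains "x \<in> verts G"
  | e t where "e \<in> arcs G" "0 < t" "t < l e" "x = \<phi> (Interior e t)" "x \<notin> verts G"
proof -
  obtain y where y: "y \<in> points G l" "x = \<phi> y"
    using model_via_bij[OF assms(1)] assms(2) by (metis bij_betw_imp_surj_on imageE)
  show thesis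
    using y(1)
  proof (cases rule: points_cases)
    case (1 v)
    then show ?thesis using y(2) that(1) model_via_Vertex[OF assms(1)] by auto
  next
    case (2 e t)
    then show ?thesis using y(2) that(2)[of e t] model_via_Interior_notin_verts[OF assms(1)] by auto
  qed
qed

lemma model_via_mdist_edge_points:
  assumes "model_via \<Gamma> G l \<phi>" "e \<in> arcs G" "s \<in> {0..l e}" "t \<in> {0..l e}"
  shows "mdist \<Gamma> (\<phi> (edge_point G l e s)) (\<phi> (edge_point G l e t)) \<le> \<bar>t - s\<bar>"
  using assms model_via_mdist[OF assms(1)] path_dist_edge_points_le[OF model_via_weighted[OF assms(1)]]
    edge_point_in_points[OF model_via_weighted[OF assms(1)]] by simp

lemma msphere_model_via:
  assumes "model_via \<Gamma> G l \<phi>" "x \<in> points G l"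
  shows "msphere \<Gamma> (\<phi> x) r = \<phi> ` {y \<in> points G l. path_dist G l x y = r}"
proof -
  have "mspace \<Gamma> = \<phi> ` points G l" using model_via_bij[OF assms(1)] by (simp add: bij_betw_def)
  then show ?thesis using model_via_mdist[OF assms] by (auto simp: msphere_def)
qed

lemma msphere_Interior:
  assumes "model_via \<Gamma> G l \<phi>" "e \<in> arcs G" "0 < r" "r < t" "r < l e - t"
  shows "msphere \<Gamma> (\<phi> (Interior e t)) r = {\<phi> (Interior e (t + r)), \<phi> (Interior e (t - r))}"
    and "\<phi> (Interior e (t + r)) \<noteq> \<phi> (Interior e (t - r))"
proof -
  show "msphere \<Gamma> (\<phi> (Interior e t)) r = {\<phi> (Interior e (t + r)), \<phi> (Interior e (t - r))}"
    using assms by (simp add: msphere_model_via sphere_Interior[OF model_via_weighted[OF assms(1)]])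
  show "\<phi> (Interior e (t + r)) \<noteq> \<phi> (Interior e (t - r))"
    using model_via_inj[OF assms(1), of "Interior e (t + r)" "Interior e (t - r)"] assms by auto
qed

lemma sum_msphere_Interior:
  assumes "model_via \<Gamma> G l \<phi>" "e \<in> arcs G" "0 < r" "r < t" "r < l e - t"
  shows "(\<Sum>y\<in>msphere \<Gamma> (\<phi> (Interior e t)) r. F y) = F (\<phi> (Interior e (t + r))) + F (\<phi> (Interior e (t - r)))"
  using msphere_Interior[OF assms] by simp

lemma msphere_Vertex:
  assumes m: "model_via \<Gamma> G l \<phi>" and v: "v \<in> verts G"
    and r: "0 < r" "\<And>e. e \<in> arcs G \<Longrightarrow> 2 * r < l e"
  shows "msphere \<Gamma> v r = (\<lambda>e. \<phi> (Interior e r)) ` {e\<in>arcs G. tail G e = v}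
    \<union> (\<lambda>e. \<phi> (Interior e (l e - r))) ` {e\<in>arcs G. head G e = v}"
  using msphere_model_via[OF m, of "Vertex v" r] sphere_Vertex[OF model_via_weighted[OF m] v r]
    model_via_Vertex[OF m v] v by (simp add: image_Un image_image)

text \<open>A loop at \<open>v\<close> enters both sums, and its points at the parameters
  \<open>r\<close> and \<open>l e - r\<close> differ because \<open>2 * r < l e\<close>; so no point
  of the sphere is counted twice.\<close>

lemma sum_msphere_Vertex:
  assumes m: "model_via \<Gamma> G l \<phi>" and v: "v \<in> verts G"
    and r: "0 < r" "\<And>e. e \<in> arcs G \<Longrightarrow> 2 * r < l e"
  shows "(\<Sum>y\<in>msphere \<Gamma> v r. F y) = (\<Sum>e\<in>{e\<in>arcs G. tail G e = v}. F (\<phi> (edge_point G l e r)))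
    + (\<Sum>e\<in>{e\<in>arcs G. head G e = v}. F (\<phi> (edge_point G l e (l e - r))))"
proof -
  let ?A = "{e\<in>arcs G. tail G e = v}" and ?B = "{e\<in>arcs G. head G e = v}"
  let ?a = "\<lambda>e. \<phi> (Interior e r)" and ?b = "\<lambda>e. \<phi> (Interior e (l e - r))"
  have fin: "finite (arcs G)" using weighted_multigraph_finite_arcs[OF model_via_weighted[OF m]] .
  have r': "r < l e" "0 < l e - r" if "e \<in> arcs G" for e using r(1) r(2)[OF that] by auto
  have a: "inj_on ?a ?A" and b: "inj_on ?b ?B" and ab: "?a ` ?A \<inter> ?b ` ?B = {}"
    using r' r by (auto intro!: inj_onI dest!: model_via_inj[OF m, rotated 2]) fastforce+
  have "(\<Sum>y\<in>msphere \<Gamma> v r. F y) = sum F (?a ` ?A) + sum F (?b ` ?B)"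
    by (subst msphere_Vertex[OF m v r]) (use fin ab in \<open>auto intro!: sum.union_disjoint\<close>)
  also have "\<dots> = (\<Sum>e\<in>?A. F (?a e)) + (\<Sum>e\<in>?B. F (?b e))"
    by (simp add: sum.reindex[OF a] sum.reindex[OF b])
  also have "(\<Sum>e\<in>?A. F (?a e)) = (\<Sum>e\<in>?A. F (\<phi> (edge_point G l e r)))"
    by (rule sum.cong) (use r' r in auto)
  also have "(\<Sum>e\<in>?B. F (?b e)) = (\<Sum>e\<in>?B. F (\<phi> (edge_point G l e (l e - r))))"
    by (rule sum.cong) (use r' r in auto)
  finally show ?thesis .
qed

section \<open>Slopes and divisors read off from small spheres\<close>

lemma eventually_at_right_0_less: "0 < (a::real) \<Longrightarrow> \<forall>\<^sub>F r in at_right 0. r < a"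
  by (rule eventually_at_rightI[of 0 a]) auto

lemma eventually_at_right_0_pos: "\<forall>\<^sub>F r in at_right (0::real). 0 < r"
  by (rule eventually_at_right_less)

lemma eventually_at_right_0_short:
  assumes "weighted_multigraph G l"
  shows "\<forall>\<^sub>F r in at_right 0. \<forall>e\<in>arcs G. 2 * r < l e"
proof (rule eventually_ball_finite[OF weighted_multigraph_finite_arcs[OF assms]], rule ballI)
  fix e assume "e \<in> arcs G"
  then have "0 < l e / 2" using weighted_multigraph_pos[OF assms] by simp
  from eventually_at_right_0_less[OF this] show "\<forall>\<^sub>F r in at_right 0. 2 * r < l e"
    by eventually_elim simp
qed

lemma has_slopes_Interior:
  assumes "has_slopes G l \<phi> f s" "e \<in> arcs G" "0 < t" "t < l e"
  shows "f (\<phi> (Interior e t)) = f (\<phi> (edge_point G l e 0)) + s e * t"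
  using assms(1,2) assms(3,4) unfolding has_slopes_def
  by (metis atLeastAtMost_iff edge_point_interior less_imp_le)

lemma outgoing_slope_sum_outside:
  assumes "model_via \<Gamma> G l \<phi>" "x \<notin> verts G"
  shows "outgoing_slope_sum G s x = 0"
proof -
  have "{e \<in> arcs G. tail G e = x} = {}" "{e \<in> arcs G. head G e = x} = {}"
    using assms weighted_multigraph_tail[OF model_via_weighted[OF assms(1)]]
      weighted_multigraph_head[OF model_via_weighted[OF assms(1)]] by auto
  then show ?thesis by (simp only: outgoing_slope_sum_def sum.empty)
qed

text \<open>This expresses the divisor of a rational function in terms of the metric only, which makes it
  independent of the model.\<close>

lemma sum_msphere_has_slopes:
  assumes m: "model_via \<Gamma> G l \<phi>" and s: "has_slopes G l \<phi> f s" and x: "x \<in> mspace \<Gamma>"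
  shows "\<forall>\<^sub>F r in at_right 0. (\<Sum>y\<in>msphere \<Gamma> x r. f y - f x) = r * outgoing_slope_sum G s x"
  using m x
proof (cases rule: model_via_cases)
  case 1
  from eventually_at_right_0_pos eventually_at_right_0_short[OF model_via_weighted[OF m]]
  show ?thesis
  proof eventually_elim
    case (elim r)
    have "f (\<phi> (edge_point G l e r)) - f x = s e * r" if "e \<in> arcs G" "tail G e = x" for e
    proof -
      have "r \<in> {0..l e}" using that elim by auto
      then show ?thesis using s that model_via_tail[OF m that(1)] by (simp add: has_slopes_def)
    qed
    moreover have "f (\<phi> (edge_point G l e (l e - r))) - f x = - s e * r"
      if "e \<in> arcs G" "head G e = x" for e
    proof -
      have "f (\<phi> (edge_point G l e t)) = f (\<phi> (edge_point G l e 0)) + of_int (s e) * t"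
        if "t \<in> {0..l e}" for t using s that \<open>e \<in> arcs G\<close> by (auto simp: has_slopes_def)
      from this[of "l e"] this[of "l e - r"] show ?thesis
        using that elim model_via_head[OF m that(1)] weighted_multigraph_pos[OF model_via_weighted[OF m] that(1)]
        by (auto simp: algebra_simps)
    qed
    ultimately have "(\<Sum>e\<in>{e\<in>arcs G. tail G e = x}. f (\<phi> (edge_point G l e r)) - f x)
        = (\<Sum>e\<in>{e\<in>arcs G. tail G e = x}. s e * r)"
      "(\<Sum>e\<in>{e\<in>arcs G. head G e = x}. f (\<phi> (edge_point G l e (l e - r))) - f x)
        = (\<Sum>e\<in>{e\<in>arcs G. head G e = x}. - s e * r)"
      by (auto intro!: sum.cong)
    then show ?case
      using elim sum_msphere_Vertex[OF m 1, of r "\<lambda>y. f y - f x"]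
      by (simp add: outgoing_slope_sum_def sum_negf mult.commute flip: sum_distrib_left)
        (simp add: right_diff_distrib)
  qed
next
  case (2 e t)
  then have e: "0 < l e - t" by simp
  have 0: "outgoing_slope_sum G s x = 0"
    using 2 outgoing_slope_sum_outside[OF m] by simp
  from eventually_at_right_0_pos eventually_at_right_0_less[OF 2(2)] eventually_at_right_0_less[OF e]
  show ?thesis
  proof eventually_elim
    case (elim r)
    then show ?case using 2 0 has_slopes_Interior[OF s 2(1)]
      by (simp add: sum_msphere_Interior[OF m] algebra_simps)
  qed
qed

text \<open>Both slope sums, times a small radius, equal one and the same sum over a sphere of
  \<open>\<Gamma>\<close>. The filter at 0 from the right is proper, so an eventual equality of
  constants is an equality.\<close>

lemma outgoing_slope_sum_unique:
  assumes m: "model_via \<Gamma> G l \<phi>" "has_slopes G l \<phi> f s"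
    and m': "model_via \<Gamma> G' l' \<phi>'" "has_slopes G' l' \<phi>' f s'"
  shows "outgoing_slope_sum G s = outgoing_slope_sum G' s'"
proof
  fix x
  show "outgoing_slope_sum G s x = outgoing_slope_sum G' s' x"
  proof (cases "x \<in> mspace \<Gamma>")
    case True
    from sum_msphere_has_slopes[OF m True] sum_msphere_has_slopes[OF m' True] eventually_at_right_0_pos
    have "\<forall>\<^sub>F r in at_right (0::real). outgoing_slope_sum G s x = outgoing_slope_sum G' s' x"
      by eventually_elim auto
    then show ?thesis by (simp add: eventually_const_iff)
  next
    case False
    then show ?thesis
      using outgoing_slope_sum_outside[OF m(1)] outgoing_slope_sum_outside[OF m'(1)]
        model_via_verts[OF m(1)] model_via_verts[OF m'(1)] by (metis subsetD)
  qed
qed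

text \<open>Provides continuity of \<open>f\<close> along the edges of a different model, where
  nothing is known about its slopes yet. Divided by a bound for all slopes, \<open>f\<close> is
  1-Lipschitz along each edge, hence for the path metric. The summand 1 in \<open>M\<close> covers
  the case that all slopes are 0.\<close>

lemma has_slopes_lipschitz:
  assumes m: "model_via \<Gamma> G l \<phi>" and s: "has_slopes G l \<phi> f s"
  obtains M where "0 < M" "\<And>x y. x \<in> mspace \<Gamma> \<Longrightarrow> y \<in> mspace \<Gamma> \<Longrightarrow> \<bar>f y - f x\<bar> \<le> M * mdist \<Gamma> x y"
proof
  define M where "M = 1 + (\<Sum>e\<in>arcs G. \<bar>real_of_int (s e)\<bar>)"
  have fin: "finite (arcs G)" using weighted_multigraph_finite_arcs[OF model_via_weighted[OF m]] .
  show M: "0 < M" by (auto simp: M_def intro!: add_pos_nonneg sum_nonneg)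
  have Ms: "\<bar>real_of_int (s e)\<bar> \<le> M" if "e \<in> arcs G" for e
    using member_le_sum[OF that, of "\<lambda>e. \<bar>real_of_int (s e)\<bar>"] fin by (simp add: M_def)
  fix x y assume xy: "x \<in> mspace \<Gamma>" "y \<in> mspace \<Gamma>"
  then obtain x' y' where xy': "x' \<in> points G l" "y' \<in> points G l" "x = \<phi> x'" "y = \<phi> y'"
    using model_via_bij[OF m] by (metis bij_betw_imp_surj_on imageE)
  have "\<bar>f (\<phi> y') / M - f (\<phi> x') / M\<bar> \<le> path_dist G l x' y'"
  proof (rule path_dist_lipschitz[OF model_via_weighted[OF m] xy'(1,2)])
    fix e a b assume e: "e \<in> arcs G" "a \<in> {0..l e}" "b \<in> {0..l e}"
    then have "f (\<phi> (edge_point G l e a)) = f (\<phi> (edge_point G l e 0)) + s e * a"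
      "f (\<phi> (edge_point G l e b)) = f (\<phi> (edge_point G l e 0)) + s e * b"
      using s by (auto simp: has_slopes_def)
    then have "\<bar>f (\<phi> (edge_point G l e b)) - f (\<phi> (edge_point G l e a))\<bar> = \<bar>real_of_int (s e)\<bar> * \<bar>b - a\<bar>"
      by (simp add: algebra_simps flip: abs_mult)
    also have "\<dots> \<le> M * \<bar>b - a\<bar>" using Ms[OF e(1)] by (intro mult_right_mono) auto
    finally show "\<bar>f (\<phi> (edge_point G l e b)) / M - f (\<phi> (edge_point G l e a)) / M\<bar> \<le> \<bar>b - a\<bar>"
      using M by (simp add: field_simps flip: diff_divide_distrib)
  qed
  then show "\<bar>f y - f x\<bar> \<le> M * mdist \<Gamma> x y"
    using M xy' by (simp add: model_via_mdist[OF m] field_simps flip: diff_divide_distrib)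
qed

section \<open>Change of models\<close>

text \<open>Comparing two-point spheres yields the values at \<open>t + r\<close> and
  \<open>t - r\<close> only as an unordered pair, and the matching could vary with \<open>r\<close>.
  It does not: the normalised difference quotient \<open>q\<close> is continuous with values 1 and
  -1 only, hence constant on an interval. The case \<open>n = 0\<close> is separate because
  \<open>q\<close> divides by \<open>n\<close>.\<close>

lemma signed_linear_germ:
  fixes k :: "real \<Rightarrow> real" and n :: int
  assumes cont: "continuous_on {t..t + d} k" and d: "0 < d"
    and k: "\<forall>\<^sub>F r::real in at_right 0. (k (t + r) = k t + n * r \<and> k (t - r) = k t - n * r) \<or>
        (k (t + r) = k t - n * r \<and> k (t - r) = k t + n * r)"
  shows "\<exists>(m::int) e. 0 < e \<and> (\<forall>h::real. \<bar>h\<bar> < e \<longrightarrow> k (t + h) = k t + m * h)"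
proof (cases "n = 0")
  case True
  obtain e where e: "0 < e" "\<And>r::real. 0 < r \<Longrightarrow> r < e \<Longrightarrow> k (t + r) = k t \<and> k (t - r) = k t"
    using k True by (auto simp: eventually_at_right_field)
  have "k (t + h) = k t + (0::int) * h" if "\<bar>h\<bar> < e" for h :: real
    using e(2)[of "\<bar>h\<bar>"] that by (cases h "0::real" rule: linorder_cases) auto
  then show ?thesis using e(1) by blast
next
  case False
  obtain e' where e': "0 < e'" "\<And>r::real. 0 < r \<Longrightarrow> r < e' \<Longrightarrow> (k (t + r) = k t + n * r \<and> k (t - r) = k t - n * r) \<or>
        (k (t + r) = k t - n * r \<and> k (t - r) = k t + n * r)"
    using k by (auto simp: eventually_at_right_field)
  define e where "e = min e' d"
  have e: "0 < e" "e \<le> d" and ee: "\<And>r::real. 0 < r \<Longrightarrow> r < e \<Longrightarrow> (k (t + r) = k t + n * r \<and> k (t - r) = k t - n * r) \<or>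
        (k (t + r) = k t - n * r \<and> k (t - r) = k t + n * r)"
    using e' d by (auto simp: e_def)
  define q where "q = (\<lambda>r::real. (k (t + r) - k t) / (n * r))"
  have q: "q r = 1 \<or> q r = - 1" if "0 < r" "r < e" for r :: real
    using ee[OF that] that False by (auto simp: q_def field_simps)
  have "continuous_on {0<..<e} q"
    unfolding q_def using False e
    by (intro continuous_intros continuous_on_compose2[OF cont]) auto
  moreover have "finite (q ` {0<..<e})"
    by (rule finite_subset[of _ "{1, -1}"]) (use q in force)+
  ultimately have "q constant_on {0<..<e}"
    using continuous_finite_range_constant[of "{0<..<e}" q] by auto
  then obtain c where c: "\<And>r::real. 0 < r \<Longrightarrow> r < e \<Longrightarrow> q r = c" by (auto simp: constant_on_def)
  have "c = 1 \<or> c = -1" using q[of "e/2"] c[of "e/2"] e by auto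
  then obtain \<sigma> :: int where \<sigma>: "c = of_int \<sigma>" "\<sigma> = 1 \<or> \<sigma> = -1"
    by (metis of_int_1 of_int_minus)
  have fwd: "k (t + r) = k t + (\<sigma> * n) * r" "k (t - r) = k t - (\<sigma> * n) * r" if "0 < r" "r < e" for r :: real
    using ee[OF that] c[OF that] that False \<sigma> by (auto simp: q_def field_simps)
  have "k (t + h) = k t + (\<sigma> * n) * h" if "\<bar>h\<bar> < e" for h :: real
    using fwd(1)[of h] fwd(2)[of "- h"] that by (cases h "0::real" rule: linorder_cases) simp_all
  then show ?thesis using e(1) by (intro exI[of _ "\<sigma> * n"] exI[of _ e]) auto
qed

text \<open>The local slope is locally constant on a connected interval, so it is a single integer
  \<open>c\<close>, and \<open>k t - c * t\<close> has derivative 0. Continuity reaches the two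
  endpoints, where no local formula is assumed.\<close>

lemma locally_affine_imp_affine:
  fixes k :: "real \<Rightarrow> real"
  assumes L: "0 < L" and cont: "continuous_on {0..L} k"
    and loc: "\<And>t. 0 < t \<Longrightarrow> t < L \<Longrightarrow> \<exists>(m::int) e. 0 < e \<and> (\<forall>h::real. \<bar>h\<bar> < e \<longrightarrow> k (t + h) = k t + m * h)"
  shows "\<exists>c::int. \<forall>t::real\<in>{0..L}. k t = k 0 + c * t"
proof -
  have "\<forall>t\<in>{0<..<L}. \<exists>m::int. \<exists>e::real. 0 < e \<and> (\<forall>h::real. \<bar>h\<bar> < e \<longrightarrow> k (t + h) = k t + m * h)"
    using loc by simp
  from bchoice[OF this] obtain n :: "real \<Rightarrow> int" where
    "\<forall>t\<in>{0<..<L}. \<exists>e::real. 0 < e \<and> (\<forall>h::real. \<bar>h\<bar> < e \<longrightarrow> k (t + h) = k t + n t * h)" ..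
  from bchoice[OF this] obtain \<epsilon> :: "real \<Rightarrow> real" where
    "\<forall>t\<in>{0<..<L}. 0 < \<epsilon> t \<and> (\<forall>h::real. \<bar>h\<bar> < \<epsilon> t \<longrightarrow> k (t + h) = k t + n t * h)" ..
  then have n: "\<And>t (h::real). 0 < t \<Longrightarrow> t < L \<Longrightarrow> \<bar>h\<bar> < \<epsilon> t \<Longrightarrow> k (t + h) = k t + n t * h"
    and \<epsilon>: "\<And>t. 0 < t \<Longrightarrow> t < L \<Longrightarrow> 0 < \<epsilon> t"
    by simp_all
  have same: "n t' = n t" if t: "0 < t" "t < L" and t': "0 < t'" "t' < L" "\<bar>t' - t\<bar> < \<epsilon> t" for t t'
  proof -
    \<comment> \<open>Small enough for \<open>t' + h\<close> to lie in both neighbourhoods, so that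
      both local formulas apply between \<open>t'\<close> and \<open>t' + h\<close>.\<close>
    define h where "h = min (\<epsilon> t') (\<epsilon> t - \<bar>t' - t\<bar>) / 2"
    have "0 < h" "h < \<epsilon> t'" "h < \<epsilon> t - \<bar>t' - t\<bar>"
      using \<epsilon>[OF t'(1,2)] t'(3) unfolding h_def by (auto simp: min_def)
    then have h: "0 < h" "h < \<epsilon> t'" "\<bar>t' - t + h\<bar> < \<epsilon> t" "\<bar>h\<bar> = h"
      by linarith+
    have "k (t' + h) = k t' + n t' * h" using n[OF t'(1,2), of h] h by simp
    moreover have "k (t' + h) = k t + n t * (t' - t + h)" using n[OF t h(3)] by (simp add: algebra_simps)
    moreover have "k t' = k t + n t * (t' - t)" using n[OF t t'(3)] by simp
    ultimately have "n t' * h = n t * h" by (simp add: algebra_simps)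
    then show ?thesis using h(1) by simp
  qed
  define c where "c = n (L / 2)"
  have nc: "n t = c" if t: "0 < t" "t < L" for t
  proof (rule connected_local_const[of "{0<..<L}" t "L/2" n, folded c_def])
    show "\<forall>a\<in>{0<..<L}. \<forall>\<^sub>F b in at a within {0<..<L}. n a = n b"
    proof
      fix a assume a: "a \<in> {0<..<L}"
      then have "0 < \<epsilon> a" using \<epsilon> by simp
      moreover have "n a = n b" if "b \<in> {0<..<L}" "dist b a < \<epsilon> a" for b
        using same[of a b] a that by (simp add: dist_real_def)
      ultimately show "\<forall>\<^sub>F b in at a within {0<..<L}. n a = n b"
        unfolding eventually_at by blast
    qed
  qed (use t L in auto)
  define g where "g = (\<lambda>t::real. k t - c * t)"
  have der: "DERIV g t :> 0" if t: "0 < t" "t < L" for t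
  proof -
    have "g u = g t" if "\<bar>u - t\<bar> < \<epsilon> t" for u
      using n[OF t that] nc[OF t] by (simp add: g_def algebra_simps)
    then have "\<forall>\<^sub>F u in nhds t. g u = g t"
      using \<epsilon>[OF t] unfolding eventually_nhds_metric dist_real_def by blast
    then show ?thesis
      by (subst DERIV_cong_ev[OF refl _ refl, of _ "\<lambda>_. g t"]) auto
  qed
  have "k t = k 0 + c * t" if "t \<in> {0..L}" for t :: real
    using DERIV_isconst2[of 0 L g t] L der that cont
    by (simp add: g_def continuous_intros)
  then show ?thesis by blast
qed

text \<open>An interior point of an edge of \<open>G1\<close> is not a vertex of \<open>G2\<close>,
  so it is interior to an edge of \<open>G2\<close> as well, and its small two-point spheres in the
  two models coincide. This makes \<open>f\<close> affine near every interior point of the edge,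
  without any combinatorial comparison of the models.\<close>

lemma has_slopes_transfer:
  assumes m1: "model_via \<Gamma> G1 l1 \<phi>1" and m2: "model_via \<Gamma> G2 l2 \<phi>2"
    and sub: "verts G2 \<subseteq> verts G1" and s2: "has_slopes G2 l2 \<phi>2 f s2"
  obtains s1 where "has_slopes G1 l1 \<phi>1 f s1" "outgoing_slope_sum G1 s1 = outgoing_slope_sum G2 s2"
proof -
  obtain M where M: "0 < M" "\<And>x y. x \<in> mspace \<Gamma> \<Longrightarrow> y \<in> mspace \<Gamma> \<Longrightarrow> \<bar>f y - f x\<bar> \<le> M * mdist \<Gamma> x y"
    using has_slopes_lipschitz[OF m2 s2] by metis
  have "\<exists>c::int. \<forall>t::real\<in>{0..l1 e}. f (\<phi>1 (edge_point G1 l1 e t)) = f (\<phi>1 (edge_point G1 l1 e 0)) + c * t"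
    if e: "e \<in> arcs G1" for e
  proof -
    have le: "0 < l1 e" using weighted_multigraph_pos[OF model_via_weighted[OF m1] e] .
    define k where "k = (\<lambda>t. f (\<phi>1 (edge_point G1 l1 e t)))"
    have k: "k t = f (\<phi>1 (Interior e t))" if "0 < t" "t < l1 e" for t
      using that by (simp add: k_def)
    have "\<bar>k t - k u\<bar> \<le> M * \<bar>t - u\<bar>" if "t \<in> {0..l1 e}" "u \<in> {0..l1 e}" for t u
      unfolding k_def
      using M(2)[OF model_via_edge_point[OF m1 e that(2)] model_via_edge_point[OF m1 e that(1)]]
        model_via_mdist_edge_points[OF m1 e that(2,1)] M(1)
      by (meson mult_left_mono less_imp_le order_trans)
    then have "M-lipschitz_on {0..l1 e} k"
      using M(1) by (intro lipschitz_onI) (auto simp: dist_real_def)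
    then have cont: "continuous_on {0..l1 e} k" by (rule lipschitz_on_continuous_on)
    have "\<exists>c::int. \<forall>t::real\<in>{0..l1 e}. k t = k 0 + c * t"
    proof (rule locally_affine_imp_affine[OF le cont])
      fix t assume t: "0 < t" "t < l1 e"
      let ?x = "\<phi>1 (Interior e t)"
      have x: "?x \<notin> verts G2" "?x \<in> mspace \<Gamma>"
        using model_via_Interior_notin_verts[OF m1 e t] sub model_via_in_mspace[OF m1, of "Interior e t"] e t
        by auto
      from m2 x(2) obtain e2 t2 where e2: "e2 \<in> arcs G2" "0 < t2" "t2 < l2 e2" "?x = \<phi>2 (Interior e2 t2)"
        by (cases rule: model_via_cases) (use x in auto)
      have pos: "0 < l1 e - t" "0 < l2 e2 - t2" using t e2 by auto
      have "\<forall>\<^sub>F r::real in at_right 0. (k (t + r) = k t + s2 e2 * r \<and> k (t - r) = k t - s2 e2 * r) \<or>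
        (k (t + r) = k t - s2 e2 * r \<and> k (t - r) = k t + s2 e2 * r)"
        using eventually_at_right_0_pos eventually_at_right_0_less[OF t(1)] eventually_at_right_0_less[OF pos(1)]
          eventually_at_right_0_less[OF e2(2)] eventually_at_right_0_less[OF pos(2)]
      proof eventually_elim
        case (elim r)
        \<comment> \<open>Equality of two-element sets forgets which side is which;
          \<open>signed_linear_germ\<close> resolves this ambiguity.\<close>
        have "{\<phi>1 (Interior e (t + r)), \<phi>1 (Interior e (t - r))}
          = {\<phi>2 (Interior e2 (t2 + r)), \<phi>2 (Interior e2 (t2 - r))}"
          using msphere_Interior(1)[OF m1 e, of r t] msphere_Interior(1)[OF m2 e2(1), of r t2] elim e2(4) by simp
        then have "f (\<phi>1 (Interior e (t + r))) = f (\<phi>2 (Interior e2 (t2 + r))) \<and>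
            f (\<phi>1 (Interior e (t - r))) = f (\<phi>2 (Interior e2 (t2 - r))) \<or>
            f (\<phi>1 (Interior e (t + r))) = f (\<phi>2 (Interior e2 (t2 - r))) \<and>
            f (\<phi>1 (Interior e (t - r))) = f (\<phi>2 (Interior e2 (t2 + r)))"
          by (auto simp: doubleton_eq_iff)
        moreover have "k t = f (\<phi>2 (Interior e2 t2))" using k t e2(4) by simp
        ultimately show ?case
          using k[of "t + r"] k[of "t - r"] elim t has_slopes_Interior[OF s2 e2(1), of "t2 + r"]
            has_slopes_Interior[OF s2 e2(1), of "t2 - r"] has_slopes_Interior[OF s2 e2(1), of t2] e2
          by (auto simp: algebra_simps)
      qed
      then show "\<exists>(m::int) e. 0 < e \<and> (\<forall>h::real. \<bar>h\<bar> < e \<longrightarrow> k (t + h) = k t + m * h)"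
      proof (rule signed_linear_germ[rotated 2])
        show "continuous_on {t..t + (l1 e - t)} k"
          by (rule continuous_on_subset[OF cont]) (use t in auto)
      qed (use t in simp)
    qed
    then show ?thesis by (simp add: k_def)
  qed
  then obtain s1 where "has_slopes G1 l1 \<phi>1 f s1"
    unfolding has_slopes_def by metis
  then show thesis using that outgoing_slope_sum_unique[OF m1 _ m2 s2] by blast
qed

section \<open>Subdivision of an arc\<close>

lemma path_length_map:
  assumes "path_length G l x y r"
    and "\<And>x. x \<in> points G l \<Longrightarrow> \<psi> x \<in> points H m"
    and "\<And>e s t. \<lbrakk>e \<in> arcs G; s \<in> {0..l e}; t \<in> {0..l e}\<rbrakk>
      \<Longrightarrow> path_length H m (\<psi> (edge_point G l e s)) (\<psi> (edge_point G l e t)) \<bar>t - s\<bar>"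
  shows "path_length H m (\<psi> x) (\<psi> y) r"
  using assms(1)
proof (induction rule: path_length.induct)
  case (trivial x)
  then show ?case by (intro path_length.trivial assms(2))
next
  case (segment x e s r t)
  then show ?case using path_length_trans[OF assms(3)] by blast
qed

text \<open>Distances are infima of path lengths, so it suffices that \<open>\<psi>\<close> and its
  inverse turn every segment into a path of the same length. That path need not be a segment: in a
  subdivided arc it may run through both pieces.\<close>

lemma isometry_of_path_lengths:
  assumes G: "weighted_multigraph G l" and H: "weighted_multigraph H m"
    and bij: "bij_betw \<psi> (points G l) (points H m)"
    and inv: "\<And>x. x \<in> points G l \<Longrightarrow> \<xi> (\<psi> x) = x"
    and 1: "\<And>e s t. \<lbrakk>e \<in> arcs G; s \<in> {0..l e}; t \<in> {0..l e}\<rbrakk>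
      \<Longrightarrow> path_length H m (\<psi> (edge_point G l e s)) (\<psi> (edge_point G l e t)) \<bar>t - s\<bar>"
    and 2: "\<And>e s t. \<lbrakk>e \<in> arcs H; s \<in> {0..m e}; t \<in> {0..m e}\<rbrakk>
      \<Longrightarrow> path_length G l (\<xi> (edge_point H m e s)) (\<xi> (edge_point H m e t)) \<bar>t - s\<bar>"
  shows "isometry (metric_graph_of G l) (metric_graph_of H m) \<psi>"
proof -
  have \<psi>: "\<psi> x \<in> points H m" if "x \<in> points G l" for x using bij that by (rule bij_betw_apply)
  have \<xi>: "\<xi> y \<in> points G l" if "y \<in> points H m" for y
    using bij inv that by (metis bij_betw_imp_surj_on imageE)
  have pl: "path_length H m (\<psi> x) (\<psi> y) = path_length G l x y" if "x \<in> points G l" "y \<in> points G l" for x y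
    using path_length_map[where \<psi> = \<psi>, OF _ \<psi> 1] path_length_map[where \<psi> = \<xi>, OF _ \<xi> 2] inv that
    by (intro ext) metis
  then show ?thesis
    using bij \<psi> by (auto simp: isometry_def mspace_metric_graph_of mdist_metric_graph_of G H path_dist_def)
qed

lemma edge_point_cong: "l e = l' e \<Longrightarrow> edge_point G l e = edge_point G l' e"
  by (simp add: edge_point_def fun_eq_iff)

lemma points_cong: "(\<And>e. e \<in> arcs G \<Longrightarrow> l e = l' e) \<Longrightarrow> points G l = points G l'"
  by (simp add: points_def)

lemma path_length_cong_imp:
  assumes "path_length G l x y r" "\<And>e. e \<in> arcs G \<Longrightarrow> l e = l' e"
  shows "path_length G l' x y r"
  using assms(1)
proof (induction rule: path_length.induct)
  case (trivial x)
  then show ?case using points_cong[of G l l'] assms(2) by (auto intro: path_length.trivial)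
next
  case (segment x e s r t)
  then show ?case
    using path_length.segment[of G l' x e s r t] edge_point_cong[of l e l' G] assms(2)[of e] by simp
qed

lemma metric_graph_of_cong:
  assumes "\<And>e. e \<in> arcs G \<Longrightarrow> l e = l' e"
  shows "metric_graph_of G l = metric_graph_of G l'"
proof -
  have "path_length G l x y r \<longleftrightarrow> path_length G l' x y r" for x y r
    using path_length_cong_imp[of G l x y r l'] path_length_cong_imp[of G l' x y r l] assms by metis
  then have "path_length G l = path_length G l'" by blast
  then show ?thesis using points_cong[of G l l', OF assms]
    by (simp add: metric_graph_of_def path_dist_def[abs_def] cong: if_cong)
qed

lemma isometry_id: "isometry X X id"
  by (auto simp: isometry_def)

lemma isometry_comp:
  assumes "isometry X Y \<phi>" "isometry Y Z \<psi>"
  shows "isometry X Z (\<psi> \<circ> \<phi>)"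
proof -
  have "bij_betw (\<psi> \<circ> \<phi>) (mspace X) (mspace Z)"
    using assms by (intro bij_betw_trans[of \<phi> _ "mspace Y"]) (simp_all add: isometry_def)
  moreover have "\<phi> x \<in> mspace Y" if "x \<in> mspace X" for x
    using assms(1) that by (auto simp: isometry_def bij_betw_def)
  ultimately show ?thesis using assms by (simp add: isometry_def)
qed

lemma isometry_inv:
  assumes "isometry X Y \<phi>"
  shows "isometry Y X (inv_into (mspace X) \<phi>)"
proof -
  let ?\<psi> = "inv_into (mspace X) \<phi>"
  have bij: "bij_betw \<phi> (mspace X) (mspace Y)" using assms by (simp add: isometry_def)
  then have inv: "bij_betw ?\<psi> (mspace Y) (mspace X)" by (rule bij_betw_inv_into)
  have "?\<psi> y \<in> mspace X" "\<phi> (?\<psi> y) = y" if "y \<in> mspace Y" for y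
    using bij_betw_apply[OF inv that] bij_betw_inv_into_right[OF bij that] .
  then have "mdist X (?\<psi> x) (?\<psi> y) = mdist Y x y" if "x \<in> mspace Y" "y \<in> mspace Y" for x y
    using assms that unfolding isometry_def by metis
  then show ?thesis using inv by (simp add: isometry_def)
qed

text \<open>The old name \<open>e\<close> stays with the first piece and \<open>f\<close> names the
  rest. No position on the arc is recorded, so that the same splitting can be used again after the
  lengths have been changed.\<close>

definition split_arc :: "('v, 'e) pre_digraph \<Rightarrow> 'e \<Rightarrow> 'v \<Rightarrow> 'e \<Rightarrow> ('v, 'e) pre_digraph" where
  "split_arc G e w f = \<lparr>verts = insert w (verts G), arcs = insert f (arcs G),
     tail = (tail G)(f := w), head = (head G)(f := head G e, e := w)\<rparr>"

definition unsplit :: "'e \<Rightarrow> 'v \<Rightarrow> 'e \<Rightarrow> real \<Rightarrow> ('v, 'e) point \<Rightarrow> ('v, 'e) point" where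
  "unsplit e w f a x = (case x of Vertex v \<Rightarrow> if v = w then Interior e a else Vertex v
     | Interior g t \<Rightarrow> if g = f then Interior e (a + t) else Interior g t)"

definition resplit :: "'e \<Rightarrow> 'v \<Rightarrow> 'e \<Rightarrow> real \<Rightarrow> ('v, 'e) point \<Rightarrow> ('v, 'e) point" where
  "resplit e w f a x = (case x of Vertex v \<Rightarrow> Vertex v
     | Interior g t \<Rightarrow> if g = e then if t < a then Interior e t else if t = a then Vertex w
         else Interior f (t - a) else Interior g t)"

lemma split_arc_simps [simp]:
  "verts (split_arc G e w f) = insert w (verts G)"
  "arcs (split_arc G e w f) = insert f (arcs G)"
  "tail (split_arc G e w f) = (tail G)(f := w)"
  "head (split_arc G e w f) = (head G)(f := head G e, e := w)"
  by (simp_all add: split_arc_def)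

text \<open>A closed vertex set contains \<open>w\<close> iff it contains either end of
  \<open>e\<close>, so removing \<open>w\<close> leaves a nonempty closed set of \<open>G\<close>,
  which is all of \<open>verts G\<close>. The new lengths are arbitrary positive numbers, since
  rescaled graphs are covered too.\<close>

lemma weighted_multigraph_split_arc:
  assumes wm: "weighted_multigraph G l0" and e: "e \<in> arcs G" and f: "f \<notin> arcs G" and w: "w \<notin> verts G"
    and pos: "\<And>g. g \<in> insert f (arcs G) \<Longrightarrow> 0 < l g"
  shows "weighted_multigraph (split_arc G e w f) l"
proof -
  interpret fin_digraph G using wm by (rule weighted_multigraph_fin_digraph)
  interpret S: fin_digraph "split_arc G e w f"
    using e by unfold_locales auto
  have con: "\<And>S. S \<subseteq> verts G \<Longrightarrow> S \<noteq> {} \<Longrightarrow> \<forall>g\<in>arcs G. tail G g \<in> S \<longleftrightarrow> head G g \<in> S \<Longrightarrow> S = verts G"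
    and ne: "verts G \<noteq> {}"
    using wm connected_iff_closed[OF wf_digraph] by (auto simp: weighted_multigraph_def)
  have "S = insert w (verts G)" if S: "S \<subseteq> insert w (verts G)" "S \<noteq> {}"
    "\<forall>g\<in>insert f (arcs G). tail (split_arc G e w f) g \<in> S \<longleftrightarrow> head (split_arc G e w f) g \<in> S" for S
  proof -
    have "f \<noteq> e" using e f by auto
    then have ew: "tail G e \<in> S \<longleftrightarrow> w \<in> S" "w \<in> S \<longleftrightarrow> head G e \<in> S"
      using S(3) e by (auto dest: bspec[of _ _ f] bspec[of _ _ e])
    have tw: "tail G e \<noteq> w" using w tail_in_verts[OF e] by auto
    have "tail G g \<in> S - {w} \<longleftrightarrow> head G g \<in> S - {w}" if g: "g \<in> arcs G" for g
    proof (cases "g = e")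
      case True
      then show ?thesis using ew e w tw head_in_verts[OF e] by auto
    next
      case False
      moreover have "g \<noteq> f" using g f by auto
      ultimately have "tail G g \<in> S \<longleftrightarrow> head G g \<in> S" using S(3) g by (auto dest: bspec[of _ _ g])
      then show ?thesis using g w by (metis DiffE DiffI head_in_verts singletonD tail_in_verts)
    qed
    moreover have "S - {w} \<noteq> {}" using ew tw S(2) by auto
    ultimately have "S - {w} = verts G" using S(1) by (intro con) auto
    then show ?thesis using ew S(1) tail_in_verts[OF e] by auto
  qed
  then have "Digraph_Component.connected (split_arc G e w f)"
    by (subst connected_iff_closed[OF S.wf_digraph]) auto
  then show ?thesis using pos S.fin_digraph by (simp add: weighted_multigraph_def)
qed

lemma unsplit_edge_point:
  assumes wm: "weighted_multigraph G l0" and e: "e \<in> arcs G" and f: "f \<notin> arcs G" and w: "w \<notin> verts G"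
    and pos: "\<And>g. g \<in> insert f (arcs G) \<Longrightarrow> 0 < l g" and g: "g \<in> insert f (arcs G)" and t: "t \<in> {0..l g}"
  shows "unsplit e w f (l e) (edge_point (split_arc G e w f) l g t)
    = (if g = f then edge_point G (l(e := l e + l f)) e (l e + t) else edge_point G (l(e := l e + l f)) g t)"
proof -
  have "f \<noteq> e" using e f by auto
  moreover have "tail G g' \<noteq> w" "head G g' \<noteq> w" if "g' \<in> arcs G" for g'
    using weighted_multigraph_tail[OF wm that] weighted_multigraph_head[OF wm that] w by auto
  ultimately show ?thesis
    using g t e pos[of f] pos[of e] pos[of g] by (auto simp: edge_point_def unsplit_def)
qed

lemma resplit_edge_point:
  assumes e: "e \<in> arcs G" and f: "f \<notin> arcs G"
    and pos: "\<And>g. g \<in> insert f (arcs G) \<Longrightarrow> 0 < l g"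
  shows "h \<in> arcs G \<Longrightarrow> h \<noteq> e \<Longrightarrow>
      resplit e w f (l e) (edge_point G (l(e := l e + l f)) h t) = edge_point (split_arc G e w f) l h t"
    and "t \<in> {0..l e} \<Longrightarrow>
      resplit e w f (l e) (edge_point G (l(e := l e + l f)) e t) = edge_point (split_arc G e w f) l e t"
    and "t \<in> {l e..l e + l f} \<Longrightarrow>
      resplit e w f (l e) (edge_point G (l(e := l e + l f)) e t) = edge_point (split_arc G e w f) l f (t - l e)"
proof -
  have "f \<noteq> e" using e f by auto
  then show "h \<in> arcs G \<Longrightarrow> h \<noteq> e \<Longrightarrow>
      resplit e w f (l e) (edge_point G (l(e := l e + l f)) h t) = edge_point (split_arc G e w f) l h t"
    "t \<in> {0..l e} \<Longrightarrow>
      resplit e w f (l e) (edge_point G (l(e := l e + l f)) e t) = edge_point (split_arc G e w f) l e t"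
    "t \<in> {l e..l e + l f} \<Longrightarrow>
      resplit e w f (l e) (edge_point G (l(e := l e + l f)) e t) = edge_point (split_arc G e w f) l f (t - l e)"
    using f pos[of f] pos[of e] e by (auto simp: edge_point_def resplit_def)
qed

text \<open>The two pieces have arbitrary positive lengths and the merged arc gets their sum. This
  covers cutting an arc at a given point as well as rescaling the pieces afterwards.\<close>

lemma isometry_unsplit:
  assumes wm: "weighted_multigraph G l0" and e: "e \<in> arcs G" and f: "f \<notin> arcs G" and w: "w \<notin> verts G"
    and pos: "\<And>g. g \<in> insert f (arcs G) \<Longrightarrow> 0 < l g"
  shows "isometry (metric_graph_of (split_arc G e w f) l) (metric_graph_of G (l(e := l e + l f)))
    (unsplit e w f (l e))"
proof -
  let ?S = "split_arc G e w f" and ?m = "l(e := l e + l f)"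
  let ?\<psi> = "unsplit e w f (l e)" and ?\<xi> = "resplit e w f (l e)"
  have ef: "f \<noteq> e" using e f by auto
  have S: "weighted_multigraph ?S l" by (rule weighted_multigraph_split_arc[OF assms])
  have G: "weighted_multigraph G ?m"
    using wm pos e by (auto simp: weighted_multigraph_def intro: add_pos_pos)
  have inv: "?\<xi> (?\<psi> x) = x" if "x \<in> points ?S l" for x
    using that ef f w pos[of e] e
    by (cases x) (auto simp: resplit_def unsplit_def)
  have bij: "bij_betw ?\<psi> (points ?S l) (points G ?m)"
  proof (rule bij_betw_byWitness[of _ ?\<xi>])
    show "\<forall>x\<in>points ?S l. ?\<xi> (?\<psi> x) = x" using inv by blast
    show "\<forall>y\<in>points G ?m. ?\<psi> (?\<xi> y) = y"
    proof
      fix y assume "y \<in> points G ?m"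
      then show "?\<psi> (?\<xi> y) = y"
        using ef f w pos[of e] e by (cases y) (auto simp: resplit_def unsplit_def)
    qed
    show "?\<psi> ` points ?S l \<subseteq> points G ?m"
    proof
      fix y assume "y \<in> ?\<psi> ` points ?S l"
      then obtain x where "x \<in> points ?S l" "y = ?\<psi> x" by blast
      then show "y \<in> points G ?m"
        using ef f w pos[of e] pos[of f] e by (cases x) (auto simp: unsplit_def split: if_splits)
    qed
    show "?\<xi> ` points G ?m \<subseteq> points ?S l"
    proof
      fix x assume "x \<in> ?\<xi> ` points G ?m"
      then obtain y where "y \<in> points G ?m" "x = ?\<xi> y" by blast
      then show "x \<in> points ?S l"
        using ef f w pos[of e] pos[of f] e by (cases y) (auto simp: resplit_def split: if_splits)
    qed
  qed
  have U: "?\<psi> (edge_point ?S l g t) = (if g = f then edge_point G ?m e (l e + t) else edge_point G ?m g t)"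
    if "g \<in> arcs ?S" "t \<in> {0..l g}" for g t
    using unsplit_edge_point[where l = l, OF wm e f w pos] that by simp
  show ?thesis
  proof (rule isometry_of_path_lengths[OF S G bij inv])
    fix g s t assume g: "g \<in> arcs ?S" "s \<in> {0..l g}" "t \<in> {0..l g}"
    show "path_length G ?m (?\<psi> (edge_point ?S l g s)) (?\<psi> (edge_point ?S l g t)) \<bar>t - s\<bar>"
    proof (cases "g = f")
      case True
      then show ?thesis
        using path_length_edge_points[OF G e, of "l e + s" "l e + t"] g pos[of e] e
          U[OF g(1,2)] U[OF g(1,3)] by simp
    next
      case False
      then have "g \<in> arcs G" "s \<in> {0..?m g}" "t \<in> {0..?m g}" using g pos[of f] by auto
      then show ?thesis
        using path_length_edge_points[OF G, of g s t] False U[OF g(1,2)] U[OF g(1,3)] by simp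
    qed
  next
    note R = resplit_edge_point[where l = l, OF e f pos]
    \<comment> \<open>A segment of the merged arc that passes over \<open>w\<close> lies in no
      single arc of the split graph, so it is cut at \<open>w\<close> into two segments whose
      lengths add up.\<close>
    have cross: "path_length ?S l (?\<xi> (edge_point G ?m e s)) (?\<xi> (edge_point G ?m e t)) (t - s)"
      if "0 \<le> s" "s \<le> l e" "l e \<le> t" "t \<le> l e + l f" for s t
    proof -
      have "path_length ?S l (edge_point ?S l e s) (edge_point ?S l e (l e)) (l e - s)"
        using path_length_edge_points[OF S, of e s "l e"] that e by simp
      moreover have "edge_point ?S l e (l e) = edge_point ?S l f 0"
        using ef pos[of e] e by (simp add: edge_point_def)
      moreover have "path_length ?S l (edge_point ?S l f 0) (edge_point ?S l f (t - l e)) (t - l e)"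
        using path_length_edge_points[OF S, of f 0 "t - l e"] that by simp
      ultimately have "path_length ?S l (edge_point ?S l e s) (edge_point ?S l f (t - l e)) ((l e - s) + (t - l e))"
        using path_length_trans by metis
      then show ?thesis using that R(2)[where w = w and t = s] R(3)[where w = w and t = t] by simp
    qed
    fix g s t assume g: "g \<in> arcs G" "s \<in> {0..?m g}" "t \<in> {0..?m g}"
    show "path_length ?S l (?\<xi> (edge_point G ?m g s)) (?\<xi> (edge_point G ?m g t)) \<bar>t - s\<bar>"
    proof (cases "g = e")
      case False
      then show ?thesis
        using path_length_edge_points[OF S, of g s t] g R(1)[where h = g and w = w and t = s] R(1)[where h = g and w = w and t = t] by simp
    next
      case True
      then have st: "0 \<le> s" "s \<le> l e + l f" "0 \<le> t" "t \<le> l e + l f" using g by auto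
      consider "s \<le> l e" "t \<le> l e" | "l e \<le> s" "l e \<le> t" | "s \<le> l e" "l e \<le> t" | "l e \<le> s" "t \<le> l e"
        by linarith
      then show ?thesis
      proof cases
        case 1
        then show ?thesis using True st e
            path_length_edge_points[OF S, of e s t] R(2)[where w = w and t = s] R(2)[where w = w and t = t] by simp
      next
        case 2
        then show ?thesis using True st
            path_length_edge_points[OF S, of f "s - l e" "t - l e"] R(3)[where w = w and t = s] R(3)[where w = w and t = t] by simp
      next
        case 3
        then show ?thesis using True st cross[of s t] by simp
      next
        case 4
        then show ?thesis using True st path_length_sym[OF S cross[of t s]] by simp
      qed
    qed
  qed
qed

lemma model_via_split_arc:
  assumes m: "model_via \<Gamma> G l \<phi>" and e: "e \<in> arcs G" and a: "0 < a" "a < l e" and f: "f \<notin> arcs G"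
    and w: "w = \<phi> (Interior e a)"
  shows "model_via \<Gamma> (split_arc G e w f) (l(e := a, f := l e - a)) (\<phi> \<circ> unsplit e w f a)"
proof -
  let ?l = "l(e := a, f := l e - a)"
  note wm = model_via_weighted[OF m]
  have ef: "f \<noteq> e" using e f by auto
  have wG: "w \<notin> verts G" using model_via_Interior_notin_verts[OF m e a] w by simp
  have pos: "\<And>g. g \<in> insert f (arcs G) \<Longrightarrow> 0 < ?l g"
    using a weighted_multigraph_pos[OF wm] by auto
  \<comment> \<open>Merging the pieces restores the length of \<open>e\<close> but not the value at
    \<open>f\<close>; as \<open>f\<close> is not an arc of \<open>G\<close>, the space is the
    same.\<close>
  have "metric_graph_of G (?l(e := ?l e + ?l f)) = metric_graph_of G l"
    by (rule metric_graph_of_cong) (use ef f in auto)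
  then have "isometry (metric_graph_of (split_arc G e w f) ?l) (metric_graph_of G l) (unsplit e w f a)"
    using isometry_unsplit[where l = ?l, OF wm e f wG pos] ef by simp
  then have "isometry (metric_graph_of (split_arc G e w f) ?l) \<Gamma> (\<phi> \<circ> unsplit e w f a)"
    by (rule isometry_comp) (use m in \<open>simp add: model_via_def\<close>)
  moreover have "weighted_multigraph (split_arc G e w f) ?l"
    by (rule weighted_multigraph_split_arc[OF wm e f wG pos])
  ultimately show ?thesis
    using model_via_Vertex[OF m] w by (auto simp: model_via_def unsplit_def)
qed

section \<open>Refinements of a model\<close>

text \<open>A chain of single splittings, so that each property of subdivisions is checked for one
  splitting only. The new vertex has to be the point of \<open>\<Gamma>\<close> at which the arc is
  cut, because models name vertices by points.\<close>

inductive refinement ::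
  "('a, nat) pre_digraph \<Rightarrow> (nat \<Rightarrow> real) \<Rightarrow> (('a, nat) point \<Rightarrow> 'a) \<Rightarrow>
   ('a, nat) pre_digraph \<Rightarrow> (nat \<Rightarrow> real) \<Rightarrow> (('a, nat) point \<Rightarrow> 'a) \<Rightarrow> bool"
  for G0 l0 \<phi>0 where
  refl: "refinement G0 l0 \<phi>0 G0 l0 \<phi>0"
| split: "\<lbrakk>refinement G0 l0 \<phi>0 G l \<phi>; e \<in> arcs G; 0 < a; a < l e; f \<notin> arcs G; w = \<phi> (Interior e a)\<rbrakk>
    \<Longrightarrow> refinement G0 l0 \<phi>0 (split_arc G e w f) (l(e := a, f := l e - a)) (\<phi> \<circ> unsplit e w f a)"

lemma refinement_model_via:
  assumes "refinement G0 l0 \<phi>0 G l \<phi>" "model_via \<Gamma> G0 l0 \<phi>0"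
  shows "model_via \<Gamma> G l \<phi>"
  using assms by induction (auto intro: model_via_split_arc)

lemma refinement_verts:
  assumes "refinement G0 l0 \<phi>0 G l \<phi>"
  shows "verts G0 \<subseteq> verts G"
  using assms by induction auto

lemma loopfree_split_arc:
  assumes "loopfree_digraph G" "e \<in> arcs G" "f \<notin> arcs G" "w \<notin> verts G"
  shows "loopfree_digraph (split_arc G e w f)"
proof -
  interpret loopfree_digraph G by fact
  show ?thesis
  proof
    fix g assume "g \<in> arcs (split_arc G e w f)"
    then show "tail (split_arc G e w f) g \<in> verts (split_arc G e w f)"
      "head (split_arc G e w f) g \<in> verts (split_arc G e w f)"
      "tail (split_arc G e w f) g \<noteq> head (split_arc G e w f) g"
      using assms no_loops tail_in_verts head_in_verts by auto
  qed
qed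

lemma refinement_loopfree:
  assumes "refinement G0 l0 \<phi>0 G l \<phi>" "model_via \<Gamma> G0 l0 \<phi>0" "loopfree_digraph G0"
  shows "loopfree_digraph G"
  using assms
proof induction
  case (split G l \<phi> e a f w)
  have "w \<notin> verts G"
    using model_via_Interior_notin_verts[OF refinement_model_via[OF split.hyps(1) split.prems(1)]] split.hyps
    by simp
  then show ?case using split by (intro loopfree_split_arc) auto
qed

text \<open>Splitting keeps orientations, so passing from a small arc to the old arc containing it
  is a translation by \<open>b\<close>. This is how break points given on old arcs are kept out of
  the interiors of new ones.\<close>

lemma refinement_subedge:
  assumes "refinement G0 l0 \<phi>0 G l \<phi>" "model_via \<Gamma> G0 l0 \<phi>0" "g \<in> arcs G"
  shows "\<exists>e\<in>arcs G0. \<exists>b\<ge>0. b + l g \<le> l0 e \<and>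
    (\<forall>t\<in>{0..l g}. \<phi> (edge_point G l g t) = \<phi>0 (edge_point G0 l0 e (b + t)))"
  using assms
proof (induction arbitrary: g)
  case (refl g)
  then show ?case by (intro bexI[of _ g] exI[of _ 0]) auto
next
  case (split G l \<phi> e a f w g)
  let ?l = "l(e := a, f := l e - a)" and ?S = "split_arc G e w f" and ?\<phi> = "\<phi> \<circ> unsplit e w f a"
  have m: "model_via \<Gamma> G l \<phi>" by (rule refinement_model_via[OF split.hyps(1) split.prems(1)])
  have ef: "f \<noteq> e" using split.hyps by auto
  have w: "w \<notin> verts G"
    using model_via_Interior_notin_verts[OF m] split.hyps by simp
  have U: "?\<phi> (edge_point ?S ?l h t) = (if h = f then \<phi> (edge_point G l e (a + t)) else \<phi> (edge_point G l h t))"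
    if "h \<in> insert f (arcs G)" "t \<in> {0..?l h}" for h t
  proof -
    have "\<And>g. g \<in> insert f (arcs G) \<Longrightarrow> 0 < ?l g"
      using split.hyps weighted_multigraph_pos[OF model_via_weighted[OF m]] by auto
    from unsplit_edge_point[where l = ?l, OF model_via_weighted[OF m] split.hyps(2,5) w this that]
    have *: "unsplit e w f a (edge_point ?S ?l h t) = (if h = f then edge_point G (?l(e := l e)) e (a + t)
        else edge_point G (?l(e := l e)) h t)"
      using ef by simp
    have "edge_point G (?l(e := l e)) e = edge_point G l e" by (rule edge_point_cong) simp
    moreover have "h \<noteq> f \<Longrightarrow> edge_point G (?l(e := l e)) h = edge_point G l h" by (rule edge_point_cong) simp
    ultimately show ?thesis using * by simp
  qed
  define g' where "g' = (if g = f then e else g)"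
  define c where "c = (if g = f then a else 0)"
  have g': "g' \<in> arcs G" "0 \<le> c" "c + ?l g \<le> l g'"
    using split.prems split.hyps by (auto simp: g'_def c_def)
  obtain e0 b where e0: "e0 \<in> arcs G0" "0 \<le> b" "b + l g' \<le> l0 e0"
    "\<forall>t\<in>{0..l g'}. \<phi> (edge_point G l g' t) = \<phi>0 (edge_point G0 l0 e0 (b + t))"
    using split.IH[OF split.prems(1) g'(1)] by blast
  have "?\<phi> (edge_point ?S ?l g t) = \<phi>0 (edge_point G0 l0 e0 ((b + c) + t))" if t: "t \<in> {0..?l g}" for t
  proof -
    have "?\<phi> (edge_point ?S ?l g t) = \<phi> (edge_point G l g' (c + t))"
      using U[OF _ t] split.prems(2) by (simp add: g'_def c_def)
    also have "c + t \<in> {0..l g'}" using t g' by auto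
    then have "\<phi> (edge_point G l g' (c + t)) = \<phi>0 (edge_point G0 l0 e0 ((b + c) + t))"
      using e0(4) by (simp add: add.assoc)
    finally show ?thesis .
  qed
  moreover have "0 \<le> b + c" "(b + c) + ?l g \<le> l0 e0" using g' e0 by auto
  ultimately show ?case using e0(1) by blast
qed

text \<open>\<open>S e\<close> collects the arcs into which \<open>e\<close> has been cut. The
  second part concerns all positive lengths on \<open>G\<close>, not only \<open>l\<close>, and so
  identifies a rescaled subdivision with a rescaling of \<open>G0\<close>, vertices included.
  Nonemptiness of \<open>S e\<close> keeps the summed lengths positive.\<close>

lemma refinement_rescaling:
  assumes "refinement G0 l0 \<phi>0 G l \<phi>" "model_via \<Gamma> G0 l0 \<phi>0"
  shows "\<exists>S. (\<forall>e\<in>arcs G0. S e \<subseteq> arcs G \<and> S e \<noteq> {} \<and> l0 e = (\<Sum>i\<in>S e. l i)) \<and>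
    (\<forall>m m0. (\<forall>g\<in>arcs G. 0 < m g) \<longrightarrow> (\<forall>e\<in>arcs G0. m0 e = (\<Sum>i\<in>S e. m i)) \<longrightarrow>
      (\<exists>\<psi>. isometry (metric_graph_of G m) (metric_graph_of G0 m0) \<psi> \<and>
        (\<forall>v\<in>verts G0. \<psi> (Vertex v) = Vertex v)))"
  using assms
proof induction
  case refl
  have "isometry (metric_graph_of G0 m) (metric_graph_of G0 m0) id"
    if "\<forall>e\<in>arcs G0. m0 e = (\<Sum>i\<in>{e}. m i)" for m m0
  proof -
    have "metric_graph_of G0 m = metric_graph_of G0 m0"
      by (rule metric_graph_of_cong) (use that in auto)
    then show ?thesis by (simp add: isometry_id)
  qed
  moreover have "\<forall>v\<in>verts G0. id (Vertex v) = Vertex v" by simp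
  moreover have "\<forall>e\<in>arcs G0. {e} \<subseteq> arcs G0 \<and> {e} \<noteq> {} \<and> l0 e = (\<Sum>i\<in>{e}. l0 i)" by simp
  ultimately show ?case by (intro exI[of _ "\<lambda>e. {e}"] conjI allI impI exI[of _ id])
next
  case (split G l \<phi> e a f w)
  have m: "model_via \<Gamma> G l \<phi>" by (rule refinement_model_via[OF split.hyps(1) split.prems(1)])
  note wm = model_via_weighted[OF m]
  have ef: "f \<noteq> e" using split.hyps by auto
  have w: "w \<notin> verts G"
    using model_via_Interior_notin_verts[OF m] split.hyps by simp
  obtain S where S0: "\<forall>e\<in>arcs G0. S e \<subseteq> arcs G \<and> S e \<noteq> {} \<and> l0 e = (\<Sum>i\<in>S e. l i)"
    and iso0: "\<forall>m m0. (\<forall>g\<in>arcs G. 0 < m g) \<longrightarrow> (\<forall>e\<in>arcs G0. m0 e = (\<Sum>i\<in>S e. m i)) \<longrightarrow>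
      (\<exists>\<psi>. isometry (metric_graph_of G m) (metric_graph_of G0 m0) \<psi> \<and> (\<forall>v\<in>verts G0. \<psi> (Vertex v) = Vertex v))"
    using split.IH[OF split.prems(1)] by blast
  have S: "\<And>e. e \<in> arcs G0 \<Longrightarrow> S e \<subseteq> arcs G \<and> S e \<noteq> {} \<and> l0 e = (\<Sum>i\<in>S e. l i)"
    using S0 by blast
  have iso: "\<And>m m0. \<lbrakk>\<forall>g\<in>arcs G. 0 < m g; \<forall>e\<in>arcs G0. m0 e = (\<Sum>i\<in>S e. m i)\<rbrakk> \<Longrightarrow>
      \<exists>\<psi>. isometry (metric_graph_of G m) (metric_graph_of G0 m0) \<psi> \<and> (\<forall>v\<in>verts G0. \<psi> (Vertex v) = Vertex v)"
    using iso0 by blast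
  \<comment> \<open>The new arc joins each collection containing the arc it was cut from. A sum over
    the pieces then equals the sum before the split with the lengths of \<open>e\<close> and
    \<open>f\<close> merged, which reduces everything to the induction hypothesis.\<close>
  define S' where "S' = (\<lambda>g. if e \<in> S g then insert f (S g) else S g)"
  have sum: "(\<Sum>i\<in>S' g. m i) = (\<Sum>i\<in>S g. (m(e := m e + m f)) i)" if g: "g \<in> arcs G0" for m :: "nat \<Rightarrow> real" and g
  proof -
    have fin: "finite (S g)" "f \<notin> S g"
      using S[OF g] weighted_multigraph_finite_arcs[OF wm] split.hyps(5) by (auto intro: finite_subset)
    show ?thesis
    proof (cases "e \<in> S g")
      case True
      then have "(\<Sum>i\<in>S g. (m(e := m e + m f)) i) = m e + m f + (\<Sum>i\<in>S g - {e}. m i)"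
        using fin by (simp add: sum.remove)
      moreover have "(\<Sum>i\<in>S' g. m i) = m f + (m e + (\<Sum>i\<in>S g - {e}. m i))"
        using True fin by (simp add: S'_def sum.remove)
      ultimately show ?thesis by simp
    next
      case False
      then show ?thesis by (auto simp: S'_def intro!: sum.cong)
    qed
  qed
  let ?G = "split_arc G e w f" and ?l = "l(e := a, f := l e - a)"
  have "S' g \<subseteq> arcs ?G \<and> S' g \<noteq> {} \<and> l0 g = (\<Sum>i\<in>S' g. ?l i)" if g: "g \<in> arcs G0" for g
  proof -
    have "(\<Sum>i\<in>S' g. ?l i) = (\<Sum>i\<in>S g. l i)"
      unfolding sum[OF g] using S[OF g] split.hyps(5) ef by (intro sum.cong) auto
    then show ?thesis using S[OF g] by (auto simp: S'_def)
  qed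
  moreover have "\<exists>\<psi>. isometry (metric_graph_of ?G m) (metric_graph_of G0 m0) \<psi> \<and>
      (\<forall>v\<in>verts G0. \<psi> (Vertex v) = Vertex v)"
    if pos: "\<forall>g\<in>arcs ?G. 0 < m g" and m0: "\<forall>e\<in>arcs G0. m0 e = (\<Sum>i\<in>S' e. m i)" for m m0
  proof -
    let ?m = "m(e := m e + m f)"
    have "0 < m e" "0 < m f" using pos split.hyps(2) by auto
    then have "\<forall>g\<in>arcs G. 0 < ?m g" using pos by auto
    moreover have "\<forall>e\<in>arcs G0. m0 e = (\<Sum>i\<in>S e. ?m i)" using m0 sum by simp
    ultimately obtain \<psi> where \<psi>: "isometry (metric_graph_of G ?m) (metric_graph_of G0 m0) \<psi>"
      "\<forall>v\<in>verts G0. \<psi> (Vertex v) = Vertex v" using iso by blast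
    have "isometry (metric_graph_of ?G m) (metric_graph_of G ?m) (unsplit e w f (m e))"
      by (rule isometry_unsplit[OF wm split.hyps(2,5) w]) (use pos in auto)
    from isometry_comp[OF this \<psi>(1)]
    have "isometry (metric_graph_of ?G m) (metric_graph_of G0 m0) (\<psi> \<circ> unsplit e w f (m e))" .
    moreover have "(\<psi> \<circ> unsplit e w f (m e)) (Vertex v) = Vertex v" if "v \<in> verts G0" for v
      using \<psi>(2) that w refinement_verts[OF split.hyps(1)] by (auto simp: unsplit_def)
    ultimately show ?thesis by blast
  qed
  ultimately show ?case by (intro exI[of _ S']) blast
qed

lemma ex_fresh_arc:
  fixes G :: "('a, nat) pre_digraph"
  assumes "weighted_multigraph G l"
  obtains f where "f \<notin> arcs G"
  using ex_new_if_finite[OF infinite_UNIV_nat weighted_multigraph_finite_arcs[OF assms]] by blast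

lemma ex_refinement:
  assumes m: "model_via \<Gamma> G0 l0 \<phi>0" and "finite P" "P \<subseteq> mspace \<Gamma>"
  obtains G l \<phi> where "refinement G0 l0 \<phi>0 G l \<phi>" "P \<subseteq> verts G"
proof -
  have "\<exists>G l \<phi>. refinement G0 l0 \<phi>0 G l \<phi> \<and> P \<subseteq> verts G"
    using assms(2,3)
  proof (induction P)
    case empty
    then show ?case using refinement.refl by blast
  next
    case (insert p P)
    then obtain G l \<phi> where G: "refinement G0 l0 \<phi>0 G l \<phi>" "P \<subseteq> verts G" by auto
    have mG: "model_via \<Gamma> G l \<phi>" by (rule refinement_model_via[OF G(1) m])
    have "p \<in> mspace \<Gamma>" using insert.prems by simp
    with mG show ?case
    proof (cases rule: model_via_cases)
      case 1
      then show ?thesis using G by blast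
    next
      case (2 e t)
      obtain f where f: "f \<notin> arcs G" by (rule ex_fresh_arc[OF model_via_weighted[OF mG]])
      then have "refinement G0 l0 \<phi>0 (split_arc G e p f) (l(e := t, f := l e - t)) (\<phi> \<circ> unsplit e p f t)"
        using 2 G(1) by (intro refinement.split) auto
      moreover have "insert p P \<subseteq> verts (split_arc G e p f)" using G(2) by auto
      ultimately show ?thesis by blast
    qed
  qed
  then show thesis using that by blast
qed

text \<open>Cutting a loop at its midpoint removes it and creates none, because both halves join the
  new vertex to an old one; half of a rational length is rational. The induction is on the number of
  loops.\<close>

lemma ex_loopfree_model:
  assumes "model_via \<Gamma> G l \<phi>"
  obtains G' l' \<phi>' where "model_via \<Gamma> G' l' \<phi>'" "loopfree_digraph G'"
    "(\<forall>e\<in>arcs G. l e \<in> \<rat>) \<Longrightarrow> (\<forall>e\<in>arcs G'. l' e \<in> \<rat>)"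
proof -
  have "\<exists>G' l' \<phi>'. model_via \<Gamma> G' l' \<phi>' \<and> loopfree_digraph G' \<and>
      ((\<forall>e\<in>arcs G. l e \<in> \<rat>) \<longrightarrow> (\<forall>e\<in>arcs G'. l' e \<in> \<rat>))"
    using assms
  proof (induction "card {e \<in> arcs G. tail G e = head G e}" arbitrary: G l \<phi> rule: less_induct)
    case less
    note wm = model_via_weighted[OF less.prems]
    interpret fin_digraph G by (rule weighted_multigraph_fin_digraph[OF wm])
    show ?case
    proof (cases "\<exists>e\<in>arcs G. tail G e = head G e")
      case False
      then have "loopfree_digraph G" by unfold_locales auto
      then show ?thesis using less.prems by blast
    next
      case True
      then obtain e where e: "e \<in> arcs G" "tail G e = head G e" by blast
      obtain f where f: "f \<notin> arcs G" by (rule ex_fresh_arc[OF wm])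
      define w where "w = \<phi> (Interior e (l e / 2))"
      have half: "0 < l e / 2" "l e / 2 < l e" using weighted_multigraph_pos[OF wm e(1)] by auto
      let ?G = "split_arc G e w f" and ?l = "l(e := l e / 2, f := l e - l e / 2)"
      have m: "model_via \<Gamma> ?G ?l (\<phi> \<circ> unsplit e w f (l e / 2))"
        by (rule model_via_split_arc[OF less.prems e(1) half f w_def])
      have w: "w \<notin> verts G"
        unfolding w_def by (rule model_via_Interior_notin_verts[OF less.prems e(1) half])
      have "{g \<in> arcs ?G. tail ?G g = head ?G g} \<subset> {g \<in> arcs G. tail G g = head G g}"
        using e f w tail_in_verts head_in_verts by (auto split: if_splits)
      then have "card {g \<in> arcs ?G. tail ?G g = head ?G g} < card {g \<in> arcs G. tail G g = head G g}"
        by (intro psubset_card_mono) auto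
      from less.hyps[OF this m] obtain G' l' \<phi>' where G': "model_via \<Gamma> G' l' \<phi>'" "loopfree_digraph G'"
        "(\<forall>e\<in>arcs ?G. ?l e \<in> \<rat>) \<longrightarrow> (\<forall>e\<in>arcs G'. l' e \<in> \<rat>)" by blast
      moreover have "\<forall>g\<in>arcs ?G. ?l g \<in> \<rat>" if "\<forall>g\<in>arcs G. l g \<in> \<rat>"
        using that e(1) by auto
      ultimately show ?thesis by blast
    qed
  qed
  then show thesis using that by blast
qed

section \<open>Rational functions\<close>

lemma metric_graphE:
  assumes "metric_graph \<Gamma>"
  obtains G l \<phi> where "model_via \<Gamma> G l \<phi>"
  using assms by (auto simp: metric_graph_def model_def)

lemma model_via_metric_graph: "model_via \<Gamma> G l \<phi> \<Longrightarrow> metric_graph \<Gamma>"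
  by (auto simp: metric_graph_def model_def)

lemma divisors_iff: "D \<in> divisors \<Gamma> \<longleftrightarrow> (\<forall>x. x \<notin> mspace \<Gamma> \<longrightarrow> Poly_Mapping.lookup D x = 0)"
  by (auto simp: divisors_def in_keys_iff)

lemma principal_divisor_of_metric_graph: "principal_divisor_of \<Gamma> f D \<Longrightarrow> metric_graph \<Gamma>"
  by (auto simp: principal_divisor_of_def intro: model_via_metric_graph)

lemma principal_divisor_of_divisors: "principal_divisor_of \<Gamma> f D \<Longrightarrow> D \<in> divisors \<Gamma>"
  unfolding principal_divisor_of_def divisors_iff
  using outgoing_slope_sum_outside model_via_verts by (metis subsetD)

lemma principal_divisors: "principal \<Gamma> D \<Longrightarrow> D \<in> divisors \<Gamma>"
  by (auto simp: principal_def intro: principal_divisor_of_divisors)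

lemma has_slopes_imp_principal_divisor_of:
  assumes m: "model_via \<Gamma> G l \<phi>" and s: "has_slopes G l \<phi> f s"
  obtains D where "principal_divisor_of \<Gamma> f D" "\<And>x. Poly_Mapping.lookup D x = outgoing_slope_sum G s x"
proof -
  have "{x. outgoing_slope_sum G s x \<noteq> 0} \<subseteq> verts G"
    using outgoing_slope_sum_outside[OF m] by blast
  then have "finite {x. outgoing_slope_sum G s x \<noteq> 0}"
    using weighted_multigraph_finite_verts[OF model_via_weighted[OF m]] by (rule finite_subset)
  then have "Poly_Mapping.lookup (Abs_poly_mapping (outgoing_slope_sum G s)) = outgoing_slope_sum G s"
    by (rule Abs_poly_mapping_inverse[simplified])
  then show thesis using that[of "Abs_poly_mapping (outgoing_slope_sum G s)"] assms
    unfolding principal_divisor_of_def by metis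
qed

text \<open>It is enough to add the vertices of all the individual models to \<open>G0\<close>: by
  \<open>has_slopes_transfer\<close> each function is then affine along the result. This is why only
  the vertex sets \<open>V i\<close> are chosen.\<close>

lemma ex_common_model:
  assumes m: "model_via \<Gamma> G0 l0 \<phi>0" and I: "finite I"
    and f: "\<And>i. i \<in> I \<Longrightarrow> principal_divisor_of \<Gamma> (f i) (D i)" and P: "finite P" "P \<subseteq> mspace \<Gamma>"
  obtains G l \<phi> s where "refinement G0 l0 \<phi>0 G l \<phi>" "P \<subseteq> verts G"
    "\<And>i. i \<in> I \<Longrightarrow> has_slopes G l \<phi> (f i) (s i)"
    "\<And>i x. i \<in> I \<Longrightarrow> Poly_Mapping.lookup (D i) x = outgoing_slope_sum G (s i) x"
proof -
  have "\<forall>i\<in>I. \<exists>V. finite V \<and> V \<subseteq> mspace \<Gamma> \<and> (\<exists>G l \<phi> s. V = verts G \<and> model_via \<Gamma> G l \<phi> \<and>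
      has_slopes G l \<phi> (f i) s \<and> (\<forall>x. Poly_Mapping.lookup (D i) x = outgoing_slope_sum G s x))"
  proof
    fix i assume "i \<in> I"
    then obtain G l \<phi> s where G: "model_via \<Gamma> G l \<phi>" "has_slopes G l \<phi> (f i) s"
      "\<forall>x. Poly_Mapping.lookup (D i) x = outgoing_slope_sum G s x"
      using f unfolding principal_divisor_of_def by blast
    then show "\<exists>V. finite V \<and> V \<subseteq> mspace \<Gamma> \<and> (\<exists>G l \<phi> s. V = verts G \<and> model_via \<Gamma> G l \<phi> \<and>
      has_slopes G l \<phi> (f i) s \<and> (\<forall>x. Poly_Mapping.lookup (D i) x = outgoing_slope_sum G s x))"
      using weighted_multigraph_finite_verts[OF model_via_weighted[OF G(1)]] model_via_verts[OF G(1)]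
      by blast
  qed
  from bchoice[OF this] obtain V where V0: "\<forall>i\<in>I. finite (V i) \<and> V i \<subseteq> mspace \<Gamma> \<and>
      (\<exists>G l \<phi> s. V i = verts G \<and> model_via \<Gamma> G l \<phi> \<and>
      has_slopes G l \<phi> (f i) s \<and> (\<forall>x. Poly_Mapping.lookup (D i) x = outgoing_slope_sum G s x))" ..
  note V = bspec[OF V0]
  have "finite (P \<union> (\<Union>i\<in>I. V i))" "P \<union> (\<Union>i\<in>I. V i) \<subseteq> mspace \<Gamma>"
    using V I P by auto
  from ex_refinement[OF m this] obtain G l \<phi> where
    G: "refinement G0 l0 \<phi>0 G l \<phi>" "P \<union> (\<Union>i\<in>I. V i) \<subseteq> verts G" by blast
  have mG: "model_via \<Gamma> G l \<phi>" by (rule refinement_model_via[OF G(1) m])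
  have "\<forall>i\<in>I. \<exists>s. has_slopes G l \<phi> (f i) s \<and> (\<forall>x. Poly_Mapping.lookup (D i) x = outgoing_slope_sum G s x)"
  proof
    fix i assume i: "i \<in> I"
    then obtain G2 l2 \<phi>2 s2 where G2: "V i = verts G2" "model_via \<Gamma> G2 l2 \<phi>2"
      "has_slopes G2 l2 \<phi>2 (f i) s2" "\<forall>x. Poly_Mapping.lookup (D i) x = outgoing_slope_sum G2 s2 x"
      using V by blast
    have "verts G2 \<subseteq> verts G" using G2(1) G(2) i by blast
    from has_slopes_transfer[OF mG G2(2) this G2(3)]
    obtain s where "has_slopes G l \<phi> (f i) s" "outgoing_slope_sum G s = outgoing_slope_sum G2 s2" .
    then show "\<exists>s. has_slopes G l \<phi> (f i) s \<and> (\<forall>x. Poly_Mapping.lookup (D i) x = outgoing_slope_sum G s x)"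
      using G2(4) by auto
  qed
  from bchoice[OF this] obtain s where "\<forall>i\<in>I. has_slopes G l \<phi> (f i) (s i) \<and>
    (\<forall>x. Poly_Mapping.lookup (D i) x = outgoing_slope_sum G (s i) x)" ..
  then show thesis using that[of G l \<phi> s] G by blast
qed

section \<open>The group of principal divisors\<close>

lemma principal_0: "metric_graph \<Gamma> \<Longrightarrow> principal \<Gamma> 0"
  unfolding principal_def principal_divisor_of_def
  by (erule metric_graphE, intro exI[of _ "\<lambda>_. 0"] exI conjI allI, assumption)
    (auto simp: has_slopes_def outgoing_slope_sum_def intro: exI[of _ "\<lambda>_. 0"])

lemma principal_diff:
  assumes "principal \<Gamma> D" "principal \<Gamma> E"
  shows "principal \<Gamma> (D - E)"
proof -
  obtain f g where fg: "principal_divisor_of \<Gamma> f D" "principal_divisor_of \<Gamma> g E"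
    using assms by (auto simp: principal_def)
  obtain G0 l0 \<phi>0 where m: "model_via \<Gamma> G0 l0 \<phi>0"
    using metric_graphE[OF principal_divisor_of_metric_graph[OF fg(1)]] by blast
  \<comment> \<open>The two functions form a family indexed by truth values, to obtain one model for
    both.\<close>
  have fg': "\<And>i. i \<in> UNIV \<Longrightarrow> principal_divisor_of \<Gamma> (if i then f else g) (if i then D else E)"
    using fg by simp
  obtain G l \<phi> s where G: "refinement G0 l0 \<phi>0 G l \<phi>"
    "\<And>i. has_slopes G l \<phi> (if i then f else g) (s i)"
    "\<And>i x. Poly_Mapping.lookup (if i then D else E) x = outgoing_slope_sum G (s i) x"
    by (rule ex_common_model[where f = "\<lambda>i. if i then f else g" and D = "\<lambda>i. if i then D else E",
        OF m finite[of "UNIV :: bool set"] fg' finite.emptyI empty_subsetI]) auto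
  have "has_slopes G l \<phi> (\<lambda>x. f x - g x) (\<lambda>e. s True e - s False e)"
    using G(2)[of True] G(2)[of False] by (simp add: has_slopes_def algebra_simps)
  moreover have "outgoing_slope_sum G (\<lambda>e. s True e - s False e) x
      = outgoing_slope_sum G (s True) x - outgoing_slope_sum G (s False) x" for x
    by (simp add: outgoing_slope_sum_def sum_subtractf sum_negf)
  then have "Poly_Mapping.lookup (D - E) x = outgoing_slope_sum G (\<lambda>e. s True e - s False e) x" for x
    using G(3)[of True x] G(3)[of False x] by (simp add: lookup_minus)
  ultimately show ?thesis
    using refinement_model_via[OF G(1) m] unfolding principal_def principal_divisor_of_def by blast
qed

lemma sum_msphere_principal:
  assumes "principal_divisor_of \<Gamma> f D" "x \<in> mspace \<Gamma>"
  shows "\<forall>\<^sub>F r in at_right 0. (\<Sum>y\<in>msphere \<Gamma> x r. f y - f x) = r * Poly_Mapping.lookup D x"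
  using assms sum_msphere_has_slopes unfolding principal_divisor_of_def by metis

lemma principal_divisor_of_lipschitz:
  assumes "principal_divisor_of \<Gamma> f D"
  obtains M where "0 < M" "\<And>x y. x \<in> mspace \<Gamma> \<Longrightarrow> y \<in> mspace \<Gamma> \<Longrightarrow> \<bar>f y - f x\<bar> \<le> M * mdist \<Gamma> x y"
  using assms has_slopes_lipschitz unfolding principal_divisor_of_def by metis

lemma eventually_finite_msphere:
  assumes "model_via \<Gamma> G l \<phi>" "x \<in> mspace \<Gamma>"
  shows "\<forall>\<^sub>F r in at_right 0. finite (msphere \<Gamma> x r)"
  using assms
proof (cases rule: model_via_cases)
  case 1
  from eventually_at_right_0_pos eventually_at_right_0_short[OF model_via_weighted[OF assms(1)]]
  show ?thesis
    by eventually_elim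
      (use 1 weighted_multigraph_finite_arcs[OF model_via_weighted[OF assms(1)]] in
        \<open>simp add: msphere_Vertex[OF assms(1)]\<close>)
next
  case (2 e t)
  then have e: "0 < l e - t" by simp
  from eventually_at_right_0_pos eventually_at_right_0_less[OF 2(2)] eventually_at_right_0_less[OF e]
  show ?thesis
    by eventually_elim (use 2 in \<open>simp add: msphere_Interior[OF assms(1)]\<close>)
qed

section \<open>Truncation of a rational function from below\<close>

lemma affine_same_side:
  fixes k s c L :: real
  assumes "\<And>z::real. 0 < z \<Longrightarrow> z < L \<Longrightarrow> k + s * z = c \<Longrightarrow> s = 0"
  shows "(\<forall>t::real\<in>{0..L}. c \<le> k + s * t) \<or> (\<forall>t::real\<in>{0..L}. k + s * t \<le> c)"
proof (rule ccontr)
  assume "\<not> ?thesis"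
  then obtain t1 t2 where t: "t1 \<in> {0..L}" "t2 \<in> {0..L}" "k + s * t1 < c" "c < k + s * t2"
    by (auto simp: not_le)
  then have s: "s \<noteq> 0" by auto
  define z where "z = (c - k) / s"
  have z: "k + s * z = c" using s by (simp add: z_def)
  have "s * t1 < s * z" "s * z < s * t2" using t z by auto
  then have "0 < z \<and> z < L" using t(1,2) s by (cases "0 < s") (auto simp: mult_less_cancel_left)
  then show False using assms[of z] z s by auto
qed

text \<open>Once the points where \<open>f\<close> crosses \<open>c\<close> are vertices, every edge
  lies on one side of the level, so the truncated function is affine on it, with the old slope or
  slope 0.\<close>

lemma principal_divisor_of_max:
  assumes "principal_divisor_of \<Gamma> f D"
  obtains E where "principal_divisor_of \<Gamma> (\<lambda>x. max (f x) c) E"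
proof -
  obtain G l \<phi> s where m: "model_via \<Gamma> G l \<phi>" and s: "has_slopes G l \<phi> f s"
    using assms by (auto simp: principal_divisor_of_def)
  \<comment> \<open>On an edge of slope 0, division by zero gives the parameter 0, so only the tail,
    already a vertex, enters \<open>P\<close>.\<close>
  let ?z = "\<lambda>e. (c - f (\<phi> (edge_point G l e 0))) / s e"
  define P where "P = (\<lambda>e. \<phi> (edge_point G l e (?z e))) ` {e \<in> arcs G. ?z e \<in> {0..l e}}"
  have "finite P" "P \<subseteq> mspace \<Gamma>"
    using weighted_multigraph_finite_arcs[OF model_via_weighted[OF m]] model_via_edge_point[OF m]
    by (auto simp: P_def)
  from ex_refinement[OF m this] obtain G' l' \<phi>' where
    ref: "refinement G l \<phi> G' l' \<phi>'" and P: "P \<subseteq> verts G'" by blast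
  have m': "model_via \<Gamma> G' l' \<phi>'" by (rule refinement_model_via[OF ref m])
  obtain s' where s': "has_slopes G' l' \<phi>' f s'"
    using has_slopes_transfer[OF m' m refinement_verts[OF ref] s] by blast
  have side: "(\<forall>t::real\<in>{0..l' g}. c \<le> f (\<phi>' (edge_point G' l' g 0)) + s' g * t) \<or>
      (\<forall>t::real\<in>{0..l' g}. f (\<phi>' (edge_point G' l' g 0)) + s' g * t \<le> c)" if g: "g \<in> arcs G'" for g
  proof (rule affine_same_side)
    fix z :: real assume z: "0 < z" "z < l' g" "f (\<phi>' (edge_point G' l' g 0)) + s' g * z = c"
    obtain e b where e: "e \<in> arcs G" "0 \<le> b" "b + l' g \<le> l e"
      "\<And>t. t \<in> {0..l' g} \<Longrightarrow> \<phi>' (edge_point G' l' g t) = \<phi> (edge_point G l e (b + t))"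
      using refinement_subedge[OF ref m g] by blast
    have se: "f (\<phi> (edge_point G l e u)) = f (\<phi> (edge_point G l e 0)) + s e * u" if "u \<in> {0..l e}" for u :: real
      using s e(1) that by (auto simp: has_slopes_def)
    have sg: "f (\<phi>' (edge_point G' l' g u)) = f (\<phi>' (edge_point G' l' g 0)) + s' g * u" if "u \<in> {0..l' g}" for u :: real
      using s' g that by (auto simp: has_slopes_def)
    have eq: "f (\<phi>' (edge_point G' l' g 0)) + s' g * u = f (\<phi> (edge_point G l e 0)) + s e * (b + u)"
      if "u \<in> {0..l' g}" for u :: real
      using se[of "b + u"] sg[OF that] e that by auto
    show "real_of_int (s' g) = 0"
    proof (rule ccontr)
      assume "real_of_int (s' g) \<noteq> 0"
      moreover have "s' g * z = s e * z" using eq[of 0] eq[of z] z by (simp add: algebra_simps)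
      ultimately have "real_of_int (s e) \<noteq> 0" using z(1) by auto
      moreover have "f (\<phi> (edge_point G l e 0)) + s e * (b + z) = c" using eq[of z] z by simp
      ultimately have "?z e = b + z" by (simp add: field_simps)
      then have "\<phi> (edge_point G l e (b + z)) \<in> P" using e z unfolding P_def by force
      then have "\<phi>' (Interior g z) \<in> verts G'" using e(4)[of z] z P by auto
      then show False using model_via_Interior_notin_verts[OF m' g z(1,2)] by blast
    qed
  qed
  define \<sigma> where "\<sigma> = (\<lambda>g. if \<forall>t::real\<in>{0..l' g}. c \<le> f (\<phi>' (edge_point G' l' g 0)) + s' g * t then s' g else 0)"
  have "has_slopes G' l' \<phi>' (\<lambda>x. max (f x) c) \<sigma>"
    unfolding has_slopes_def
  proof (intro ballI)
    fix g and t :: real assume g: "g \<in> arcs G'" and t: "t \<in> {0..l' g}"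
    have 0: "(0::real) \<in> {0..l' g}" using t by auto
    have ft: "f (\<phi>' (edge_point G' l' g t)) = f (\<phi>' (edge_point G' l' g 0)) + s' g * t"
      using s' g t by (auto simp: has_slopes_def)
    show "max (f (\<phi>' (edge_point G' l' g t))) c = max (f (\<phi>' (edge_point G' l' g 0))) c + \<sigma> g * t"
    proof (cases "\<forall>t::real\<in>{0..l' g}. c \<le> f (\<phi>' (edge_point G' l' g 0)) + s' g * t")
      case True
      from bspec[OF True t] bspec[OF True 0] show ?thesis using True ft by (simp add: \<sigma>_def)
    next
      case False
      with side[OF g] have le: "\<forall>t::real\<in>{0..l' g}. f (\<phi>' (edge_point G' l' g 0)) + s' g * t \<le> c" by blast
      have "\<sigma> g = 0" using False unfolding \<sigma>_def by (rule if_not_P)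
      then show ?thesis using bspec[OF le t] bspec[OF le 0] unfolding ft by simp
    qed
  qed
  from has_slopes_imp_principal_divisor_of[OF m' this] show thesis using that by blast
qed

text \<open>All three parts compare sums over small spheres. Below the level the truncated function
  has a minimum at \<open>x\<close>; above it truncation can only raise the neighbours. In the last
  part both sums vanish: the one for the truncation forces \<open>f y \<le> c\<close> on the sphere,
  and then the one for \<open>f\<close> has terms of one sign.\<close>

lemma max_divisor_bounds:
  assumes f: "principal_divisor_of \<Gamma> f D" and h: "principal_divisor_of \<Gamma> (\<lambda>x. max (f x) c) E"
    and x: "x \<in> mspace \<Gamma>"
  shows "f x \<le> c \<Longrightarrow> 0 \<le> Poly_Mapping.lookup E x"
    and "c \<le> f x \<Longrightarrow> Poly_Mapping.lookup D x \<le> Poly_Mapping.lookup E x"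
    and "\<lbrakk>f x = c; Poly_Mapping.lookup E x = 0; Poly_Mapping.lookup D x = 0\<rbrakk>
      \<Longrightarrow> \<forall>\<^sub>F r in at_right 0. \<forall>y\<in>msphere \<Gamma> x r. f y = c"
proof -
  note ev = sum_msphere_principal[OF f x] sum_msphere_principal[OF h x] eventually_at_right_0_pos
  show "0 \<le> Poly_Mapping.lookup E x" if fx: "f x \<le> c"
  proof -
    from ev have "\<forall>\<^sub>F r in at_right (0::real). 0 \<le> Poly_Mapping.lookup E x"
    proof eventually_elim
      case (elim r)
      have "0 \<le> (\<Sum>y\<in>msphere \<Gamma> x r. max (f y) c - max (f x) c)"
        by (rule sum_nonneg) (use fx in auto)
      then show ?case using elim by (simp add: zero_le_mult_iff)
    qed
    then show ?thesis by (simp add: eventually_const_iff)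
  qed
  show "Poly_Mapping.lookup D x \<le> Poly_Mapping.lookup E x" if fx: "c \<le> f x"
  proof -
    from ev have "\<forall>\<^sub>F r in at_right (0::real). Poly_Mapping.lookup D x \<le> Poly_Mapping.lookup E x"
    proof eventually_elim
      case (elim r)
      have "(\<Sum>y\<in>msphere \<Gamma> x r. f y - f x) \<le> (\<Sum>y\<in>msphere \<Gamma> x r. max (f y) c - max (f x) c)"
        by (rule sum_mono) (use fx in auto)
      then show ?case using elim by simp
    qed
    then show ?thesis by (simp add: eventually_const_iff)
  qed
  assume fx: "f x = c" and 0: "Poly_Mapping.lookup E x = 0" "Poly_Mapping.lookup D x = 0"
  obtain G l \<phi> where m: "model_via \<Gamma> G l \<phi>"
    using metric_graphE[OF principal_divisor_of_metric_graph[OF f]] by blast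
  from ev eventually_finite_msphere[OF m x]
  show "\<forall>\<^sub>F r in at_right 0. \<forall>y\<in>msphere \<Gamma> x r. f y = c"
  proof eventually_elim
    case (elim r)
    then have "(\<Sum>y\<in>msphere \<Gamma> x r. max (f y) c - c) = 0" using fx 0 by simp
    then have le: "f y \<le> c" if "y \<in> msphere \<Gamma> x r" for y
      using elim(4) that by (subst (asm) sum_nonneg_eq_0_iff) auto
    have "(\<Sum>y\<in>msphere \<Gamma> x r. f y - c) = 0" using elim fx 0 by simp
    then have "(\<Sum>y\<in>msphere \<Gamma> x r. c - f y) = 0" by (simp add: sum_subtractf)
    then show ?case using elim(4) le by (subst (asm) sum_nonneg_eq_0_iff) auto
  qed
qed

text \<open>Translates statements about spheres into statements about nearby parameters on an edge.
  For large radii a shortcut through other edges could make the distance smaller than the difference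
  of parameters.\<close>

lemma eventually_edge_in_msphere:
  assumes m: "model_via \<Gamma> G l \<phi>" and e: "e \<in> arcs G" and z: "z \<in> {0..l e}"
  shows "\<forall>\<^sub>F r in at_right 0. \<forall>z'\<in>{0..l e}. \<bar>z' - z\<bar> = r \<longrightarrow>
    \<phi> (edge_point G l e z') \<in> msphere \<Gamma> (\<phi> (edge_point G l e z)) r"
proof -
  note wm = model_via_weighted[OF m]
  have le: "0 < l e" by (rule weighted_multigraph_pos[OF wm e])
  consider "z = 0" | "z = l e" | "0 < z" "z < l e" using z by fastforce
  then show ?thesis
  proof cases
    case 1
    from eventually_at_right_0_pos eventually_at_right_0_short[OF wm]
    show ?thesis
    proof eventually_elim
      case (elim r)
      then have "r < l e" using e le by auto
      then show ?case
        using elim 1 e model_via_Vertex[OF m weighted_multigraph_tail[OF wm e]]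
        by (auto simp: msphere_Vertex[OF m weighted_multigraph_tail[OF wm e]])
    qed
  next
    case 2
    from eventually_at_right_0_pos eventually_at_right_0_short[OF wm]
    show ?thesis
    proof eventually_elim
      case (elim r)
      then have r: "r < l e" using e le by auto
      show ?case
      proof (intro ballI impI)
        fix z' assume z': "z' \<in> {0..l e}" "\<bar>z' - z\<bar> = r"
        then have "z' = l e - r" using 2 by auto
        then show "\<phi> (edge_point G l e z') \<in> msphere \<Gamma> (\<phi> (edge_point G l e z)) r"
          using elim r 2 e model_via_Vertex[OF m weighted_multigraph_head[OF wm e]] le
          by (auto simp: msphere_Vertex[OF m weighted_multigraph_head[OF wm e]] edge_point_end)
      qed
    qed
  next
    case 3
    then have pos: "0 < l e - z" by simp
    from eventually_at_right_0_pos eventually_at_right_0_less[OF 3(1)] eventually_at_right_0_less[OF pos]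
    show ?thesis
    proof eventually_elim
      case (elim r)
      show ?case
      proof (intro ballI impI)
        fix z' assume z': "z' \<in> {0..l e}" "\<bar>z' - z\<bar> = r"
        then have "z' = z + r \<or> z' = z - r" by auto
        then show "\<phi> (edge_point G l e z') \<in> msphere \<Gamma> (\<phi> (edge_point G l e z)) r"
          using elim 3 by (auto simp: msphere_Interior[OF m e])
      qed
    qed
  qed
qed

text \<open>The level set of \<open>f\<close> is open and closed in the segment.\<close>

lemma constant_on_segment:
  assumes m: "model_via \<Gamma> G l \<phi>" and e: "e \<in> arcs G" and f: "principal_divisor_of \<Gamma> f D"
    and seg: "0 \<le> \<alpha>" "\<beta> \<le> l e" and t: "t \<in> {\<alpha>..\<beta>}" "f (\<phi> (edge_point G l e t)) = c"
    and loc: "\<And>z. \<lbrakk>z \<in> {\<alpha>..\<beta>}; f (\<phi> (edge_point G l e z)) = c\<rbrakk> \<Longrightarrow>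
      \<forall>\<^sub>F r in at_right 0. \<forall>y\<in>msphere \<Gamma> (\<phi> (edge_point G l e z)) r. f y = c"
    and z: "z \<in> {\<alpha>..\<beta>}"
  shows "f (\<phi> (edge_point G l e z)) = c"
proof -
  let ?g = "\<lambda>z. f (\<phi> (edge_point G l e z))"
  obtain M where M: "0 < M" "\<And>x y. x \<in> mspace \<Gamma> \<Longrightarrow> y \<in> mspace \<Gamma> \<Longrightarrow> \<bar>f y - f x\<bar> \<le> M * mdist \<Gamma> x y"
    using principal_divisor_of_lipschitz[OF f] by metis
  have lip: "\<bar>?g b - ?g a\<bar> \<le> M * \<bar>b - a\<bar>" if "a \<in> {\<alpha>..\<beta>}" "b \<in> {\<alpha>..\<beta>}" for a b
  proof -
    have ab: "a \<in> {0..l e}" "b \<in> {0..l e}" using that seg by auto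
    have "\<bar>?g b - ?g a\<bar> \<le> M * mdist \<Gamma> (\<phi> (edge_point G l e a)) (\<phi> (edge_point G l e b))"
      using M(2) model_via_edge_point[OF m e] ab by blast
    also have "\<dots> \<le> M * \<bar>b - a\<bar>"
      using model_via_mdist_edge_points[OF m e ab] M(1) by (simp add: mult_left_mono)
    finally show ?thesis .
  qed
  have "(?g z = c) = (?g t = c)"
  proof (rule connected_local_const[where f = "\<lambda>z. ?g z = c"])
    show "\<forall>a\<in>{\<alpha>..\<beta>}. \<forall>\<^sub>F b in at a within {\<alpha>..\<beta>}. (?g a = c) = (?g b = c)"
    proof
      fix a assume a: "a \<in> {\<alpha>..\<beta>}"
      then have a0: "a \<in> {0..l e}" using seg by auto
      show "\<forall>\<^sub>F b in at a within {\<alpha>..\<beta>}. (?g a = c) = (?g b = c)"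
      proof (cases "?g a = c")
        case True
        from loc[OF a True] eventually_edge_in_msphere[OF m e a0]
        have "\<forall>\<^sub>F r in at_right 0. \<forall>z'\<in>{0..l e}. \<bar>z' - a\<bar> = r \<longrightarrow> ?g z' = c"
          by eventually_elim blast
        then obtain d where d: "0 < d"
          "\<And>r z'. \<lbrakk>0 < r; r < d; z' \<in> {0..l e}; \<bar>z' - a\<bar> = r\<rbrakk> \<Longrightarrow> ?g z' = c"
          by (auto simp: eventually_at_right_field)
        have "?g b = c" if "b \<in> {\<alpha>..\<beta>}" "b \<noteq> a" "dist b a < d" for b
          using d(2)[of "\<bar>b - a\<bar>" b] that seg by (auto simp: dist_real_def)
        then show ?thesis using True d(1) unfolding eventually_at by blast
      next
        case False
        \<comment> \<open>Within this radius the Lipschitz bound keeps \<open>f\<close> away from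
          the value \<open>c\<close>.\<close>
        define d where "d = \<bar>?g a - c\<bar> / M"
        have d: "0 < d" using False M(1) by (simp add: d_def)
        have "?g b \<noteq> c" if b: "b \<in> {\<alpha>..\<beta>}" "b \<noteq> a" "dist b a < d" for b
        proof
          assume "?g b = c"
          then have "\<bar>?g a - c\<bar> \<le> M * \<bar>b - a\<bar>" using lip[OF a b(1)] by simp
          also have "\<dots> < M * d" using b(3) M(1) by (simp add: dist_real_def)
          finally show False using M(1) by (simp add: d_def)
        qed
        then show ?thesis using False d unfolding eventually_at by blast
      qed
    qed
  qed (use t z in auto)
  then show ?thesis using t(2) by simp
qed

text \<open>A firing move that sends one chip inwards from each end of the segment between the
  parameters \<open>a\<close> and \<open>b\<close>, until one of the two reaches the parameter \<open>t\<close>.\<close>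

lemma tent_divisor:
  assumes m: "model_via \<Gamma> G0 l0 \<phi>0" and lf: "loopfree_digraph G0" and e: "e \<in> arcs G0"
    and abt: "0 \<le> a" "a < t" "t < b" "b \<le> l0 e"
  obtains g E where "principal_divisor_of \<Gamma> g E"
    "\<And>x. (if x \<in> {\<phi>0 (edge_point G0 l0 e a), \<phi>0 (edge_point G0 l0 e b)} then - 1 else 0)
        \<le> Poly_Mapping.lookup E x"
    "1 \<le> Poly_Mapping.lookup E (\<phi>0 (edge_point G0 l0 e t))"
proof -
  let ?\<gamma> = "\<lambda>z. \<phi>0 (edge_point G0 l0 e z)"
  note wm = model_via_weighted[OF m]
  have le: "0 < l0 e" by (rule weighted_multigraph_pos[OF wm e])
  \<comment> \<open>The time at which the first of two chips, moving at unit speed from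
    \<open>a\<close> and \<open>b\<close>, arrives at \<open>t\<close>.\<close>
  define h where "h = min (t - a) (b - t)"
  have h: "0 < h" "a + h \<le> b - h" "h = t - a \<or> h = b - t" "h \<le> t - a" "h \<le> b - t"
    using abt by (auto simp: h_def min_def)
  \<comment> \<open>Slope -1 from \<open>a\<close> on, a plateau at \<open>- h\<close>, then slope 1
    up to \<open>b\<close>. The inward slopes at \<open>a\<close> and \<open>b\<close> are -1, and
    the outgoing slopes add up to a positive number at the inner corners, one of which is
    \<open>t\<close>.\<close>
  define \<kappa> where "\<kappa> = (\<lambda>z. max (- h) (- max 0 (min (z - a) (b - z))))"
  have \<kappa>0: "\<kappa> z = 0" if "z \<le> a \<or> b \<le> z" for z
    using that h abt by (auto simp: \<kappa>_def)
  define g where "g = (\<lambda>x. case inv_into (points G0 l0) \<phi>0 x of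
    Vertex v \<Rightarrow> 0 | Interior e' z \<Rightarrow> if e' = e then \<kappa> z else 0)"
  have inj: "inj_on \<phi>0 (points G0 l0)" using model_via_bij[OF m] by (simp add: bij_betw_def)
  have gv: "g v = 0" if "v \<in> verts G0" for v
    using inv_into_f_f[OF inj, of "Vertex v"] that model_via_Vertex[OF m that] by (simp add: g_def)
  have gi: "g (\<phi>0 (Interior e' z)) = (if e' = e then \<kappa> z else 0)" if "e' \<in> arcs G0" "0 < z" "z < l0 e'" for e' z
    using inv_into_f_f[OF inj, of "Interior e' z"] that by (simp add: g_def)
  have ge: "g (\<phi>0 (edge_point G0 l0 e' z)) = (if e' = e then \<kappa> z else 0)" if "e' \<in> arcs G0" "z \<in> {0..l0 e'}" for e' z
  proof -
    consider "z = 0" | "z = l0 e'" | "0 < z" "z < l0 e'" using \<open>z \<in> _\<close> by fastforce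
    then show ?thesis
    proof cases
      case 1
      then show ?thesis using gv weighted_multigraph_tail[OF wm that(1)] \<kappa>0[of 0] abt
          model_via_tail[OF m that(1)] by simp
    next
      case 2
      then show ?thesis using gv weighted_multigraph_head[OF wm that(1)] \<kappa>0[of "l0 e"] abt
          model_via_head[OF m that(1)] by simp
    next
      case 3
      then show ?thesis using gi[OF that(1)] by simp
    qed
  qed
  \<comment> \<open>All break points of the tent become vertices, so each subedge lies in a range
    where the tent is affine.\<close>
  have "{a, a + h, b - h, b} \<subseteq> {0..l0 e}" using abt h by auto
  then have "finite (?\<gamma> ` {a, a + h, b - h, b})" "?\<gamma> ` {a, a + h, b - h, b} \<subseteq> mspace \<Gamma>"
    using model_via_edge_point[OF m e] by blast+
  from ex_refinement[OF m this] obtain G l \<phi> where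
    ref: "refinement G0 l0 \<phi>0 G l \<phi>" and P: "?\<gamma> ` {a, a + h, b - h, b} \<subseteq> verts G" by blast
  have m': "model_via \<Gamma> G l \<phi>" by (rule refinement_model_via[OF ref m])
  have "\<exists>\<sigma>::int. \<forall>z::real\<in>{0..l i}. g (\<phi> (edge_point G l i z)) = g (\<phi> (edge_point G l i 0)) + \<sigma> * z"
    if i: "i \<in> arcs G" for i
  proof -
    obtain e' c where e': "e' \<in> arcs G0" "0 \<le> c" "c + l i \<le> l0 e'"
      "\<And>z. z \<in> {0..l i} \<Longrightarrow> \<phi> (edge_point G l i z) = \<phi>0 (edge_point G0 l0 e' (c + z))"
      using refinement_subedge[OF ref m i] by blast
    have li: "0 < l i" by (rule weighted_multigraph_pos[OF model_via_weighted[OF m'] i])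
    have gz: "g (\<phi> (edge_point G l i z)) = (if e' = e then \<kappa> (c + z) else 0)" if "z \<in> {0..l i}" for z
      using e'(4)[OF that] ge[OF e'(1), of "c + z"] e'(2,3) that by simp
    show ?thesis
    proof (cases "e' = e")
      case False
      then show ?thesis using gz gz[of 0] li by (intro exI[of _ 0]) (auto simp del: edge_point_0)
    next
      case True
      have brk: "\<not> (c < w \<and> w < c + l i)" if w: "w \<in> {a, a + h, b - h, b}" for w
      proof
        assume cw: "c < w \<and> w < c + l i"
        then have "\<phi> (Interior i (w - c)) = ?\<gamma> w" using e'(4)[of "w - c"] True by simp
        then have "\<phi> (Interior i (w - c)) \<in> verts G" using P w by auto
        then show False using model_via_Interior_notin_verts[OF m' i, of "w - c"] cw by simp
      qed
      have "\<exists>\<sigma>::int. \<forall>z::real\<in>{0..l i}. \<kappa> (c + z) = \<kappa> c + \<sigma> * z"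
      proof -
        have "(a \<le> c \<or> c + l i \<le> a) \<and> (a + h \<le> c \<or> c + l i \<le> a + h)
          \<and> (b - h \<le> c \<or> c + l i \<le> b - h) \<and> (b \<le> c \<or> c + l i \<le> b)"
          using brk[of a] brk[of "a + h"] brk[of "b - h"] brk[of b] by (simp add: not_less not_le)
        then consider "c + l i \<le> a" | "a \<le> c" "c + l i \<le> a + h" | "a + h \<le> c" "c + l i \<le> b - h"
          | "b - h \<le> c" "c + l i \<le> b" | "b \<le> c"
          by blast
        then show ?thesis
        proof cases
          case 1
          have "\<forall>z\<in>{0..l i}. \<kappa> (c + z) = \<kappa> c + of_int (0) * z" using 1 li by (simp add: \<kappa>0)
          then show ?thesis by blast
        next
          case 2
          have k: "\<kappa> w = a - w" if "a \<le> w" "w \<le> a + h" for w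
            using that h(1,2) unfolding \<kappa>_def by linarith
          have "\<forall>z\<in>{0..l i}. \<kappa> (c + z) = \<kappa> c + of_int (- 1) * z" using 2 li by (simp add: k)
          then show ?thesis by blast
        next
          case 3
          have k: "\<kappa> w = - h" if "a + h \<le> w" "w \<le> b - h" for w
            using that h(1,2) unfolding \<kappa>_def by linarith
          have "\<forall>z\<in>{0..l i}. \<kappa> (c + z) = \<kappa> c + of_int (0) * z" using 3 li by (simp add: k)
          then show ?thesis by blast
        next
          case 4
          have k: "\<kappa> w = w - b" if "b - h \<le> w" "w \<le> b" for w
            using that h(1,2) unfolding \<kappa>_def by linarith
          have "\<forall>z\<in>{0..l i}. \<kappa> (c + z) = \<kappa> c + of_int (1) * z" using 4 li by (simp add: k)
          then show ?thesis by blast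
        next
          case 5
          have "\<forall>z\<in>{0..l i}. \<kappa> (c + z) = \<kappa> c + of_int (0) * z" using 5 li by (simp add: \<kappa>0)
          then show ?thesis by blast
        qed
      qed
      then show ?thesis using gz gz[of 0] True li by (simp del: edge_point_0)
    qed
  qed
  then obtain \<sigma> where "has_slopes G l \<phi> g \<sigma>" unfolding has_slopes_def by metis
  from has_slopes_imp_principal_divisor_of[OF m' this] obtain E where E: "principal_divisor_of \<Gamma> g E" by blast
  \<comment> \<open>Only lower bounds on coefficients matter for effectivity, and these follow from
    lower bounds on sphere sums.\<close>
  have lower: "k \<le> Poly_Mapping.lookup E x"
    if x: "x \<in> mspace \<Gamma>" and "\<forall>\<^sub>F r in at_right 0. r * real_of_int k \<le> (\<Sum>y\<in>msphere \<Gamma> x r. g y - g x)" for x k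
  proof -
    from that(2) sum_msphere_principal[OF E x] eventually_at_right_0_pos
    have "\<forall>\<^sub>F r in at_right (0::real). k \<le> Poly_Mapping.lookup E x"
      by eventually_elim simp
    then show ?thesis by (simp add: eventually_const_iff)
  qed
  have vert: "(if x \<in> {?\<gamma> a, ?\<gamma> b} then - 1 else 0) \<le> Poly_Mapping.lookup E x" if x: "x \<in> verts G0" for x
  proof (rule lower)
    \<comment> \<open>Radii below \<open>d\<close> do not reach the tent from an end of the edge
      unless the tent starts there; in that case the value 1 stands for no restriction.\<close>
    define d where "d = min (if a = 0 then 1 else a) (if b = l0 e then 1 else l0 e - b)"
    have d: "0 < d" using abt by (auto simp: d_def)
    show "\<forall>\<^sub>F r in at_right 0. r * real_of_int (if x \<in> {?\<gamma> a, ?\<gamma> b} then - 1 else 0) \<le> (\<Sum>y\<in>msphere \<Gamma> x r. g y - g x)"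
      using eventually_at_right_0_pos eventually_at_right_0_short[OF wm] eventually_at_right_0_less[OF d]
    proof eventually_elim
      case (elim r)
      then have r: "0 < r" "2 * r < l0 e" "r < d" using e by auto
      have fin: "finite (arcs G0)" using weighted_multigraph_finite_arcs[OF wm] .
      have rl: "r \<in> {0..l0 i}" "l0 i - r \<in> {0..l0 i}" if "i \<in> arcs G0" for i
        using elim that by auto
      have "(\<Sum>y\<in>msphere \<Gamma> x r. g y - g x) = (\<Sum>y\<in>msphere \<Gamma> x r. g y)" using gv[OF x] by simp
      also have "\<dots> = (\<Sum>i\<in>{i\<in>arcs G0. tail G0 i = x}. if i = e then \<kappa> r else 0)
          + (\<Sum>i\<in>{i\<in>arcs G0. head G0 i = x}. if i = e then \<kappa> (l0 e - r) else 0)"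
        using elim rl by (subst sum_msphere_Vertex[OF m x]) (auto intro!: arg_cong2[where f = "(+)"] sum.cong simp: ge)
      also have "\<dots> = (if tail G0 e = x then \<kappa> r else 0) + (if head G0 e = x then \<kappa> (l0 e - r) else 0)"
        using fin e by (simp add: sum.delta)
      finally have eq: "(\<Sum>y\<in>msphere \<Gamma> x r. g y - g x) = \<dots>" .
      \<comment> \<open>A loop could lose \<open>r\<close> at both of its ends, which would lower
        the coefficient to -2.\<close>
      have th: "tail G0 e \<noteq> head G0 e" using lf e by (simp add: loopfree_digraph_def loopfree_digraph_axioms_def)
      have \<kappa>r: "\<kappa> r = 0 \<or> a = 0 \<and> - r \<le> \<kappa> r"
        using r abt \<kappa>0[of r] by (cases "a = 0") (auto simp: d_def \<kappa>_def)
      have \<kappa>l: "\<kappa> (l0 e - r) = 0 \<or> b = l0 e \<and> - r \<le> \<kappa> (l0 e - r)"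
        using r abt \<kappa>0[of "l0 e - r"] by (cases "b = l0 e") (auto simp: d_def \<kappa>_def)
      have aux: "r * real_of_int (if M then - 1 else 0) \<le> u" if "u = 0 \<or> Q \<and> - r \<le> u" "Q \<Longrightarrow> M" for M Q u
        using that r(1) by auto
      consider "x = tail G0 e" "x \<noteq> head G0 e" | "x \<noteq> tail G0 e" "x = head G0 e" | "x \<noteq> tail G0 e" "x \<noteq> head G0 e"
        using th by metis
      then show ?case
      proof cases
        case 1
        then have S: "(\<Sum>y\<in>msphere \<Gamma> x r. g y - g x) = \<kappa> r" using eq by simp
        have "a = 0 \<Longrightarrow> x \<in> {?\<gamma> a, ?\<gamma> b}" using 1(1) model_via_tail[OF m e] by simp
        from aux[OF \<kappa>r this] show ?thesis unfolding S .
      next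
        case 2
        then have S: "(\<Sum>y\<in>msphere \<Gamma> x r. g y - g x) = \<kappa> (l0 e - r)" using eq by simp
        have "b = l0 e \<Longrightarrow> x \<in> {?\<gamma> a, ?\<gamma> b}" using 2(2) model_via_head[OF m e] by simp
        from aux[OF \<kappa>l this] show ?thesis unfolding S .
      next
        case 3
        then show ?thesis using eq r(1) by (cases "x \<in> {?\<gamma> a, ?\<gamma> b}") simp_all
      qed
    qed
  qed (use x model_via_verts[OF m] in auto)
  have inner: "(if z = a \<or> z = b then - 1 else if z = t then 1 else 0) \<le> Poly_Mapping.lookup E (\<phi>0 (Interior e z))"
    if z: "0 < z" "z < l0 e" for z
  proof (rule lower)
    \<comment> \<open>Radii below \<open>d\<close> stay inside the edge and do not reach
      \<open>a\<close> or \<open>b\<close> from another point. The bound \<open>d \<le> h\<close>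
      keeps a step from \<open>a\<close>, \<open>b\<close> or \<open>t\<close> along a slope of the
      tent on that slope.\<close>
    define d where "d = min (min z (l0 e - z)) (min h
      (min (if z = a then 1 else \<bar>z - a\<bar>) (if z = b then 1 else \<bar>z - b\<bar>)))"
    have d: "0 < d" using z h by (auto simp: d_def)
    have dle: "d \<le> z" "d \<le> l0 e - z" "d \<le> h" "z \<noteq> a \<Longrightarrow> d \<le> \<bar>z - a\<bar>" "z \<noteq> b \<Longrightarrow> d \<le> \<bar>z - b\<bar>"
      by (auto simp: d_def) linarith+
    show "\<forall>\<^sub>F r in at_right 0. r * real_of_int (if z = a \<or> z = b then - 1 else if z = t then 1 else 0)
        \<le> (\<Sum>y\<in>msphere \<Gamma> (\<phi>0 (Interior e z)) r. g y - g (\<phi>0 (Interior e z)))"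
      using eventually_at_right_0_pos eventually_at_right_0_less[OF d]
    proof eventually_elim
      case (elim r)
      have "(\<Sum>y\<in>msphere \<Gamma> (\<phi>0 (Interior e z)) r. g y - g (\<phi>0 (Interior e z)))
          = \<kappa> (z + r) + \<kappa> (z - r) - 2 * \<kappa> z"
        using elim dle z gi[OF e] by (subst sum_msphere_Interior[OF m e]) auto
      moreover have "r * real_of_int (if z = a \<or> z = b then - 1 else if z = t then 1 else 0)
          \<le> \<kappa> (z + r) + \<kappa> (z - r) - 2 * \<kappa> z"
      proof -
        consider "z = a" | "z = b" | "z < a" | "b < z" | "a < z" "z < b" "z = t" | "a < z" "z < b" "z \<noteq> t"
          by linarith
        then show ?thesis
        proof cases
          case 1
          have "\<kappa> a = 0" "\<kappa> (a - r) = 0" using \<kappa>0 elim by simp_all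
          moreover have "- r \<le> \<kappa> (a + r)" using elim h(1) unfolding \<kappa>_def by linarith
          ultimately show ?thesis using 1 by simp
        next
          case 2
          have "\<kappa> b = 0" "\<kappa> (b + r) = 0" using \<kappa>0 elim by simp_all
          moreover have "- r \<le> \<kappa> (b - r)" using elim h(1) unfolding \<kappa>_def by linarith
          ultimately show ?thesis using 2 by simp
        next
          case 3
          then have "z + r \<le> a" "z - r \<le> a" using elim dle(4) by auto
          then show ?thesis using 3 \<kappa>0 abt by simp
        next
          case 4
          then have "b \<le> z + r" "b \<le> z - r" using elim dle(5) by auto
          then show ?thesis using 4 \<kappa>0 abt by simp
        next
          \<comment> \<open>Parameter \<open>t\<close> is an end of the plateau, so the tent rises
            with slope 1 on at least one side; this is the chip that arrives.\<close>
          case 5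
          then have "\<kappa> z = - h" "- h \<le> \<kappa> (z + r)" "- h \<le> \<kappa> (z - r)"
            using h(1,4,5) unfolding \<kappa>_def by linarith+
          moreover have "- h + r \<le> \<kappa> (z + r) \<or> - h + r \<le> \<kappa> (z - r)"
            using h(3)
          proof
            assume "h = t - a"
            then have "- h + r \<le> \<kappa> (z - r)" using 5 elim dle(3) unfolding \<kappa>_def by linarith
            then show ?thesis ..
          next
            assume "h = b - t"
            then have "- h + r \<le> \<kappa> (z + r)" using 5 elim dle(3) unfolding \<kappa>_def by linarith
            then show ?thesis ..
          qed
          ultimately show ?thesis using 5 by auto
        next
          \<comment> \<open>Between \<open>a\<close> and \<open>b\<close> the tent is the maximum of
            three affine functions, hence convex.\<close>
          case 6
          then have "0 < z - r - a" "z + r < b" using elim dle by auto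
          then have r: "a < z - r" "z - r < b" "a < z + r" "z + r < b" using 6 elim(1) by auto
          have ge: "- h \<le> \<kappa> w" "a - w \<le> \<kappa> w" "w - b \<le> \<kappa> w" if "a < w" "w < b" for w
            using that h(1) unfolding \<kappa>_def by linarith+
          have "\<kappa> z = - h \<or> \<kappa> z = a - z \<or> \<kappa> z = z - b"
            using 6 h(1) unfolding \<kappa>_def by linarith
          then have "2 * \<kappa> z \<le> \<kappa> (z + r) + \<kappa> (z - r)" using ge[OF r(1,2)] ge[OF r(3,4)] by linarith
          then show ?thesis using 6 by simp
        qed
      qed
      ultimately show ?case by simp
    qed
  qed (use z e model_via_in_mspace[OF m, of "Interior e z"] in auto)
  have other: "0 \<le> Poly_Mapping.lookup E (\<phi>0 (Interior e' z))"
    if z: "e' \<in> arcs G0" "e' \<noteq> e" "0 < z" "z < l0 e'" for e' z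
  proof (rule lower)
    have pos: "0 < l0 e' - z" using z by simp
    show "\<forall>\<^sub>F r in at_right 0. r * real_of_int 0 \<le> (\<Sum>y\<in>msphere \<Gamma> (\<phi>0 (Interior e' z)) r. g y - g (\<phi>0 (Interior e' z)))"
      using eventually_at_right_0_pos eventually_at_right_0_less[OF z(3)] eventually_at_right_0_less[OF pos]
      by eventually_elim (use z gi[OF z(1)] in \<open>simp add: sum_msphere_Interior[OF m z(1)]\<close>)
  qed (use z model_via_in_mspace[OF m, of "Interior e' z"] in auto)
  show thesis
  proof (rule that[OF E])
    fix x
    show "(if x \<in> {?\<gamma> a, ?\<gamma> b} then - 1 else 0) \<le> Poly_Mapping.lookup E x"
    proof (cases "x \<in> mspace \<Gamma>")
      case False
      then have "Poly_Mapping.lookup E x = 0"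
        using principal_divisor_of_divisors[OF E] by (simp add: divisors_iff)
      then show ?thesis by simp
    next
      case True
      from m True show ?thesis
      proof (cases rule: model_via_cases)
        case 1
        then show ?thesis by (rule vert)
      next
        case (2 e' z)
        show ?thesis
        proof (cases "e' = e")
          case False
          then show ?thesis using other[of e' z] 2 by auto
        next
          case True
          then have x: "x = ?\<gamma> z" "x = \<phi>0 (Interior e z)" and z: "0 < z" "z < l0 e" using 2 by auto
          show ?thesis
          proof (cases "z = a \<or> z = b")
            case True
            then have "x \<in> {?\<gamma> a, ?\<gamma> b}" using x(1) by blast
            then show ?thesis using inner[OF z] True x(2) by simp
          next
            case False
            then have "0 \<le> (if z = a \<or> z = b then - 1 else if z = t then 1 else (0::int))" by simp
            also note inner[OF z]
            finally have "0 \<le> Poly_Mapping.lookup E x" unfolding x(2) .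
            then show ?thesis by simp
          qed
        qed
      qed
    qed
  next
    show "1 \<le> Poly_Mapping.lookup E (?\<gamma> t)" using inner[of t] abt by simp
  qed
qed

section \<open>Rank-determining vertices\<close>

lemma divisors_add: "D \<in> divisors \<Gamma> \<Longrightarrow> E \<in> divisors \<Gamma> \<Longrightarrow> D + E \<in> divisors \<Gamma>"
  and divisors_diff: "D \<in> divisors \<Gamma> \<Longrightarrow> E \<in> divisors \<Gamma> \<Longrightarrow> D - E \<in> divisors \<Gamma>"
  and divisors_single: "x \<in> mspace \<Gamma> \<Longrightarrow> Poly_Mapping.single x k \<in> divisors \<Gamma>"
  by (auto simp: divisors_iff lookup_add lookup_minus lookup_single when_def)

lemma divisor_degree_superset:
  "finite A \<Longrightarrow> Poly_Mapping.keys D \<subseteq> A \<Longrightarrow> divisor_degree D = (\<Sum>x\<in>A. Poly_Mapping.lookup D x)"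
  unfolding divisor_degree_def by (rule sum.mono_neutral_left) (auto simp: in_keys_iff)

lemma divisor_degree_diff: "divisor_degree (D - E) = divisor_degree D - divisor_degree E"
proof -
  let ?A = "Poly_Mapping.keys D \<union> Poly_Mapping.keys E"
  have "Poly_Mapping.keys (D - E) \<subseteq> ?A" by (auto simp: in_keys_iff lookup_minus)
  then show ?thesis
    using divisor_degree_superset[of ?A] by (simp add: lookup_minus sum_subtractf)
qed

lemma divisor_degree_single: "divisor_degree (Poly_Mapping.single x k) = k"
  using divisor_degree_superset[of "{x}" "Poly_Mapping.single x k"] by auto

lemma divisor_degree_nonneg: "effective D \<Longrightarrow> 0 \<le> divisor_degree D"
  by (auto simp: divisor_degree_def effective_def intro: sum_nonneg)

lemma effective_degree_0: "effective D \<Longrightarrow> divisor_degree D = 0 \<Longrightarrow> D = 0"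
  unfolding divisor_degree_def effective_def
  by (subst (asm) sum_nonneg_eq_0_iff) (auto simp: in_keys_iff intro!: poly_mapping_eqI)

lemma divisor_degree_principal:
  assumes "principal \<Gamma> D"
  shows "divisor_degree D = 0"
proof -
  obtain G l \<phi> s where m: "model_via \<Gamma> G l \<phi>" and D: "\<And>x. Poly_Mapping.lookup D x = outgoing_slope_sum G s x"
    using assms by (auto simp: principal_def principal_divisor_of_def)
  note wm = model_via_weighted[OF m]
  note fin = weighted_multigraph_finite_verts[OF wm] weighted_multigraph_finite_arcs[OF wm]
  have "Poly_Mapping.keys D \<subseteq> verts G"
    using outgoing_slope_sum_outside[OF m, of _ s] D by (fastforce simp: in_keys_iff)
  from divisor_degree_superset[OF fin(1) this]
  have "divisor_degree D = (\<Sum>x\<in>verts G. \<Sum>e\<in>{e\<in>arcs G. tail G e = x}. s e)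
      + (\<Sum>x\<in>verts G. \<Sum>e\<in>{e\<in>arcs G. head G e = x}. - s e)"
    by (simp add: D outgoing_slope_sum_def sum.distrib)
  also have "(\<Sum>x\<in>verts G. \<Sum>e\<in>{e\<in>arcs G. tail G e = x}. s e) = (\<Sum>e\<in>arcs G. s e)"
    by (rule sum.group) (use fin weighted_multigraph_tail[OF wm] in auto)
  also have "(\<Sum>x\<in>verts G. \<Sum>e\<in>{e\<in>arcs G. head G e = x}. - s e) = (\<Sum>e\<in>arcs G. - s e)"
    by (rule sum.group) (use fin weighted_multigraph_head[OF wm] in auto)
  finally show ?thesis by (simp add: sum_negf)
qed

text \<open>Nonemptiness of the complete linear system of \<open>C\<close>.\<close>

definition equiv_effective :: "'a metric \<Rightarrow> ('a \<Rightarrow>\<^sub>0 int) \<Rightarrow> bool" where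
  "equiv_effective \<Gamma> C \<longleftrightarrow> (\<exists>F\<in>divisors \<Gamma>. effective F \<and> equivalent \<Gamma> C F)"

text \<open>If \<open>p\<close> lies on the edge from \<open>u\<close> to \<open>v\<close>, start with effective divisors \<open>D1\<close> and \<open>D2\<close> with a
  chip at \<open>u\<close> and \<open>v\<close>, respectively, and let \<open>D2 - D1\<close> be the divisor of \<open>f\<close>. Adding the divisor of
  \<open>max f (f p)\<close> to \<open>D1\<close> gives an effective divisor such that \<open>f\<close> is locally constant at each point of
  its level set through \<open>p\<close> that carries no chip. So there are chips on both sides of \<open>p\<close> on the
  edge, and they can be moved towards each other until one of them reaches \<open>p\<close>.\<close>

lemma equiv_effective_point:
  assumes m: "model_via \<Gamma> G0 l0 \<phi>0" and lf: "loopfree_digraph G0"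
    and C: "\<And>a. a \<in> verts G0 \<Longrightarrow> equiv_effective \<Gamma> (C - Poly_Mapping.single a 1)"
    and p: "p \<in> mspace \<Gamma>"
  shows "equiv_effective \<Gamma> (C - Poly_Mapping.single p 1)"
  using m p
proof (cases rule: model_via_cases)
  case 1
  then show ?thesis by (rule C)
next
  case (2 e t)
  note wm = model_via_weighted[OF m]
  let ?\<gamma> = "\<lambda>z. \<phi>0 (edge_point G0 l0 e z)"
  have p_eq: "p = ?\<gamma> t" using 2 by simp
  have \<gamma>: "?\<gamma> z \<in> mspace \<Gamma>" if "z \<in> {0..l0 e}" for z by (rule model_via_edge_point[OF m 2(1) that])
  obtain F1 where F1: "F1 \<in> divisors \<Gamma>" "effective F1" "principal \<Gamma> (C - Poly_Mapping.single (?\<gamma> 0) 1 - F1)"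
    using C[OF weighted_multigraph_tail[OF wm 2(1)]] model_via_tail[OF m 2(1)]
    by (auto simp: equiv_effective_def equivalent_def)
  obtain F2 where F2: "F2 \<in> divisors \<Gamma>" "effective F2" "principal \<Gamma> (C - Poly_Mapping.single (?\<gamma> (l0 e)) 1 - F2)"
    using C[OF weighted_multigraph_head[OF wm 2(1)]] model_via_head[OF m 2(1)]
    by (auto simp: equiv_effective_def equivalent_def)
  define D1 where "D1 = F1 + Poly_Mapping.single (?\<gamma> 0) 1"
  define D2 where "D2 = F2 + Poly_Mapping.single (?\<gamma> (l0 e)) 1"
  have D1: "D1 \<in> divisors \<Gamma>" "0 \<le> Poly_Mapping.lookup D1 x" "1 \<le> Poly_Mapping.lookup D1 (?\<gamma> 0)" for x
    using F1 2 \<gamma>[of 0] by (auto simp: D1_def effective_def lookup_add lookup_single when_def simp del: edge_point_0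
        intro!: divisors_add divisors_single)
  have D2: "D2 \<in> divisors \<Gamma>" "0 \<le> Poly_Mapping.lookup D2 x" "1 \<le> Poly_Mapping.lookup D2 (?\<gamma> (l0 e))" for x
    using F2 2 \<gamma>[of "l0 e"] by (auto simp: D2_def effective_def lookup_add lookup_single when_def
        intro!: divisors_add divisors_single)
  have C1: "principal \<Gamma> (C - D1)" using F1(3) by (simp add: D1_def algebra_simps)
  have C2: "principal \<Gamma> (C - D2)" using F2(3) by (simp add: D2_def algebra_simps)
  have "principal \<Gamma> (D2 - D1)" using principal_diff[OF C1 C2] by simp
  then obtain f where f: "principal_divisor_of \<Gamma> f (D2 - D1)" by (auto simp: principal_def)
  define c where "c = f p"
  obtain E where E: "principal_divisor_of \<Gamma> (\<lambda>x. max (f x) c) E"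
    by (rule principal_divisor_of_max[OF f])
  note E' = max_divisor_bounds[OF f E]
  \<comment> \<open>Dominates \<open>D1\<close> where \<open>f \<le> c\<close> and \<open>D2\<close>
    where \<open>c \<le> f\<close>; together these bounds make it effective.\<close>
  define T where "T = D1 + E"
  have T1: "Poly_Mapping.lookup D1 x \<le> Poly_Mapping.lookup T x" if "x \<in> mspace \<Gamma>" "f x \<le> c" for x
    using E'(1)[OF that] by (simp add: T_def lookup_add)
  have T2: "Poly_Mapping.lookup D2 x \<le> Poly_Mapping.lookup T x" if "x \<in> mspace \<Gamma>" "c \<le> f x" for x
    using E'(2)[OF that] by (simp add: T_def lookup_add lookup_minus)
  have T_div: "T \<in> divisors \<Gamma>"
    unfolding T_def by (intro divisors_add D1(1) principal_divisor_of_divisors[OF E])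
  have T0: "0 \<le> Poly_Mapping.lookup T x" for x
  proof (cases "x \<in> mspace \<Gamma>")
    case True
    then show ?thesis using T1[of x] T2[of x] D1(2)[of x] D2(2)[of x] by linarith
  next
    case False
    then show ?thesis using T_div by (simp add: divisors_iff)
  qed
  have CT: "principal \<Gamma> (C - T)"
    using principal_diff[OF C1, of E] E by (auto simp: T_def principal_def algebra_simps)
  \<comment> \<open>If a segment containing \<open>p\<close> carried no chip of \<open>T\<close>,
    then \<open>f\<close> would be constantly \<open>c\<close> on it. There \<open>T\<close> would
    dominate both \<open>D1\<close> and \<open>D2\<close>, one of which has a chip at the parameter
    \<open>w\<close>.\<close>
  have chip: "\<exists>z\<in>{\<alpha>..\<beta>}. 1 \<le> Poly_Mapping.lookup T (?\<gamma> z)"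
    if seg: "0 \<le> \<alpha>" "\<beta> \<le> l0 e" "t \<in> {\<alpha>..\<beta>}" and w: "w \<in> {\<alpha>..\<beta>}"
      "1 \<le> Poly_Mapping.lookup D1 (?\<gamma> w) \<or> 1 \<le> Poly_Mapping.lookup D2 (?\<gamma> w)" for \<alpha> \<beta> w
  proof (rule ccontr)
    assume no: "\<not> ?thesis"
    have T_eq: "Poly_Mapping.lookup T (?\<gamma> z) = 0" if "z \<in> {\<alpha>..\<beta>}" for z
    proof -
      have "\<not> 1 \<le> Poly_Mapping.lookup T (?\<gamma> z)" using no that by blast
      then show ?thesis using T0[of "?\<gamma> z"] by linarith
    qed
    have sub: "z \<in> {0..l0 e}" if "z \<in> {\<alpha>..\<beta>}" for z using that seg by auto
    have "f (?\<gamma> w) = c"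
    proof (rule constant_on_segment[OF m 2(1) f seg _ _ w(1)])
      show "f (?\<gamma> t) = c" by (simp add: c_def p_eq)
      fix z assume z: "z \<in> {\<alpha>..\<beta>}" "f (?\<gamma> z) = c"
      let ?x = "?\<gamma> z"
      have x: "?x \<in> mspace \<Gamma>" using \<gamma> sub z(1) by blast
      have "Poly_Mapping.lookup D1 ?x = 0" "Poly_Mapping.lookup D2 ?x = 0"
        using T1[OF x] T2[OF x] D1(2)[of ?x] D2(2)[of ?x] T_eq[OF z(1)] z(2) by simp_all
      then show "\<forall>\<^sub>F r in at_right 0. \<forall>y\<in>msphere \<Gamma> ?x r. f y = c"
        using T_eq[OF z(1)] z(2) by (intro E'(3)[OF x]) (simp_all add: T_def lookup_add lookup_minus)
    qed
    then have "1 \<le> Poly_Mapping.lookup T (?\<gamma> w)"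
      using T1[OF \<gamma>[OF sub[OF w(1)]]] T2[OF \<gamma>[OF sub[OF w(1)]]] w(2) by auto
    then show False using T_eq[OF w(1)] by simp
  qed
  obtain a where a: "0 \<le> a" "a \<le> t" "1 \<le> Poly_Mapping.lookup T (?\<gamma> a)"
    using chip[of 0 t 0] D1(3) 2 by auto
  obtain b where b: "t \<le> b" "b \<le> l0 e" "1 \<le> Poly_Mapping.lookup T (?\<gamma> b)"
    using chip[of t "l0 e" "l0 e"] D2(3) 2 by auto
  \<comment> \<open>With a chip already at \<open>p\<close> nothing has to move; otherwise
    \<open>a\<close> and \<open>b\<close> lie strictly on either side of \<open>t\<close>, as the
    tent requires.\<close>
  have "\<exists>E'. principal \<Gamma> E' \<and> effective (T + E' - Poly_Mapping.single p 1)"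
  proof (cases "1 \<le> Poly_Mapping.lookup T p")
    case True
    then have "effective (T + 0 - Poly_Mapping.single p 1)"
      using T0 by (auto simp: effective_def lookup_add lookup_minus lookup_single when_def)
    then show ?thesis using principal_0[OF model_via_metric_graph[OF m]] by blast
  next
    case False
    then have "a \<noteq> t" "b \<noteq> t" using a b p_eq by auto
    then have "a < t" "t < b" using a b by auto
    then obtain g Eg where Eg: "principal_divisor_of \<Gamma> g Eg"
      "\<And>x. (if x \<in> {?\<gamma> a, ?\<gamma> b} then - 1 else 0) \<le> Poly_Mapping.lookup Eg x"
      "1 \<le> Poly_Mapping.lookup Eg (?\<gamma> t)"
      using tent_divisor[OF m lf 2(1) a(1) _ _ b(2)] by metis
    have "effective (T + Eg - Poly_Mapping.single p 1)"
      unfolding effective_def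
    proof
      fix x
      show "0 \<le> Poly_Mapping.lookup (T + Eg - Poly_Mapping.single p 1) x"
      proof (cases "x = p")
        case True
        then show ?thesis using T0[of p] Eg(3) p_eq by (simp add: lookup_add lookup_minus)
      next
        case False
        then have "Poly_Mapping.lookup (T + Eg - Poly_Mapping.single p 1) x
            = Poly_Mapping.lookup T x + Poly_Mapping.lookup Eg x"
          by (simp add: lookup_add lookup_minus lookup_single)
        moreover have "x \<in> {?\<gamma> a, ?\<gamma> b} \<Longrightarrow> 1 \<le> Poly_Mapping.lookup T x" using a(3) b(3) by blast
        ultimately show ?thesis using Eg(2)[of x] T0[of x] by (smt (verit))
      qed
    qed
    then show ?thesis using Eg(1) by (auto simp: principal_def)
  qed
  then obtain E' where E': "principal \<Gamma> E'" "effective (T + E' - Poly_Mapping.single p 1)" by blast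
  have "T + E' - Poly_Mapping.single p 1 \<in> divisors \<Gamma>"
    by (intro divisors_diff divisors_add T_div principal_divisors E' divisors_single p)
  moreover have "principal \<Gamma> (C - Poly_Mapping.single p 1 - (T + E' - Poly_Mapping.single p 1))"
    using principal_diff[OF CT E'(1)] by (simp add: algebra_simps)
  ultimately show ?thesis using E'(2) by (auto simp: equiv_effective_def equivalent_def)
qed

text \<open>Chips are moved to vertices one at a time. Taking a chip at \<open>p\<close> from
  \<open>E\<close> leaves \<open>E1\<close>; the induction hypothesis for \<open>C\<close> minus a
  chip at a vertex \<open>a\<close> handles \<open>E1\<close>, and
  \<open>equiv_effective_point\<close> then trades the vertices \<open>a\<close> for
  \<open>p\<close>. Hence \<open>C\<close> varies in the induction.\<close>

lemma equiv_effective_of_verts: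
  assumes m: "model_via \<Gamma> G0 l0 \<phi>0" and lf: "loopfree_digraph G0"
    and C: "\<And>E. \<lbrakk>Poly_Mapping.keys E \<subseteq> verts G0; effective E; divisor_degree E = int n\<rbrakk>
      \<Longrightarrow> equiv_effective \<Gamma> (C - E)"
    and E: "E \<in> divisors \<Gamma>" "effective E" "divisor_degree E = int n"
  shows "equiv_effective \<Gamma> (C - E)"
  using C E
proof (induction n arbitrary: C E)
  case 0
  then have "E = 0" by (intro effective_degree_0) simp_all
  then show ?case using 0(1)[of 0] 0(3,4) by simp
next
  case (Suc n)
  have "\<exists>p\<in>Poly_Mapping.keys E. 0 < Poly_Mapping.lookup E p"
  proof (rule ccontr)
    assume "\<not> ?thesis"
    then have "divisor_degree E \<le> 0"
      unfolding divisor_degree_def by (intro sum_nonpos) (auto simp: not_less)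
    then show False using Suc.prems by simp
  qed
  then obtain p where p: "p \<in> Poly_Mapping.keys E" "0 < Poly_Mapping.lookup E p" by blast
  have pm: "p \<in> mspace \<Gamma>" using p Suc.prems(2) by (auto simp: divisors_def)
  define E1 where "E1 = E - Poly_Mapping.single p 1"
  have E1: "E1 \<in> divisors \<Gamma>" "effective E1" "divisor_degree E1 = int n"
    using Suc.prems p pm unfolding E1_def
    by (auto simp: divisor_degree_diff divisor_degree_single effective_def lookup_minus lookup_single when_def
        intro!: divisors_diff divisors_single)
  have "equiv_effective \<Gamma> (C - E1 - Poly_Mapping.single p 1)"
  proof (rule equiv_effective_point[OF m lf _ pm])
    fix a assume a: "a \<in> verts G0"
    have "equiv_effective \<Gamma> ((C - Poly_Mapping.single a 1) - E1)"
    proof (rule Suc.IH[OF _ E1])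
      fix E' :: "'a \<Rightarrow>\<^sub>0 int"
      assume E': "Poly_Mapping.keys E' \<subseteq> verts G0" "effective E'" "divisor_degree E' = int n"
      have "Poly_Mapping.keys (E' + Poly_Mapping.single a 1) \<subseteq> verts G0"
        using E'(1) a by (auto simp: in_keys_iff lookup_add lookup_single when_def split: if_splits)
      moreover have "effective (E' + Poly_Mapping.single a 1)"
        using E'(2) by (auto simp: effective_def lookup_add lookup_single when_def)
      moreover have "divisor_degree (E' + Poly_Mapping.single a 1) = int (Suc n)"
        using E'(3) divisor_degree_diff[of "E' + Poly_Mapping.single a 1" "Poly_Mapping.single a 1"]
        by (simp add: divisor_degree_single)
      ultimately have "equiv_effective \<Gamma> (C - (E' + Poly_Mapping.single a 1))" by (rule Suc.prems(1))
      then show "equiv_effective \<Gamma> (C - Poly_Mapping.single a 1 - E')" by (simp add: algebra_simps)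
    qed
    then show "equiv_effective \<Gamma> (C - E1 - Poly_Mapping.single a 1)" by (simp add: algebra_simps)
  qed
  then show ?case by (simp add: E1_def)
qed

section \<open>The rank as a greatest element\<close>

definition rank_at_least :: "'a metric \<Rightarrow> ('a \<Rightarrow>\<^sub>0 int) \<Rightarrow> int \<Rightarrow> bool" where
  "rank_at_least \<Gamma> D k \<longleftrightarrow> (\<forall>E\<in>divisors \<Gamma>. effective E \<and> divisor_degree E = k \<longrightarrow> equiv_effective \<Gamma> (D - E))"

lemma divisor_rank_altdef: "divisor_rank \<Gamma> D = (GREATEST k. rank_at_least \<Gamma> D k)"
  by (simp add: divisor_rank_def rank_at_least_def equiv_effective_def)

text \<open>Test with \<open>k\<close> chips at one point: beyond the bound the difference has
  negative degree, while principal divisors have degree 0. The maximum with 0 makes such a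
  \<open>k\<close> positive, so that the test divisor is effective.\<close>

lemma rank_at_least_bounded:
  assumes "metric_graph \<Gamma>" "rank_at_least \<Gamma> D k"
  shows "k \<le> max 0 (divisor_degree D)"
proof (rule ccontr)
  assume k: "\<not> k \<le> max 0 (divisor_degree D)"
  obtain G l \<phi> where m: "model_via \<Gamma> G l \<phi>" using metric_graphE[OF assms(1)] .
  obtain x where x: "x \<in> mspace \<Gamma>"
    using weighted_multigraph_verts_nonempty[OF model_via_weighted[OF m]] model_via_verts[OF m] by blast
  let ?E = "Poly_Mapping.single x k"
  have "effective ?E" using k by (auto simp: effective_def lookup_single when_def)
  then have "equiv_effective \<Gamma> (D - ?E)"
    using assms(2)[unfolded rank_at_least_def, rule_format, OF divisors_single[OF x, of k]]
      divisor_degree_single[of x k] by blast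
  then obtain F where F: "effective F" "principal \<Gamma> (D - ?E - F)"
    by (auto simp: equiv_effective_def equivalent_def)
  then show False
    using divisor_degree_principal[OF F(2)] divisor_degree_nonneg[OF F(1)] k
    by (simp add: divisor_degree_diff divisor_degree_single)
qed

lemma rank_at_least_neg: "k < 0 \<Longrightarrow> rank_at_least \<Gamma> D k"
  using divisor_degree_nonneg by (force simp: rank_at_least_def)

text \<open>The value -1 always qualifies, vacuously, and the qualifying values are bounded above,
  so the maximum over a finite window starting at -1 is the greatest value overall.\<close>

lemma divisor_rank:
  assumes "metric_graph \<Gamma>"
  shows "rank_at_least \<Gamma> D (divisor_rank \<Gamma> D)"
    and "rank_at_least \<Gamma> D k \<Longrightarrow> k \<le> divisor_rank \<Gamma> D"
proof -
  let ?A = "{k \<in> {-1..max 0 (divisor_degree D)}. rank_at_least \<Gamma> D k}"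
  have fin: "finite ?A" by (rule finite_subset[of _ "{-1..max 0 (divisor_degree D)}"]) auto
  have "-1 \<in> ?A" using rank_at_least_neg[of "-1" \<Gamma> D] by simp
  then have ne: "?A \<noteq> {}" by blast
  have M: "rank_at_least \<Gamma> D (Max ?A)" "-1 \<le> Max ?A" using Max_in[OF fin ne] by auto
  have le: "k \<le> Max ?A" if "rank_at_least \<Gamma> D k" for k
  proof (cases "- 1 \<le> k")
    case True
    then show ?thesis using rank_at_least_bounded[OF assms that] that by (intro Max_ge[OF fin]) auto
  next
    case False
    then show ?thesis using M(2) by simp
  qed
  have "divisor_rank \<Gamma> D = Max ?A"
    unfolding divisor_rank_altdef by (rule Greatest_equality) (use M le in auto)
  then show "rank_at_least \<Gamma> D (divisor_rank \<Gamma> D)" "rank_at_least \<Gamma> D k \<Longrightarrow> k \<le> divisor_rank \<Gamma> D"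
    using M le by auto
qed

section \<open>Rational length vectors\<close>

text \<open>Take a basis of the reals over the rationals that contains 1, fix 1 and move every other
  basis element to a nearby rational. How near is dictated by the coordinates of the finitely many
  elements of \<open>X\<close>.\<close>

lemma rational_linear_approximation:
  fixes X :: "real set"
  assumes X: "finite X" and \<epsilon>: "0 < \<epsilon>"
  obtains T :: "real \<Rightarrow> real" where "\<And>x y. T (x + y) = T x + T y"
    "\<And>q x. q \<in> \<rat> \<Longrightarrow> T (q * x) = q * T x" "T 1 = 1"
    "\<And>x. x \<in> X \<Longrightarrow> T x \<in> \<rat>" "\<And>x. x \<in> X \<Longrightarrow> \<bar>T x - x\<bar> < \<epsilon>"
proof -
  define sc where "sc = (\<lambda>(q::rat) (x::real). of_rat q * x)"
  interpret Q: vector_space sc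
    by unfold_locales (simp_all add: sc_def distrib_left distrib_right of_rat_add of_rat_mult mult.assoc)
  interpret QQ: vector_space_pair sc sc by unfold_locales
  define B where "B = Q.extend_basis {1}"
  have one: "Q.independent {1}" by simp
  have B: "1 \<in> B" "Q.independent B" "Q.span B = UNIV"
    using Q.extend_basis_superset[OF one] Q.independent_extend_basis[OF one] Q.span_extend_basis[OF one]
    by (auto simp: B_def)
  define R where "R = (\<lambda>x b. real_of_rat (Q.representation B x b))"
  define N where "N = (\<lambda>x. {b. Q.representation B x b \<noteq> 0})"
  have N: "finite (N x)" "N x \<subseteq> B" for x
    using Q.finite_representation Q.representation_ne_zero by (auto simp: N_def)
  \<comment> \<open>Exceeds the sum of the absolute coordinates of each element of \<open>X\<close>,
    so moving basis elements by less than \<open>\<epsilon> / M\<close> moves the elements of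
    \<open>X\<close> by less than \<open>\<epsilon>\<close>. The summand 1 makes \<open>M\<close>
    positive and the bound strict.\<close>
  define M where "M = 1 + (\<Sum>x\<in>X. \<Sum>b\<in>N x. \<bar>R x b\<bar>)"
  have M: "0 < M" by (auto simp: M_def intro!: add_pos_nonneg sum_nonneg)
  have "\<exists>r. r \<in> \<rat> \<and> \<bar>r - b\<bar> < \<epsilon> / M" for b :: real
  proof -
    have "b - \<epsilon> / M < b + \<epsilon> / M" using M \<epsilon> by simp
    then obtain r where "r \<in> \<rat>" "b - \<epsilon> / M < r" "r < b + \<epsilon> / M" using Rats_dense_in_real by blast
    then show ?thesis by (intro exI[of _ r]) auto
  qed
  then obtain r where r: "\<And>b. r b \<in> \<rat>" "\<And>b::real. \<bar>r b - b\<bar> < \<epsilon> / M" by metis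
  obtain T where lin: "Vector_Spaces.linear sc sc T" and T: "\<forall>b\<in>B. T b = (r(1 := 1)) b"
    using QQ.linear_independent_extend[OF B(2), of "r(1 := 1)"] by blast
  interpret T: Vector_Spaces.linear sc sc T by fact
  have close: "\<bar>(r(1 := 1)) b - b\<bar> < \<epsilon> / M" for b using r(2) M \<epsilon> by simp
  have xN: "x = (\<Sum>b\<in>N x. R x b * b)" for x
    using Q.sum_nonzero_representation_eq[OF B(2), of x] B(3) by (simp add: N_def R_def sc_def)
  have TN: "T x = (\<Sum>b\<in>N x. R x b * (r(1 := 1)) b)" for x
  proof -
    have "T x = T (\<Sum>b\<in>N x. sc (Q.representation B x b) b)"
      using Q.sum_nonzero_representation_eq[OF B(2), of x] B(3) by (simp add: N_def)
    also have "\<dots> = (\<Sum>b\<in>N x. sc (Q.representation B x b) (T b))"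
      by (simp add: T.sum T.scale)
    also have "\<dots> = (\<Sum>b\<in>N x. R x b * (r(1 := 1)) b)"
    proof (rule sum.cong)
      fix b assume "b \<in> N x"
      then have "T b = (r(1 := 1)) b" using T N(2) by blast
      then show "sc (Q.representation B x b) (T b) = R x b * (r(1 := 1)) b" by (simp only: sc_def R_def)
    qed simp
    finally show ?thesis .
  qed
  show thesis
  proof (rule that)
    show "T (x + y) = T x + T y" for x y by (rule T.add)
    show "T (q * x) = q * T x" if "q \<in> \<rat>" for q x
      using that T.scale by (auto elim!: Rats_cases simp: sc_def)
    show "T 1 = 1" using T B(1) by simp
    show "T x \<in> \<rat>" if "x \<in> X" for x
      unfolding TN using r(1) by (intro Rats_sum Rats_mult) (auto simp: R_def)
    show "\<bar>T x - x\<bar> < \<epsilon>" if x: "x \<in> X" for x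
    proof -
      have "T x - x = (\<Sum>b\<in>N x. R x b * ((r(1 := 1)) b - b))"
        by (subst (2) xN, subst TN) (simp add: right_diff_distrib sum_subtractf)
      then have "\<bar>T x - x\<bar> \<le> (\<Sum>b\<in>N x. \<bar>R x b\<bar> * \<bar>(r(1 := 1)) b - b\<bar>)"
        by (simp add: sum_abs flip: abs_mult del: fun_upd_apply)
      also have "\<dots> \<le> (\<Sum>b\<in>N x. \<bar>R x b\<bar> * (\<epsilon> / M))"
        by (intro sum_mono mult_left_mono less_imp_le[OF close]) simp
      also have "\<dots> = (\<Sum>b\<in>N x. \<bar>R x b\<bar>) * (\<epsilon> / M)" by (rule sum_distrib_right[symmetric])
      also have "(\<Sum>b\<in>N x. \<bar>R x b\<bar>) < M"
        using member_le_sum[OF x _ X, of "\<lambda>x. \<Sum>b\<in>N x. \<bar>R x b\<bar>"] by (simp add: M_def sum_nonneg)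
      then have "(\<Sum>b\<in>N x. \<bar>R x b\<bar>) * (\<epsilon> / M) < M * (\<epsilon> / M)"
        using M \<epsilon> by (intro mult_strict_right_mono) auto
      also have "\<dots> = \<epsilon>" using M by simp
      finally show ?thesis .
    qed
  qed
qed

text \<open>A model whose vertices are named by points of its own glued space.\<close>

definition lift_verts :: "('v, 'e) pre_digraph \<Rightarrow> (('v, 'e) point, 'e) pre_digraph" where
  "lift_verts G = \<lparr>verts = Vertex ` verts G, arcs = arcs G, tail = Vertex \<circ> tail G, head = Vertex \<circ> head G\<rparr>"

definition unlift :: "(('v, 'e) point, 'e) point \<Rightarrow> ('v, 'e) point" where
  "unlift x = (case x of Vertex y \<Rightarrow> y | Interior e t \<Rightarrow> Interior e t)"

lemma lift_verts_simps [simp]: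
  "verts (lift_verts G) = Vertex ` verts G" "arcs (lift_verts G) = arcs G"
  "tail (lift_verts G) e = Vertex (tail G e)" "head (lift_verts G) e = Vertex (head G e)"
  by (simp_all add: lift_verts_def)

lemma unlift_edge_point: "unlift (edge_point (lift_verts G) l e t) = edge_point G l e t"
  by (simp add: unlift_def edge_point_def)

lemma weighted_multigraph_lift_verts:
  assumes wm: "weighted_multigraph G l"
  shows "weighted_multigraph (lift_verts G) l"
proof -
  interpret fin_digraph G by (rule weighted_multigraph_fin_digraph[OF wm])
  interpret L: fin_digraph "lift_verts G" by unfold_locales auto
  have con: "\<And>S. S \<subseteq> verts G \<Longrightarrow> S \<noteq> {} \<Longrightarrow> \<forall>g\<in>arcs G. tail G g \<in> S \<longleftrightarrow> head G g \<in> S \<Longrightarrow> S = verts G"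
    and ne: "verts G \<noteq> {}"
    using wm connected_iff_closed[OF wf_digraph] by (auto simp: weighted_multigraph_def)
  have "S = Vertex ` verts G" if S: "S \<subseteq> Vertex ` verts G" "S \<noteq> {}"
    "\<forall>e\<in>arcs G. Vertex (tail G e) \<in> S \<longleftrightarrow> Vertex (head G e) \<in> S" for S :: "('a, 'b) point set"
  proof -
    obtain S' where S': "S' \<subseteq> verts G" "S = Vertex ` S'" using S(1) by (auto simp: subset_image_iff)
    then have "S' = verts G" using S(2,3) by (intro con) (auto simp: image_iff)
    then show ?thesis using S' by simp
  qed
  then have "Digraph_Component.connected (lift_verts G)"
    using ne by (subst connected_iff_closed[OF L.wf_digraph]) auto
  then show ?thesis using weighted_multigraph_pos[OF wm] L.fin_digraph by (simp add: weighted_multigraph_def)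
qed

lemma isometry_unlift:
  assumes wm: "weighted_multigraph G l"
  shows "isometry (metric_graph_of (lift_verts G) l) (metric_graph_of G l) unlift"
proof (rule isometry_of_path_lengths[where \<xi> = "\<lambda>x. case x of Vertex v \<Rightarrow> Vertex (Vertex v) | Interior e t \<Rightarrow> Interior e t"])
  let ?\<xi> = "\<lambda>x. case x of Vertex v \<Rightarrow> Vertex (Vertex v) | Interior e t \<Rightarrow> Interior e t"
  note wm' = weighted_multigraph_lift_verts[OF wm]
  show "weighted_multigraph (lift_verts G) l" "weighted_multigraph G l" by fact+
  show inv: "?\<xi> (unlift x) = x" if "x \<in> points (lift_verts G) l" for x
    using that by (cases x) (auto simp: unlift_def)
  show "bij_betw unlift (points (lift_verts G) l) (points G l)"
  proof (rule bij_betw_byWitness[of _ ?\<xi>])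
    show "\<forall>y\<in>points G l. unlift (?\<xi> y) = y" by (auto simp: unlift_def split: point.split)
    show "unlift ` points (lift_verts G) l \<subseteq> points G l"
      by (auto simp: unlift_def split: point.split)
    show "?\<xi> ` points G l \<subseteq> points (lift_verts G) l" by (auto split: point.split)
  qed (use inv in blast)
  fix e s t
  show "path_length G l (unlift (edge_point (lift_verts G) l e s)) (unlift (edge_point (lift_verts G) l e t)) \<bar>t - s\<bar>"
    if "e \<in> arcs (lift_verts G)" "s \<in> {0..l e}" "t \<in> {0..l e}"
    using path_length_edge_points[OF wm, of e s t] that by (simp add: unlift_edge_point)
  have "?\<xi> (edge_point G l e u) = edge_point (lift_verts G) l e u" for u
    by (simp add: edge_point_def)
  then show "path_length (lift_verts G) l (?\<xi> (edge_point G l e s)) (?\<xi> (edge_point G l e t)) \<bar>t - s\<bar>"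
    if "e \<in> arcs G" "s \<in> {0..l e}" "t \<in> {0..l e}"
    using path_length_edge_points[OF wm', of e s t] that by simp
qed

text \<open>Vertices of a model have to be points of the space, so \<open>G\<close> itself is not a
  model of the space glued from it; the vertex \<open>v\<close> has to be renamed to
  \<open>Vertex v\<close>.\<close>

lemma model_via_lift_verts:
  fixes G :: "('a, nat) pre_digraph"
  assumes "weighted_multigraph G l"
  shows "model_via (metric_graph_of G l) (lift_verts G) l unlift"
  using assms by (auto simp: model_via_def weighted_multigraph_lift_verts isometry_unlift unlift_def)

lemma outgoing_slope_sum_lift_verts:
  "outgoing_slope_sum (lift_verts G) s (Vertex v) = outgoing_slope_sum G s v"
  "outgoing_slope_sum (lift_verts G) s (Interior e t) = 0"
  by (simp_all add: outgoing_slope_sum_def)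

text \<open>The new function has the values \<open>T (f v)\<close> at the vertices and the old
  slopes along the arcs. These fit together because \<open>T\<close> commutes with the integer
  factor \<open>s e\<close>, and unchanged slopes give the same coefficients. Composing
  \<open>f\<close> with \<open>T\<close> along an arc would not do, as \<open>T\<close> need not be
  continuous.\<close>

lemma principal_rescaling:
  fixes G :: "('a, nat) pre_digraph" and T :: "real \<Rightarrow> real"
  assumes m: "model_via \<Gamma> G l \<phi>" and s: "has_slopes G l \<phi> f s"
    and add: "\<And>x y. T (x + y) = T x + T y" and scale: "\<And>q x. q \<in> \<rat> \<Longrightarrow> T (q * x) = q * T x"
    and pos: "\<And>e. e \<in> arcs G \<Longrightarrow> 0 < T (l e)"
    and D: "\<And>v. Poly_Mapping.lookup D (Vertex v) = outgoing_slope_sum G s v"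
      "\<And>e t. Poly_Mapping.lookup D (Interior e t) = 0"
  shows "principal (metric_graph_of G (T \<circ> l)) D"
proof -
  let ?l = "T \<circ> l"
  note wm = model_via_weighted[OF m]
  have wm': "weighted_multigraph G ?l" using wm pos by (simp add: weighted_multigraph_def)
  define F where "F = (\<lambda>v. T (f v))"
  define f' where "f' = (\<lambda>x. case x of Vertex v \<Rightarrow> F v | Interior e t \<Rightarrow> F (tail G e) + s e * t)"
  have F: "F (head G e) = F (tail G e) + s e * T (l e)" if e: "e \<in> arcs G" for e
  proof -
    have le: "0 < l e" by (rule weighted_multigraph_pos[OF wm e])
    then have "f (\<phi> (edge_point G l e (l e))) = f (\<phi> (edge_point G l e 0)) + s e * l e"
      using s[unfolded has_slopes_def, rule_format, OF e, of "l e"] by (simp del: edge_point_0)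
    then have "f (head G e) = f (tail G e) + s e * l e"
      unfolding model_via_head[OF m e] model_via_tail[OF m e] .
    then show ?thesis using add[of "f (tail G e)" "s e * l e"] scale[of "s e" "l e"] by (simp add: F_def)
  qed
  have f': "f' (edge_point G ?l e t) = F (tail G e) + s e * t" if "e \<in> arcs G" "t \<in> {0..?l e}" for e and t :: real
    using that F by (auto simp: edge_point_def f'_def)
  have "has_slopes (lift_verts G) ?l unlift f' s"
    unfolding has_slopes_def unlift_edge_point
  proof (intro ballI)
    fix e and t :: real assume e: "e \<in> arcs (lift_verts G)" "t \<in> {0..?l e}"
    then have "0 \<in> {0..?l e}" by auto
    then show "f' (edge_point G ?l e t) = f' (edge_point G ?l e 0) + s e * t"
      using f'[of e t] f'[of e 0] e by (simp del: edge_point_0)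
  qed
  moreover have "Poly_Mapping.lookup D x = outgoing_slope_sum (lift_verts G) s x" for x
    by (cases x) (simp_all add: D outgoing_slope_sum_lift_verts)
  ultimately show ?thesis
    using model_via_lift_verts[OF wm'] unfolding principal_def principal_divisor_of_def by blast
qed

section \<open>Transfer of the rank to the rescaled graph\<close>

lemma finite_effective_divisors:
  assumes V: "finite V"
  shows "finite {E. Poly_Mapping.keys E \<subseteq> V \<and> effective E \<and> divisor_degree E = k}" (is "finite ?\<E>")
proof (rule finite_imageD)
  have "Poly_Mapping.lookup E x \<in> {0..k}" if E: "E \<in> ?\<E>" and x: "x \<in> V" for E x
  proof -
    have "Poly_Mapping.lookup E x \<le> (\<Sum>x\<in>V. Poly_Mapping.lookup E x)"
      using E x V by (intro member_le_sum) (auto simp: effective_def)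
    then show ?thesis using E divisor_degree_superset[OF V, of E] by (simp add: effective_def)
  qed
  then have "(\<lambda>E. restrict (Poly_Mapping.lookup E) V) ` ?\<E> \<subseteq> PiE V (\<lambda>_. {0..k})"
    unfolding image_subset_iff restrict_PiE_iff by blast
  moreover have "finite (PiE V (\<lambda>_. {0..k}))" using V by (intro finite_PiE) auto
  ultimately show "finite ((\<lambda>E. restrict (Poly_Mapping.lookup E) V) ` ?\<E>)" by (rule finite_subset)
  show "inj_on (\<lambda>E. restrict (Poly_Mapping.lookup E) V) ?\<E>"
  proof (rule inj_onI)
    fix E F assume E: "E \<in> ?\<E>" and F: "F \<in> ?\<E>"
      and eq: "restrict (Poly_Mapping.lookup E) V = restrict (Poly_Mapping.lookup F) V"
    show "E = F"
    proof (rule poly_mapping_eqI)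
      fix x
      show "Poly_Mapping.lookup E x = Poly_Mapping.lookup F x"
      proof (cases "x \<in> V")
        case True
        then show ?thesis using fun_cong[OF eq, of x] by simp
      next
        case False
        then have "x \<notin> Poly_Mapping.keys E" "x \<notin> Poly_Mapping.keys F" using E F by auto
        then show ?thesis by (simp add: in_keys_iff)
      qed
    qed
  qed
qed

lemma rank_rescaling:
  fixes \<Gamma> :: "'a metric"
  assumes m0: "model_via \<Gamma> G0 l0 \<phi>0" and lf: "loopfree_digraph G0" and D: "D \<in> divisors \<Gamma>"
  obtains G l l' where "model \<Gamma> G l" "loopfree_digraph G" "Poly_Mapping.keys D \<subseteq> verts G"
    "\<forall>e\<in>arcs G. 0 < l' e \<and> l' e \<in> \<rat>"
    "divisor_rank \<Gamma> D \<le> divisor_rank (metric_graph_of G l') (rescaled_divisor D)"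
    "(\<forall>e\<in>arcs G0. l0 e \<in> \<rat>) \<Longrightarrow> isometric (metric_graph_of G l') \<Gamma>"
proof -
  define k where "k = divisor_rank \<Gamma> D"
  have rk: "rank_at_least \<Gamma> D k"
    unfolding k_def by (rule divisor_rank(1)[OF model_via_metric_graph[OF m0]])
  define \<E> where "\<E> = {E. Poly_Mapping.keys E \<subseteq> verts G0 \<and> effective E \<and> divisor_degree E = k}"
  have fin: "finite \<E>"
    unfolding \<E>_def by (intro finite_effective_divisors weighted_multigraph_finite_verts[OF model_via_weighted[OF m0]])
  have "\<forall>E\<in>\<E>. \<exists>F. F \<in> divisors \<Gamma> \<and> effective F \<and> (\<exists>f. principal_divisor_of \<Gamma> f (D - E - F))"
    using rk model_via_verts[OF m0]
    by (auto simp: rank_at_least_def \<E>_def equiv_effective_def equivalent_def principal_def divisors_def)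
  from bchoice[OF this] obtain F where
    F: "\<forall>E\<in>\<E>. F E \<in> divisors \<Gamma> \<and> effective (F E) \<and> (\<exists>f. principal_divisor_of \<Gamma> f (D - E - F E))" ..
  then have "\<forall>E\<in>\<E>. \<exists>f. principal_divisor_of \<Gamma> f (D - E - F E)" by blast
  from bchoice[OF this] obtain f where f: "\<forall>E\<in>\<E>. principal_divisor_of \<Gamma> (f E) (D - E - F E)" ..
  \<comment> \<open>The supports of \<open>D\<close> and of all \<open>F E\<close> have to consist
    of vertices of \<open>G\<close> for these divisors to be carried over to the rescaled
    graph.\<close>
  define P where "P = Poly_Mapping.keys D \<union> (\<Union>E\<in>\<E>. Poly_Mapping.keys (F E))"
  have P: "finite P" "P \<subseteq> mspace \<Gamma>"
    using fin D F by (auto simp: P_def divisors_def)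
  obtain G l \<phi> s where ref: "refinement G0 l0 \<phi>0 G l \<phi>" and PG: "P \<subseteq> verts G"
    and s: "\<And>E. E \<in> \<E> \<Longrightarrow> has_slopes G l \<phi> (f E) (s E)"
      "\<And>E x. E \<in> \<E> \<Longrightarrow> Poly_Mapping.lookup (D - E - F E) x = outgoing_slope_sum G (s E) x"
    by (rule ex_common_model[where f = f and D = "\<lambda>E. D - E - F E", OF m0 fin bspec[OF f] P])
      (assumption, rule that, assumption+)
  have m: "model_via \<Gamma> G l \<phi>" by (rule refinement_model_via[OF ref m0])
  note wm = model_via_weighted[OF m]
  note wm0 = model_via_weighted[OF m0]
  have finA: "finite (arcs G)" by (rule weighted_multigraph_finite_arcs[OF wm])
  \<comment> \<open>An error below the shortest arc length keeps the new lengths positive; 1 is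
    inserted for a graph without arcs.\<close>
  define \<epsilon> where "\<epsilon> = Min (insert 1 (l ` arcs G))"
  have \<epsilon>: "0 < \<epsilon>" "\<And>e. e \<in> arcs G \<Longrightarrow> \<epsilon> \<le> l e"
    using finA weighted_multigraph_pos[OF wm] by (auto simp: \<epsilon>_def)
  obtain T where T: "\<And>x y. T (x + y) = T x + T y" "\<And>q x. q \<in> \<rat> \<Longrightarrow> T (q * x) = q * T x" "T 1 = 1"
    "\<And>x. x \<in> l ` arcs G \<Longrightarrow> T x \<in> \<rat>" "\<And>x. x \<in> l ` arcs G \<Longrightarrow> \<bar>T x - x\<bar> < \<epsilon>"
    using rational_linear_approximation[of "l ` arcs G" \<epsilon>] finA \<epsilon>(1) by blast
  let ?l = "T \<circ> l" and ?base = "T \<circ> l0"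
  let ?\<Gamma> = "metric_graph_of G ?l" and ?D = "rescaled_divisor D :: ('a, nat) point \<Rightarrow>\<^sub>0 int"
  have pos: "0 < T (l e)" "T (l e) \<in> \<rat>" if "e \<in> arcs G" for e
    using T(4)[of "l e"] T(5)[of "l e"] \<epsilon>(2)[OF that] that by auto
  have wm': "weighted_multigraph G ?l" using wm pos by (simp add: weighted_multigraph_def)
  have T0: "T 0 = 0" using T(1)[of 0 0] by simp
  have Tsum: "T (\<Sum>i\<in>A. g i) = (\<Sum>i\<in>A. T (g i))" for A and g :: "nat \<Rightarrow> real"
    by (induction A rule: infinite_finite_induct) (simp_all add: T(1) T0)
  obtain S where S: "\<forall>e\<in>arcs G0. S e \<subseteq> arcs G \<and> S e \<noteq> {} \<and> l0 e = (\<Sum>i\<in>S e. l i)"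
    and iso: "\<forall>m m0. (\<forall>g\<in>arcs G. 0 < m g) \<longrightarrow> (\<forall>e\<in>arcs G0. m0 e = (\<Sum>i\<in>S e. m i)) \<longrightarrow>
      (\<exists>\<psi>. isometry (metric_graph_of G m) (metric_graph_of G0 m0) \<psi> \<and>
        (\<forall>v\<in>verts G0. \<psi> (Vertex v) = Vertex v))"
    using refinement_rescaling[OF ref m0] by blast
  have l0: "\<forall>e\<in>arcs G0. ?base e = (\<Sum>i\<in>S e. ?l i)" using S Tsum by simp
  have "\<forall>g\<in>arcs G. 0 < ?l g" using pos by simp
  with iso l0 obtain \<psi> where \<psi>: "isometry ?\<Gamma> (metric_graph_of G0 ?base) \<psi>"
    "\<forall>v\<in>verts G0. \<psi> (Vertex v) = Vertex v" by blast
  have "0 < ?base e" if e: "e \<in> arcs G0" for e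
  proof -
    have "0 < (\<Sum>i\<in>S e. ?l i)"
      using S e pos finite_subset[OF _ finA] by (intro sum_pos) auto
    then show ?thesis using l0 e by simp
  qed
  then have wm0': "weighted_multigraph G0 ?base" using wm0 by (simp add: weighted_multigraph_def)
  \<comment> \<open>The rescaled space has \<open>G0\<close> with the summed lengths as a loopless
    model, so the same vertices determine the rank there.\<close>
  have m0': "model_via ?\<Gamma> (lift_verts G0) ?base (inv_into (mspace ?\<Gamma>) \<psi> \<circ> unlift)"
  proof -
    have "inv_into (mspace ?\<Gamma>) \<psi> (Vertex u) = Vertex u" if u: "u \<in> verts G0" for u
    proof -
      have "Vertex u \<in> mspace ?\<Gamma>"
        using u refinement_verts[OF ref] by (auto simp: mspace_metric_graph_of[OF wm'])
      moreover have "inj_on \<psi> (mspace ?\<Gamma>)" using \<psi>(1) by (simp add: isometry_def bij_betw_def)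
      ultimately show ?thesis using inv_into_f_f[of \<psi> "mspace ?\<Gamma>" "Vertex u"] \<psi>(2) u by simp
    qed
    then show ?thesis
      using isometry_comp[OF isometry_unlift[OF wm0'] isometry_inv[OF \<psi>(1)]]
        weighted_multigraph_lift_verts[OF wm0'] by (auto simp: model_via_def unlift_def)
  qed
  have lf': "loopfree_digraph (lift_verts G0)"
    using lf by (auto simp: loopfree_digraph_def loopfree_digraph_axioms_def wf_digraph_def)
  have mG: "metric_graph ?\<Gamma>" by (rule model_via_metric_graph[OF m0'])
  have "rank_at_least ?\<Gamma> ?D k"
    unfolding rank_at_least_def
  proof (intro ballI impI, elim conjE)
    fix E' assume E': "E' \<in> divisors ?\<Gamma>" "effective E'" "divisor_degree E' = k"
    \<comment> \<open>An effective divisor of degree \<open>k\<close> is at hand, so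
      \<open>k\<close> is nonnegative; for rank -1 there is nothing to test.\<close>
    then have k: "k = int (nat k)" using divisor_degree_nonneg by fastforce
    show "equiv_effective ?\<Gamma> (?D - E')"
    proof (rule equiv_effective_of_verts[OF m0' lf', where n = "nat k"])
      fix E' :: "('a, nat) point \<Rightarrow>\<^sub>0 int"
      assume E': "Poly_Mapping.keys E' \<subseteq> verts (lift_verts G0)" "effective E'" "divisor_degree E' = int (nat k)"
      \<comment> \<open>Pulled back to \<open>\<Gamma>\<close>, the test divisor is one of the
        finitely many for which a function has been chosen.\<close>
      define E where "E = Poly_Mapping.map_key Vertex E'"
      have inj: "inj (Vertex :: 'a \<Rightarrow> ('a, nat) point)" by (auto intro: injI)
      have E_lookup: "Poly_Mapping.lookup E v = Poly_Mapping.lookup E' (Vertex v)" for v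
        using map_key.rep_eq[OF inj, of E'] by (simp add: E_def)
      have "divisor_degree E = (\<Sum>v\<in>verts G0. Poly_Mapping.lookup E v)"
        using E'(1) weighted_multigraph_finite_verts[OF wm0]
        by (intro divisor_degree_superset) (auto simp: in_keys_iff E_lookup)
      also have "\<dots> = (\<Sum>x\<in>Vertex ` verts G0. Poly_Mapping.lookup E' x)"
        by (subst sum.reindex) (auto simp: E_lookup intro: inj_onI)
      also have "\<dots> = divisor_degree E'"
        using E'(1) weighted_multigraph_finite_verts[OF wm0]
        by (intro divisor_degree_superset[symmetric]) auto
      finally have deg: "divisor_degree E = k" using E'(3) k by simp
      have E: "E \<in> \<E>"
        using E'(1,2) deg by (auto simp: \<E>_def effective_def in_keys_iff E_lookup)
      let ?F = "rescaled_divisor (F E) :: ('a, nat) point \<Rightarrow>\<^sub>0 int"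
      have "effective ?F"
        unfolding effective_def
      proof
        fix x show "0 \<le> Poly_Mapping.lookup ?F x"
          using F E by (cases x) (auto simp: lookup_rescaled_divisor effective_def)
      qed
      moreover have "?F \<in> divisors ?\<Gamma>"
      proof -
        have "Poly_Mapping.keys (F E) \<subseteq> verts G" using PG E unfolding P_def by blast
        then have "x \<in> points G ?l" if "x \<in> Poly_Mapping.keys ?F" for x
          using that by (cases x) (auto simp: in_keys_iff lookup_rescaled_divisor)
        then show ?thesis by (auto simp: divisors_def mspace_metric_graph_of[OF wm'])
      qed
      moreover have "principal ?\<Gamma> (?D - E' - ?F)"
      proof (rule principal_rescaling[OF m s(1)[OF E] T(1,2) pos(1)])
        show "Poly_Mapping.lookup (?D - E' - ?F) (Vertex v) = outgoing_slope_sum G (s E) v" for v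
          using s(2)[OF E, of v] by (simp add: lookup_minus lookup_rescaled_divisor E_lookup)
        have "Interior e t \<notin> Poly_Mapping.keys E'" for e t using E'(1) by auto
        then show "Poly_Mapping.lookup (?D - E' - ?F) (Interior e t) = 0" for e t
          by (simp add: lookup_minus lookup_rescaled_divisor in_keys_iff)
      qed
      ultimately show "equiv_effective ?\<Gamma> (?D - E')" by (auto simp: equiv_effective_def equivalent_def)
    qed (use E' k in auto)
  qed
  then have rank: "divisor_rank \<Gamma> D \<le> divisor_rank ?\<Gamma> ?D"
    unfolding k_def by (rule divisor_rank(2)[OF mG])
  have "isometric ?\<Gamma> \<Gamma>" if rat: "\<forall>e\<in>arcs G0. l0 e \<in> \<rat>"
  proof -
    have "metric_graph_of G0 ?base = metric_graph_of G0 l0"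
    proof (rule metric_graph_of_cong)
      fix e assume "e \<in> arcs G0"
      then show "?base e = l0 e" using T(2)[of "l0 e" 1] T(3) rat by simp
    qed
    then show ?thesis
      using isometry_comp[OF \<psi>(1)] m0 by (auto simp: isometric_def model_via_def)
  qed
  moreover have "model \<Gamma> G l" using m by (auto simp: model_def)
  moreover have "loopfree_digraph G" by (rule refinement_loopfree[OF ref m0 lf])
  moreover have "Poly_Mapping.keys D \<subseteq> verts G" using PG by (auto simp: P_def)
  moreover have "\<forall>e\<in>arcs G. 0 < ?l e \<and> ?l e \<in> \<rat>" using pos by simp
  ultimately show thesis using that rank by blast
qed

theorem theorem3p3:
  fixes \<Gamma> :: "'a metric" and D :: "'a \<Rightarrow>\<^sub>0 int"
  assumes "metric_graph \<Gamma>" and "D \<in> divisors \<Gamma>" and "effective D"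
  shows "(\<exists>G l l'. model \<Gamma> G l \<and> loopfree_digraph G \<and> Poly_Mapping.keys D \<subseteq> verts G \<and>
            (\<forall>e\<in>arcs G. 0 < l' e \<and> l' e \<in> \<rat>) \<and>
            divisor_rank (metric_graph_of G l') (rescaled_divisor D) \<ge> divisor_rank \<Gamma> D)
       \<and> (metric_Q_graph \<Gamma> \<longrightarrow>
          (\<exists>G l l'. model \<Gamma> G l \<and> loopfree_digraph G \<and> Poly_Mapping.keys D \<subseteq> verts G \<and>
            (\<forall>e\<in>arcs G. 0 < l' e \<and> l' e \<in> \<rat>) \<and>
            divisor_rank (metric_graph_of G l') (rescaled_divisor D) \<ge> divisor_rank \<Gamma> D \<and>
            isometric (metric_graph_of G l') \<Gamma>))"
proof (intro conjI impI)
  obtain G0 l0 \<phi>0 where "model_via \<Gamma> G0 l0 \<phi>0" by (rule metric_graphE[OF assms(1)])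
  then obtain G1 l1 \<phi>1 where "model_via \<Gamma> G1 l1 \<phi>1" "loopfree_digraph G1"
    by (rule ex_loopfree_model)
  from rank_rescaling[OF this assms(2)]
  show "\<exists>G l l'. model \<Gamma> G l \<and> loopfree_digraph G \<and> Poly_Mapping.keys D \<subseteq> verts G \<and>
            (\<forall>e\<in>arcs G. 0 < l' e \<and> l' e \<in> \<rat>) \<and>
            divisor_rank (metric_graph_of G l') (rescaled_divisor D) \<ge> divisor_rank \<Gamma> D"
    by metis
next
  assume "metric_Q_graph \<Gamma>"
  then obtain G0 l0 \<phi>0 where "model_via \<Gamma> G0 l0 \<phi>0" and rat: "\<forall>e\<in>arcs G0. l0 e \<in> \<rat>"
    by (auto simp: metric_Q_graph_def model_def)
  then obtain G1 l1 \<phi>1 where m: "model_via \<Gamma> G1 l1 \<phi>1" "loopfree_digraph G1"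
    and rat: "\<forall>e\<in>arcs G1. l1 e \<in> \<rat>" by (metis ex_loopfree_model)
  from rank_rescaling[OF m assms(2)] rat
  show "\<exists>G l l'. model \<Gamma> G l \<and> loopfree_digraph G \<and> Poly_Mapping.keys D \<subseteq> verts G \<and>
            (\<forall>e\<in>arcs G. 0 < l' e \<and> l' e \<in> \<rat>) \<and>
            divisor_rank (metric_graph_of G l') (rescaled_divisor D) \<ge> divisor_rank \<Gamma> D \<and>
            isometric (metric_graph_of G l') \<Gamma>"
    by metis
qed

end
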